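(* For $\vec{x}=(a,b,c,d,e,f,g)^T\in V$, $$S(d-c)\,A(1-a,e-a,f-a,g-a)\,A(1-a,1-b,1-c,1-d)\,A(b,1+b-e,1+b-f,1+b-g)\,K_{p_0}(\vec{x})$$ $$-\,A(1-c,e-c,f-c,g-c)\,B_1(a,b,d,c,e,f,g)\,L_{\overline{1}}(\vec{x})+A(1-d,e-d,f-d,g-d)\,B_1(\vec{x})\,L_{\overline{2}}(\vec{x})=0.$$
   Context: $V=\{(a,b,c,d,e,f,g)^T\in\mathbb{C}^7: e+f+g-a-b-c-d=1\}$. ${}_4F_3\left[\begin{smallmatrix}a,b,c,d\\ e,f,g\end{smallmatrix};1\right]=\sum_{n\ge0}\frac{(a)_n(b)_n(c)_n(d)_n}{n!(e)_n(f)_n(g)_n}$, with $(a)_n$ the rising factorial. For $(a,b,c,d,e,f,g)^T\in V$, $$K(a;b,c,d;e,f,g)=\frac{{}_4F_3\left[\begin{smallmatrix}a,b,c,d\\ e,f,g\end{smallmatrix};1\right]}{\sin\pi a\,\Gamma(a)\Gamma(1+a-e)\Gamma(1+a-f)\Gamma(1+a-g)\Gamma(e)\Gamma(f)\Gamma(g)}+\frac{{}_4F_3\left[\begin{smallmatrix}a,1+a-e,1+a-f,1+a-g\\ 1+a-b,1+a-c,1+a-d\end{smallmatrix};1\right]}{\sin\pi a\,\Gamma(a)\Gamma(b)\Gamma(c)\Gamma(d)\Gamma(1+a-b)\Gamma(1+a-c)\Gamma(1+a-d)},$$ $$L(a,b,c,d;e;f,g)=\frac{{}_4F_3\left[\begin{smallmatrix}a,b,c,d\\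 e,f,g\end{smallmatrix};1\right]}{\sin\pi e\,\Gamma(1+a-e)\Gamma(1+b-e)\Gamma(1+c-e)\Gamma(1+d-e)\Gamma(e)\Gamma(f)\Gamma(g)}-\frac{{}_4F_3\left[\begin{smallmatrix}1+a-e,1+b-e,1+c-e,1+d-e\\ 2-e,1+f-e,1+g-e\end{smallmatrix};1\right]}{\sin\pi e\,\Gamma(a)\Gamma(b)\Gamma(c)\Gamma(d)\Gamma(2-e)\Gamma(1+f-e)\Gamma(1+g-e)}.$$ Notation: $S(a_1,\dots,a_n)=\sin\pi a_1\cdots\sin\pi a_n$; $A(x,y,z,w)=\frac{1}{\Gamma(x)\Gamma(y)\Gamma(z)\Gamma(w)}$ (with $1/\Gamma=0$ at nonpositive integers). The relation is asserted for those $\vec{x}\in V$ at which the $K$ and $L$ functions occurring are defined (no lower parameter of an occurring series is a nonpositive integer, no sine in an occurring denominator vanishes). Here $K_{p_0}(\vec{x})=K(a;b,c,d;e,f,g)$, $L_{\overline{1}}(\vec{x})=L(1-a,e-a,f-a,g-a;1+d-a;1+c-a,1+b-a)$, $L_{\overline{2}}(\vec{x})=L(1-a,e-a,f-a,g-a;1+c-a;1+b-a,1+d-a)$, and $B_1(\vec{x})=B_1(a,b,c,d,e,f,g)=\pi^{-4}S(b,c)\,[S(b-a,c-a,d)+S(e-a,f-a,g-a)]$. *)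

theory Defs
  imports "HOL-Analysis.Analysis"
begin

type_synonym complex7 = "complex \<times> complex \<times> complex \<times> complex \<times> complex \<times> complex \<times> complex"

definition V :: "complex7 set" where
  "V = {(a, b, c, d, e, f, g). e + f + g - a - b - c - d = 1}"

(* The series 4F3[a,b,c,d; e,f,g; 1]; meaningful when no lower parameter is a nonpositive integer. *)
definition hyp4F3 ::
  "complex \<Rightarrow> complex \<Rightarrow> complex \<Rightarrow> complex \<Rightarrow> complex \<Rightarrow> complex \<Rightarrow> complex \<Rightarrow> complex" where
  "hyp4F3 a b c d e f g =
     (\<Sum>n. (pochhammer a n * pochhammer b n * pochhammer c n * pochhammer d n) /
           (fact n * pochhammer e n * pochhammer f n * pochhammer g n))"

definition sinpi :: "complex \<Rightarrow> complex" where
  "sinpi z = sin (of_real pi * z)"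

definition S :: "complex list \<Rightarrow> complex" where
  "S zs = (\<Prod>z\<leftarrow>zs. sinpi z)"

(* Throughout, 1/Gamma is the entire function rGamma, which vanishes at the nonpositive integers. *)
definition A :: "complex \<Rightarrow> complex \<Rightarrow> complex \<Rightarrow> complex \<Rightarrow> complex" where
  "A x y z w = rGamma x * rGamma y * rGamma z * rGamma w"

(* K a b c d e f g stands for K(a; b,c,d; e,f,g). *)
definition K ::
  "complex \<Rightarrow> complex \<Rightarrow> complex \<Rightarrow> complex \<Rightarrow> complex \<Rightarrow> complex \<Rightarrow> complex \<Rightarrow> complex" where
  "K a b c d e f g =
     hyp4F3 a b c d e f g / sinpi a
       * (rGamma a * rGamma (1 + a - e) * rGamma (1 + a - f) * rGamma (1 + a - g)
          * rGamma e * rGamma f * rGamma g)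
   + hyp4F3 a (1 + a - e) (1 + a - f) (1 + a - g) (1 + a - b) (1 + a - c) (1 + a - d) / sinpi a
       * (rGamma a * rGamma b * rGamma c * rGamma d
          * rGamma (1 + a - b) * rGamma (1 + a - c) * rGamma (1 + a - d))"

definition K_defined ::
  "complex \<Rightarrow> complex \<Rightarrow> complex \<Rightarrow> complex \<Rightarrow> complex \<Rightarrow> complex \<Rightarrow> complex \<Rightarrow> bool" where
  "K_defined a b c d e f g \<longleftrightarrow>
     sinpi a \<noteq> 0 \<and> {e, f, g, 1 + a - b, 1 + a - c, 1 + a - d} \<inter> \<int>\<^sub>\<le>\<^sub>0 = {}"

(* L a b c d e f g stands for L(a,b,c,d; e; f,g). *)
definition L ::
  "complex \<Rightarrow> complex \<Rightarrow> complex \<Rightarrow> complex \<Rightarrow> complex \<Rightarrow> complex \<Rightarrow> complex \<Rightarrow> complex" where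
  "L a b c d e f g =
     hyp4F3 a b c d e f g / sinpi e
       * (rGamma (1 + a - e) * rGamma (1 + b - e) * rGamma (1 + c - e) * rGamma (1 + d - e)
          * rGamma e * rGamma f * rGamma g)
   - hyp4F3 (1 + a - e) (1 + b - e) (1 + c - e) (1 + d - e) (2 - e) (1 + f - e) (1 + g - e) / sinpi e
       * (rGamma a * rGamma b * rGamma c * rGamma d
          * rGamma (2 - e) * rGamma (1 + f - e) * rGamma (1 + g - e))"

definition L_defined ::
  "complex \<Rightarrow> complex \<Rightarrow> complex \<Rightarrow> complex \<Rightarrow> complex \<Rightarrow> complex \<Rightarrow> complex \<Rightarrow> bool" where
  "L_defined a b c d e f g \<longleftrightarrow>
     sinpi e \<noteq> 0 \<and> {e, f, g, 2 - e, 1 + f - e, 1 + g - e} \<inter> \<int>\<^sub>\<le>\<^sub>0 = {}"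

fun K_p0 :: "complex7 \<Rightarrow> complex" where
  "K_p0 (a, b, c, d, e, f, g) = K a b c d e f g"

fun K_p0_defined :: "complex7 \<Rightarrow> bool" where
  "K_p0_defined (a, b, c, d, e, f, g) \<longleftrightarrow> K_defined a b c d e f g"

fun L_1bar :: "complex7 \<Rightarrow> complex" where
  "L_1bar (a, b, c, d, e, f, g) =
     L (1 - a) (e - a) (f - a) (g - a) (1 + d - a) (1 + c - a) (1 + b - a)"

fun L_1bar_defined :: "complex7 \<Rightarrow> bool" where
  "L_1bar_defined (a, b, c, d, e, f, g) \<longleftrightarrow>
     L_defined (1 - a) (e - a) (f - a) (g - a) (1 + d - a) (1 + c - a) (1 + b - a)"

fun L_2bar :: "complex7 \<Rightarrow> complex" where
  "L_2bar (a, b, c, d, e, f, g) =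
     L (1 - a) (e - a) (f - a) (g - a) (1 + c - a) (1 + b - a) (1 + d - a)"

fun L_2bar_defined :: "complex7 \<Rightarrow> bool" where
  "L_2bar_defined (a, b, c, d, e, f, g) \<longleftrightarrow>
     L_defined (1 - a) (e - a) (f - a) (g - a) (1 + c - a) (1 + b - a) (1 + d - a)"

fun B1 :: "complex7 \<Rightarrow> complex" where
  "B1 (a, b, c, d, e, f, g) =
     S [b, c] * (S [b - a, c - a, d] + S [e - a, f - a, g - a]) / of_real pi ^ 4"

end

theory Submission
  imports Defs "HOL-Computational_Algebra.Formal_Power_Series"
begin

text \<open>
  Write \<open>F\<^sub>0\<close> for the first series in \<open>K\<close> and \<open>G\<^sub>x\<close>, for \<open>x\<close> among \<open>a, b, c, d\<close>, for the series with
  upper parameters \<open>x, 1+x-e, 1+x-f, 1+x-g\<close>; thus \<open>K\<close> is a combination of \<open>F\<^sub>0\<close> and \<open>G\<^sub>a\<close>.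

  The coefficients of the Wronskian of two local solutions at \<open>0\<close> of the hypergeometric equation are, up to a
  constant, those of the Wronskian of the complementary pair of solutions of the adjoint equation
  (Jacobi's theorem on complementary minors); the powers of \<open>1-z\<close> cancel because the series are
  Saalschuetzian. Comparing the leading asymptotics of these coefficients gives
  \<open>L(a,b,c,d;e;f,g) = L(f-a,f-b,f-c,f-d;1+f-g;f,1+f-e)\<close>, which turns the two \<open>L\<close> functions of
  the theorem into combinations of \<open>G\<^sub>b, G\<^sub>c\<close> and of \<open>G\<^sub>b, G\<^sub>d\<close>.

  Truncating \<open>\<Gamma>(a+s)\<Gamma>(b+s)\<Gamma>(c+s)\<Gamma>(d+s) / (\<Gamma>(1+s)\<Gamma>(e+s)\<Gamma>(f+s)\<Gamma>(g+s))\<close> to a rational function of \<open>s\<close>,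
  the sum of its residues and the sum of its values at integers yield in the limit two linear relations
  between \<open>F\<^sub>0, G\<^sub>a, G\<^sub>b, G\<^sub>c, G\<^sub>d\<close>. The theorem is a combination of these two relations,
  by a trigonometric identity, as long as certain linear forms in the parameters are not integers. The
  remaining parameters are limits of such generic ones.
\<close>

section \<open>Wronskians of solutions and of adjoint solutions\<close>

text \<open>All series are evaluated at the singular point 1, on the boundary of the disc of
  convergence. The Wronskian identity is therefore kept formal, as an identity between power series
  coefficients, and values at 1 are recovered from growth: for two sequences of order n^-2, n times
  the n-th Wronskian coefficient converges, and its limit pairs the sum of each series with the
  asymptotic constant of the other. This pairing is exactly the shape of \<open>L\<close>. In the
  same spirit, exact partial fractions followed by dominated limits take the place of a Barnes
  contour integral.

  Once everything is written in the four normalized residue series, the first series of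
  \<open>K\<close> enters with weights cot(pi a), ..., cot(pi d), and the coefficients of the four
  residue series in the theorem all turn out to be equal. The left-hand side is then a multiple of
  their vanishing sum. Only the coefficient belonging to b needs a serious trigonometric identity.

  Simple poles and distinct exponents require non-integral differences, while the theorem admits,
  for example, a positive integer e. This is why a passage to the limit concludes the proof.\<close>

text \<open>The Euler operator \<open>z d/dz\<close> conjugated by \<open>z\<^sup>r\<close>: it represents the action on
  \<open>z\<^sup>r u(z)\<close>.\<close>

definition theta :: "complex \<Rightarrow> complex fps \<Rightarrow> complex fps" where
  "theta r u = fps_X * fps_deriv u + fps_const r * u"

lemma theta_nth: "fps_nth (theta r u) n = (of_nat n + r) * fps_nth u n"
  by (cases n) (simp_all add: theta_def algebra_simps)

lemma theta_add: "theta r (u + v) = theta r u + theta r v"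
  and theta_diff: "theta r (u - v) = theta r u - theta r v"
  by (simp_all add: theta_def algebra_simps)

lemma theta_mult: "theta (r + s) (u * v) = theta r u * v + u * theta s v"
  by (simp add: theta_def algebra_simps flip: fps_const_add)

lemma theta_eq_0D:
  assumes "theta r u = 0" "\<And>n. of_nat n + r \<noteq> 0"
  shows "u = 0"
proof (rule fps_ext)
  fix n
  have "(of_nat n + r) * fps_nth u n = 0"
    using assms(1) by (simp flip: theta_nth)
  then show "fps_nth u n = fps_nth 0 n"
    using assms(2)[of n] by simp
qed

text \<open>Lagrange's identity: the concomitant is annihilated by \<open>z d/dz\<close>, and the exponent \<open>s + r\<close> excludes
  nonzero constants.\<close>

lemma bilinear_concomitant_eq_0:
  fixes u w p0 p1 p2 p3 p4 :: "complex fps" and r s :: complex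
  defines "x3 \<equiv> p4 * w"
  defines "x2 \<equiv> p3 * w - theta s x3"
  defines "x1 \<equiv> p2 * w - theta s x2"
  defines "x0 \<equiv> p1 * w - theta s x1"
  assumes ode: "p0 * u + p1 * theta r u + p2 * theta r (theta r u)
      + p3 * theta r (theta r (theta r u)) + p4 * theta r (theta r (theta r (theta r u))) = 0"
    and adj: "theta s x0 = p0 * w"
    and nz: "\<And>n. of_nat n + (s + r) \<noteq> 0"
  shows "x0 * u + x1 * theta r u + x2 * theta r (theta r u) + x3 * theta r (theta r (theta r u)) = 0"
proof (rule theta_eq_0D[OF _ nz])
  have x: "theta s x3 = p3 * w - x2" "theta s x2 = p2 * w - x1" "theta s x1 = p1 * w - x0"
    by (simp_all add: x0_def x1_def x2_def)
  have "theta (s + r) (x0 * u + x1 * theta r u + x2 * theta r (theta r u)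
        + x3 * theta r (theta r (theta r u)))
      = w * (p0 * u + p1 * theta r u + p2 * theta r (theta r u)
        + p3 * theta r (theta r (theta r u)) + p4 * theta r (theta r (theta r (theta r u))))"
    unfolding theta_add theta_mult x adj by (simp add: x3_def algebra_simps)
  then show "theta (s + r) (x0 * u + x1 * theta r u + x2 * theta r (theta r u)
        + x3 * theta r (theta r (theta r u))) = 0"
    by (simp add: ode)
qed

text \<open>The form \<open>y3 * x - x3 * y\<close> has no last component and annihilates both u and
  v. Eliminating its component 0 between these two relations leaves the claim. No division occurs,
  so the minors may vanish.\<close>

lemma complementary_minors:
  fixes u0 u1 u2 u3 v0 v1 v2 v3 :: "'a::comm_ring_1"
  assumes "x0 * u0 + x1 * u1 + x2 * u2 + x3 * u3 = 0" "x0 * v0 + x1 * v1 + x2 * v2 + x3 * v3 = 0"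
    "y0 * u0 + y1 * u1 + y2 * u2 + y3 * u3 = 0" "y0 * v0 + y1 * v1 + y2 * v2 + y3 * v3 = 0"
  shows "(u0 * v1 - u1 * v0) * (x1 * y3 - x3 * y1) + (u0 * v2 - u2 * v0) * (x2 * y3 - x3 * y2) = 0"
proof -
  have "(u0 * v1 - u1 * v0) * (x1 * y3 - x3 * y1) + (u0 * v2 - u2 * v0) * (x2 * y3 - x3 * y2)
    = y3 * (u0 * (x0 * v0 + x1 * v1 + x2 * v2 + x3 * v3) - v0 * (x0 * u0 + x1 * u1 + x2 * u2 + x3 * u3))
    - x3 * (u0 * (y0 * v0 + y1 * v1 + y2 * v2 + y3 * v3) - v0 * (y0 * u0 + y1 * u1 + y2 * u2 + y3 * u3))"
    by (simp add: algebra_simps)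
  then show ?thesis by (simp add: assms)
qed

text \<open>Both Wronskians obey the same first-order equation. Up to the factor
  \<open>p4 * p4\<close>, \<open>N\<close> is a minor of the concomitant coefficients; its
  derivative involves a neighbouring minor, which \<open>complementary_minors\<close> trades for the
  derivative of \<open>M\<close>. In general an integrating factor made of \<open>p3\<close> and
  \<open>p4\<close> would separate \<open>M\<close> from \<open>N\<close>; hypothesis
  \<open>bal\<close> says that this factor is trivial.\<close>

lemma wronskian_adjoint_proportional:
  fixes u v w z p0 p1 p2 p3 p4 :: "complex fps" and r r' s s' :: complex
  defines "adj \<equiv> \<lambda>s w. theta s (p1 * w - theta s (p2 * w - theta s (p3 * w - theta s (p4 * w)))) = p0 * w"
  defines "ode \<equiv> \<lambda>r u. p0 * u + p1 * theta r u + p2 * theta r (theta r u)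
      + p3 * theta r (theta r (theta r u)) + p4 * theta r (theta r (theta r (theta r u))) = 0"
  assumes ode: "ode r u" "ode r' v" and adj: "adj s w" "adj s' z"
    and nz: "\<And>n. of_nat n + (s + r) \<noteq> 0" "\<And>n. of_nat n + (s' + r) \<noteq> 0"
      "\<And>n. of_nat n + (s + r') \<noteq> 0" "\<And>n. of_nat n + (s' + r') \<noteq> 0"
    and p4: "p4 \<noteq> 0"
    and bal: "2 * theta 0 p4 + fps_const (s + s' - r - r') * p4 = p3"
  defines "M \<equiv> u * theta r' v - theta r u * v"
  defines "N \<equiv> w * theta s' z - theta s w * z"
  shows "fps_deriv N * M = N * fps_deriv M"
proof -
  define x3 x2 x1 x0 where
    x: "x3 = p4 * w" "x2 = p3 * w - theta s x3" "x1 = p2 * w - theta s x2" "x0 = p1 * w - theta s x1"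
  define y3 y2 y1 y0 where
    y: "y3 = p4 * z" "y2 = p3 * z - theta s' y3" "y1 = p2 * z - theta s' y2" "y0 = p1 * z - theta s' y1"
  define M2 where "M2 = u * theta r' (theta r' v) - theta r (theta r u) * v"
  have tM: "theta (r + r') M = M2"
    unfolding M_def M2_def theta_diff theta_mult by (simp add: algebra_simps)
  have "M * (x1 * y3 - x3 * y1) + M2 * (x2 * y3 - x3 * y2) = 0"
    unfolding M_def M2_def
  proof (rule complementary_minors[of x0 u x1 "theta r u" x2 "theta r (theta r u)" x3
        "theta r (theta r (theta r u))" v "theta r' v" "theta r' (theta r' v)"
        "theta r' (theta r' (theta r' v))" y0 y1 y2 y3])
  qed (use bilinear_concomitant_eq_0[OF ode(1)[unfolded ode_def] adj(1)[unfolded adj_def] nz(1)]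
      bilinear_concomitant_eq_0[OF ode(2)[unfolded ode_def] adj(1)[unfolded adj_def] nz(3)]
      bilinear_concomitant_eq_0[OF ode(1)[unfolded ode_def] adj(2)[unfolded adj_def] nz(2)]
      bilinear_concomitant_eq_0[OF ode(2)[unfolded ode_def] adj(2)[unfolded adj_def] nz(4)]
      in \<open>simp_all add: x y\<close>)
  then have pl: "M * (x1 * y3 - x3 * y1) = - (M2 * (x2 * y3 - x3 * y2))"
    by (simp add: eq_neg_iff_add_eq_0)
  have tp4w: "theta s (p4 * w) = theta 0 p4 * w + p4 * theta s w"
    "theta s' (p4 * z) = theta 0 p4 * z + p4 * theta s' z"
    using theta_mult[of 0 s p4 w] theta_mult[of 0 s' p4 z] by simp_all
  have N': "x2 * y3 - x3 * y2 = p4 * p4 * N"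
    unfolding x y N_def tp4w by (simp add: algebra_simps)
  have xs: "theta s x3 = p3 * w - x2" "theta s x2 = p2 * w - x1"
     "theta s' y3 = p3 * z - y2" "theta s' y2 = p2 * z - y1"
    by (simp_all add: x y)
  \<comment> \<open>The recursion defining the concomitant coefficients lowers one index of the
    minor. The two terms \<open>x2 * y2\<close> cancel here, and those with \<open>p2\<close> cancel
    in the next step because \<open>x3\<close> and \<open>y3\<close> are multiples of
    \<open>w\<close> and \<open>z\<close> by the same series.\<close>
  have "theta (s + s') (x2 * y3 - x3 * y2)
      = (p2 * w - x1) * y3 + x2 * (p3 * z - y2) - (p3 * w - x2) * y2 - x3 * (p2 * z - y1)"
    unfolding theta_diff theta_mult xs by (simp add: algebra_simps)
  also have "\<dots> = - (x1 * y3 - x3 * y1) + p3 * (x2 * z - w * y2)"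
    unfolding x(1) y(1) by (simp add: algebra_simps)
  finally have t: "theta (s + s') (x2 * y3 - x3 * y2)
      = - (x1 * y3 - x3 * y1) + p3 * (x2 * z - w * y2)" .
  have q: "x2 * y3 - x3 * y2 = p4 * (x2 * z - w * y2)"
    by (simp add: x(1) y(1) algebra_simps)
  have "p4 * theta (s + s') (x2 * y3 - x3 * y2)
      = - p4 * (x1 * y3 - x3 * y1) + p3 * (p4 * (x2 * z - w * y2))"
    unfolding t by (simp add: algebra_simps)
  then have "p4 * theta (s + s') (x2 * y3 - x3 * y2)
      = - p4 * (x1 * y3 - x3 * y1) + p3 * (x2 * y3 - x3 * y2)"
    by (simp only: q)
  then have "M * (p4 * theta (s + s') (p4 * p4 * N))
      = p4 * (M2 * (p4 * p4 * N)) + M * p3 * (p4 * p4 * N)"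
    using pl unfolding N' by algebra
  moreover have "theta (s + s') (p4 * p4 * N)
      = 2 * theta 0 p4 * p4 * N + p4 * p4 * theta (s + s') N"
    using theta_mult[of 0 "s + s'" "p4 * p4" N] theta_mult[of 0 0 p4 p4]
    by (simp add: algebra_simps)
  ultimately have "(p4 * p4 * p4) * (M * theta (s + s') N)
      = (p4 * p4 * p4) * (theta (r + r') M * N) + (p3 - 2 * theta 0 p4) * (p4 * p4) * (M * N)"
    unfolding tM by (simp add: algebra_simps)
  also have "(p3 - 2 * theta 0 p4) = fps_const (s + s' - r - r') * p4"
    by (simp flip: bal)
  finally have "(p4 * p4 * p4) * (M * theta (s + s') N)
      = (p4 * p4 * p4) * (theta (r + r') M * N + fps_const (s + s' - r - r') * (M * N))"
    by (simp add: algebra_simps)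
  then have "M * theta (s + s') N = theta (r + r') M * N + fps_const (s + s' - r - r') * (M * N)"
    using p4 by simp
  \<comment> \<open>The constants in the three \<open>theta\<close> terms add up to zero, so plain
    derivatives remain.\<close>
  then have "fps_X * (fps_deriv N * M) = fps_X * (N * fps_deriv M)"
    by (simp add: theta_def algebra_simps flip: fps_const_add fps_const_sub)
  then show ?thesis by simp
qed

lemma fps_proportional_if_deriv:
  fixes M N :: "complex fps"
  assumes "fps_deriv N * M = N * fps_deriv M" "fps_nth N 0 \<noteq> 0"
  shows "fps_const (fps_nth N 0) * M = fps_const (fps_nth M 0) * N"
proof -
  have N: "N * inverse N = 1"
    using inverse_mult_eq_1[OF assms(2)] by (simp add: mult.commute)
  have "fps_deriv (M * inverse N) * (N * N) = 0"
    using assms N by (simp add: fps_inverse_deriv algebra_simps power2_eq_square)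
       (metis (no_types, lifting) mult.assoc mult.commute mult_1)
  moreover have "N \<noteq> 0" using assms(2) by auto
  ultimately have "fps_deriv (M * inverse N) = 0" by simp
  then have c: "M * inverse N = fps_const (fps_nth (M * inverse N) 0)"
    using fps_deriv_eq_0_iff by metis
  then have "fps_const (fps_nth N 0) * M = fps_const (fps_nth N 0 * fps_nth (M * inverse N) 0) * N"
    using N by (metis (no_types, lifting) fps_const_mult mult.assoc mult.commute mult_1)
  also have "fps_nth N 0 * fps_nth (M * inverse N) 0 = fps_nth M 0"
    using assms(2) by simp
  finally show ?thesis .
qed

section \<open>Coefficient recursions for the hypergeometric equation and its adjoint\<close>

lemma fps_nth_linear_mult:
  fixes u :: "complex fps"
  shows "fps_nth ((fps_const p - fps_X * fps_const q) * u) 0 = p * fps_nth u 0"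
    "fps_nth ((fps_const p - fps_X * fps_const q) * u) (Suc n) = p * fps_nth u (Suc n) - q * fps_nth u n"
  by (simp_all add: left_diff_distrib mult.assoc)

text \<open>The operator is Q(theta) - z S(theta) for two quartic polynomials with coefficients
  \<open>q0\<close>, ..., \<open>q4\<close> and \<open>s0\<close>, ..., \<open>s4\<close>. The first
  hypothesis is the indicial equation; the second compares coefficients, where Q is taken at the new
  exponent and S at the old one.\<close>

lemma hypergeometric_odeI:
  fixes u :: "complex fps"
  assumes "q0 + q1 * r + q2 * r ^ 2 + q3 * r ^ 3 + q4 * r ^ 4 = 0"
    and "\<And>n. let x = of_nat n + 1 + r; y = of_nat n + r in
      (q0 + q1 * x + q2 * x ^ 2 + q3 * x ^ 3 + q4 * x ^ 4) * fps_nth u (Suc n)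
      = (s0 + s1 * y + s2 * y ^ 2 + s3 * y ^ 3 + s4 * y ^ 4) * fps_nth u n"
  shows "(fps_const q0 - fps_X * fps_const s0) * u + (fps_const q1 - fps_X * fps_const s1) * theta r u
      + (fps_const q2 - fps_X * fps_const s2) * theta r (theta r u)
      + (fps_const q3 - fps_X * fps_const s3) * theta r (theta r (theta r u))
      + (fps_const q4 - fps_X * fps_const s4) * theta r (theta r (theta r (theta r u))) = 0"
proof (rule fps_ext)
  fix n
  show "fps_nth ((fps_const q0 - fps_X * fps_const s0) * u + (fps_const q1 - fps_X * fps_const s1) * theta r u
      + (fps_const q2 - fps_X * fps_const s2) * theta r (theta r u)
      + (fps_const q3 - fps_X * fps_const s3) * theta r (theta r (theta r u))
      + (fps_const q4 - fps_X * fps_const s4) * theta r (theta r (theta r (theta r u)))) n = fps_nth 0 n"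
  proof (cases n)
    case 0
    have "q0 * fps_nth u 0 + q1 * (r * fps_nth u 0) + q2 * (r * (r * fps_nth u 0))
      + q3 * (r * (r * (r * fps_nth u 0))) + q4 * (r * (r * (r * (r * fps_nth u 0))))
      = (q0 + q1 * r + q2 * r ^ 2 + q3 * r ^ 3 + q4 * r ^ 4) * fps_nth u 0"
      by algebra
    then show ?thesis using assms(1)
      by (simp add: 0 fps_nth_linear_mult theta_nth)
  next
    case (Suc m)
    define x y where "x = of_nat m + 1 + r" and "y = of_nat m + r"
    have x: "of_nat (Suc m) + r = x"
      by (simp add: x_def)
    show ?thesis using assms(2)[of m, folded x_def y_def] 
      unfolding Suc Let_def fps_add_nth fps_nth_linear_mult theta_nth x y_def[symmetric] fps_zero_nth
      by algebra
  qed
qed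

text \<open>The adjoint operator is Q(-theta) - S(-theta) z. Here the multiplication by z comes
  before theta, so both polynomials are evaluated at the same shifted exponent, in contrast to
  \<open>hypergeometric_odeI\<close>.\<close>

lemma hypergeometric_adjoint_odeI:
  fixes w :: "complex fps"
  assumes "q0 - q1 * s + q2 * s ^ 2 - q3 * s ^ 3 + q4 * s ^ 4 = 0"
    and "\<And>n. let x = of_nat n + 1 + s in
      (q0 - q1 * x + q2 * x ^ 2 - q3 * x ^ 3 + q4 * x ^ 4) * fps_nth w (Suc n)
      = (s0 - s1 * x + s2 * x ^ 2 - s3 * x ^ 3 + s4 * x ^ 4) * fps_nth w n"
  shows "theta s ((fps_const q1 - fps_X * fps_const s1) * w
      - theta s ((fps_const q2 - fps_X * fps_const s2) * w
      - theta s ((fps_const q3 - fps_X * fps_const s3) * w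
      - theta s ((fps_const q4 - fps_X * fps_const s4) * w))))
      = (fps_const q0 - fps_X * fps_const s0) * w"
proof (rule fps_ext)
  fix n
  show "fps_nth (theta s ((fps_const q1 - fps_X * fps_const s1) * w
      - theta s ((fps_const q2 - fps_X * fps_const s2) * w
      - theta s ((fps_const q3 - fps_X * fps_const s3) * w
      - theta s ((fps_const q4 - fps_X * fps_const s4) * w))))) n
      = fps_nth ((fps_const q0 - fps_X * fps_const s0) * w) n"
  proof (cases n)
    case 0
    show ?thesis using assms(1)
      unfolding 0 fps_sub_nth fps_nth_linear_mult theta_nth of_nat_0 by algebra
  next
    case (Suc m)
    define x where "x = of_nat m + 1 + s"
    have x: "of_nat (Suc m) + s = x"
      by (simp add: x_def)
    show ?thesis using assms(2)[of m, folded x_def] 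
      unfolding Suc Let_def fps_sub_nth fps_nth_linear_mult theta_nth x
      by algebra
  qed
qed

definition hyp_coeff :: "complex \<Rightarrow> complex \<Rightarrow> complex \<Rightarrow> complex \<Rightarrow> complex \<Rightarrow> complex \<Rightarrow> complex \<Rightarrow> nat \<Rightarrow> complex" where
  "hyp_coeff a b c d e f g n =
     (pochhammer a n * pochhammer b n * pochhammer c n * pochhammer d n) /
     (fact n * pochhammer e n * pochhammer f n * pochhammer g n)"

lemma hyp4F3_eq_suminf: "hyp4F3 a b c d e f g = (\<Sum>n. hyp_coeff a b c d e f g n)"
  by (simp add: hyp4F3_def hyp_coeff_def)

lemma hyp_coeff_0 [simp]: "hyp_coeff a b c d e f g 0 = 1"
  by (simp add: hyp_coeff_def)

lemma pochhammer_neq_0: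
  fixes z :: complex
  shows "z \<notin> \<int>\<^sub>\<le>\<^sub>0 \<Longrightarrow> pochhammer z n \<noteq> 0"
  using pochhammer_eq_0_imp_nonpos_Int by blast

lemma hyp_coeff_Suc:
  assumes "e \<notin> \<int>\<^sub>\<le>\<^sub>0" "f \<notin> \<int>\<^sub>\<le>\<^sub>0" "g \<notin> \<int>\<^sub>\<le>\<^sub>0"
  shows "(of_nat n + 1) * (e + of_nat n) * (f + of_nat n) * (g + of_nat n) * hyp_coeff a b c d e f g (Suc n)
    = (a + of_nat n) * (b + of_nat n) * (c + of_nat n) * (d + of_nat n) * hyp_coeff a b c d e f g n"
proof -
  have "e + of_nat n \<noteq> 0" "f + of_nat n \<noteq> 0" "g + of_nat n \<noteq> 0"
    using assms by (auto dest: plus_of_nat_eq_0_imp)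
  moreover have "(1::complex) + of_nat n \<noteq> 0"
    by (metis of_nat_Suc of_nat_eq_0_iff nat.distinct(2))
  ultimately show ?thesis
    using assms
    by (simp add: hyp_coeff_def pochhammer_Suc pochhammer_neq_0 divide_simps) 
qed

text \<open>Coefficients of the Wronskian of \<open>F(z)\<close> and \<open>z\<^bsup>1-e\<^esup> G(z)\<close>, the two local solutions at \<open>0\<close> whose values at \<open>1\<close>
  occur in \<open>L\<close>.\<close>

definition wronskian_coeff ::
  "complex \<Rightarrow> complex \<Rightarrow> complex \<Rightarrow> complex \<Rightarrow> complex \<Rightarrow> complex \<Rightarrow> complex \<Rightarrow> nat \<Rightarrow> complex" where
  "wronskian_coeff a b c d e f g n =
     (\<Sum>k\<le>n. (1 - e + of_nat (n - k) - of_nat k) * hyp_coeff a b c d e f g k *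
        hyp_coeff (1 + a - e) (1 + b - e) (1 + c - e) (1 + d - e) (2 - e) (1 + f - e) (1 + g - e) (n - k))"

lemma fps_nth_wronskian:
  "fps_nth (Abs_fps u * theta s (Abs_fps v) - theta r (Abs_fps u) * Abs_fps v) n
    = (\<Sum>k\<le>n. (s - r + of_nat (n - k) - of_nat k) * u k * v (n - k))"
proof -
  have "fps_nth (Abs_fps u * theta s (Abs_fps v) - theta r (Abs_fps u) * Abs_fps v) n
    = (\<Sum>k=0..n. u k * ((of_nat (n - k) + s) * v (n - k)) - (of_nat k + r) * u k * v (n - k))"
    by (simp add: fps_mult_nth theta_nth sum_subtractf)
  also have "\<dots> = (\<Sum>k\<le>n. (s - r + of_nat (n - k) - of_nat k) * u k * v (n - k))"
    unfolding atMost_atLeast0 by (intro sum.cong) (simp_all add: algebra_simps)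
  finally show ?thesis .
qed

lemma not_Ints_imp:
  fixes z :: complex
  assumes "z \<notin> \<int>"
  shows "z \<notin> \<int>\<^sub>\<le>\<^sub>0" "1 + z \<notin> \<int>\<^sub>\<le>\<^sub>0" "2 - z \<notin> \<int>\<^sub>\<le>\<^sub>0" "of_nat n + z \<noteq> 0"
proof -
  show "z \<notin> \<int>\<^sub>\<le>\<^sub>0" "1 + z \<notin> \<int>\<^sub>\<le>\<^sub>0" "2 - z \<notin> \<int>\<^sub>\<le>\<^sub>0"
    using assms by (auto dest!: nonpos_Ints_Int)
  show "of_nat n + z \<noteq> 0"
    using assms plus_of_nat_eq_0_imp[of z n] by (auto simp: add.commute)
qed

text \<open>The exponents at 0 are 0, 1-e, 1-f, 1-g. The left side belongs to the pair 0, 1-e; the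
  right side belongs to the adjoint solutions with exponents f-1 and g-1, which correspond to the
  complementary pair. The factors \<open>g - f\<close> and \<open>1 - e\<close> are the constant
  coefficients of the two Wronskians and fix the proportionality constant.\<close>

lemma wronskian_coeff_dual:
  assumes bal: "e + f + g = 1 + a + b + c + d"
    and nonint: "e \<notin> \<int>" "f \<notin> \<int>" "g \<notin> \<int>" "f - e \<notin> \<int>" "g - e \<notin> \<int>" "f - g \<notin> \<int>"
  shows "(g - f) * wronskian_coeff a b c d e f g n
    = (1 - e) * wronskian_coeff (f - a) (f - b) (f - c) (f - d) (1 + f - g) f (1 + f - e) n"
proof -
  have neg: "g - f \<notin> \<int>" "e - f \<notin> \<int>" "e - g \<notin> \<int>"
    using nonint by (metis minus_diff_eq minus_in_Ints_iff)+
  have lower: "2 - e \<notin> \<int>\<^sub>\<le>\<^sub>0" "1 + f - e \<notin> \<int>\<^sub>\<le>\<^sub>0" "1 + g - e \<notin> \<int>\<^sub>\<le>\<^sub>0" "1 + f - g \<notin> \<int>\<^sub>\<le>\<^sub>0"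
    "1 + g - f \<notin> \<int>\<^sub>\<le>\<^sub>0" "e \<notin> \<int>\<^sub>\<le>\<^sub>0" "f \<notin> \<int>\<^sub>\<le>\<^sub>0" "g \<notin> \<int>\<^sub>\<le>\<^sub>0"
    using nonint neg by (auto simp: not_Ints_imp simp flip: add_diff_eq)
  define u where "u = Abs_fps (hyp_coeff a b c d e f g)"
  define v where "v = Abs_fps (hyp_coeff (1+a-e) (1+b-e) (1+c-e) (1+d-e) (2-e) (1+f-e) (1+g-e))"
  define w where "w = Abs_fps (hyp_coeff (f-a) (f-b) (f-c) (f-d) (1+f-g) f (1+f-e))"
  define z where "z = Abs_fps (hyp_coeff (g-a) (g-b) (g-c) (g-d) (1+g-f) g (1+g-e))"
  \<comment> \<open>Coefficients of the two polynomials whose factorizations are recorded in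
    \<open>Q\<close> below.\<close>
  define q0 q1 q2 q3 q4 :: complex where "q0 = 0" and "q1 = (e-1)*(f-1)*(g-1)"
    and "q2 = (e-1)*(f-1) + (e-1)*(g-1) + (f-1)*(g-1)" and "q3 = e+f+g-3" and "q4 = 1"
  define s0 s1 s2 s3 s4 :: complex where "s0 = a*b*c*d" and "s1 = a*b*c+a*b*d+a*c*d+b*c*d"
    and "s2 = a*b+a*c+a*d+b*c+b*d+c*d" and "s3 = a+b+c+d" and "s4 = 1"
  note q = q0_def q1_def q2_def q3_def q4_def
  note s = s0_def s1_def s2_def s3_def s4_def
  have Q: "q0 + q1 * x + q2 * x ^ 2 + q3 * x ^ 3 + q4 * x ^ 4 = x * (x + e - 1) * (x + f - 1) * (x + g - 1)"
    "q0 - q1 * x + q2 * x ^ 2 - q3 * x ^ 3 + q4 * x ^ 4 = x * (x + 1 - e) * (x + 1 - f) * (x + 1 - g)"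
    "s0 + s1 * x + s2 * x ^ 2 + s3 * x ^ 3 + s4 * x ^ 4 = (x + a) * (x + b) * (x + c) * (x + d)"
    "s0 - s1 * x + s2 * x ^ 2 - s3 * x ^ 3 + s4 * x ^ 4 = (x - a) * (x - b) * (x - c) * (x - d)" for x
    unfolding q s by algebra+
  have v_shift: "of_nat n + 1 + (1 - e) = 2 - e + of_nat n"
    "2 - e + of_nat n + e - 1 = of_nat n + 1"
    "2 - e + of_nat n + f - 1 = 1 + f - e + of_nat n"
    "2 - e + of_nat n + g - 1 = 1 + g - e + of_nat n"
    "of_nat n + (1 - e) + a = 1 + a - e + of_nat n"
    "of_nat n + (1 - e) + b = 1 + b - e + of_nat n"
    "of_nat n + (1 - e) + c = 1 + c - e + of_nat n"
    "of_nat n + (1 - e) + d = 1 + d - e + of_nat n" for n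
    by (simp_all add: algebra_simps)
  have w_shift: "of_nat n + 1 + (f - 1) = f + of_nat n"
    "f + of_nat n + 1 - e = 1 + f - e + of_nat n"
    "f + of_nat n + 1 - f = of_nat n + 1"
    "f + of_nat n + 1 - g = 1 + f - g + of_nat n"
    "f + of_nat n - a = f - a + of_nat n"
    "f + of_nat n - b = f - b + of_nat n"
    "f + of_nat n - c = f - c + of_nat n"
    "f + of_nat n - d = f - d + of_nat n" for n
    by (simp_all add: algebra_simps)
  have z_shift: "of_nat n + 1 + (g - 1) = g + of_nat n"
    "g + of_nat n + 1 - e = 1 + g - e + of_nat n"
    "g + of_nat n + 1 - g = of_nat n + 1"
    "g + of_nat n + 1 - f = 1 + g - f + of_nat n"
    "g + of_nat n - a = g - a + of_nat n"
    "g + of_nat n - b = g - b + of_nat n"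
    "g + of_nat n - c = g - c + of_nat n"
    "g + of_nat n - d = g - d + of_nat n" for n
    by (simp_all add: algebra_simps)
  define p where "p = (\<lambda>q s. fps_const q - fps_X * fps_const (s::complex))"
  define M where "M = u * theta (1 - e) v - theta 0 u * v"
  define N where "N = w * theta (g - 1) z - theta (f - 1) w * z"
  have "fps_deriv N * M = N * fps_deriv M"
    unfolding M_def N_def
  proof (rule wronskian_adjoint_proportional[of "p q0 s0" u "p q1 s1" _ "p q2 s2" "p q3 s3" "p q4 s4"])
    show "p q0 s0 * u + p q1 s1 * theta 0 u + p q2 s2 * theta 0 (theta 0 u)
      + p q3 s3 * theta 0 (theta 0 (theta 0 u)) + p q4 s4 * theta 0 (theta 0 (theta 0 (theta 0 u))) = 0"
      unfolding p_def
    proof (rule hypergeometric_odeI)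
      show "let x = of_nat n + 1 + 0; y = of_nat n + 0 in
        (q0 + q1 * x + q2 * x ^ 2 + q3 * x ^ 3 + q4 * x ^ 4) * fps_nth u (Suc n)
        = (s0 + s1 * y + s2 * y ^ 2 + s3 * y ^ 3 + s4 * y ^ 4) * fps_nth u n" for n
        unfolding Let_def Q using hyp_coeff_Suc[OF lower(6-8), of n a b c d]
        by (simp add: u_def ac_simps add_diff_eq[symmetric])
    qed (simp add: q)
    show "p q0 s0 * v + p q1 s1 * theta (1-e) v + p q2 s2 * theta (1-e) (theta (1-e) v)
      + p q3 s3 * theta (1-e) (theta (1-e) (theta (1-e) v))
      + p q4 s4 * theta (1-e) (theta (1-e) (theta (1-e) (theta (1-e) v))) = 0"
      unfolding p_def
    proof (rule hypergeometric_odeI)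
      show "let x = of_nat n + 1 + (1-e); y = of_nat n + (1-e) in
        (q0 + q1 * x + q2 * x ^ 2 + q3 * x ^ 3 + q4 * x ^ 4) * fps_nth v (Suc n)
        = (s0 + s1 * y + s2 * y ^ 2 + s3 * y ^ 3 + s4 * y ^ 4) * fps_nth v n" for n
        using hyp_coeff_Suc[OF lower(1-3), of n "1+a-e" "1+b-e" "1+c-e" "1+d-e"] unfolding Let_def Q v_shift by (simp only: v_def fps_nth_Abs_fps mult_ac)
    qed (simp only: Q, simp)
    show "theta (f-1) (p q1 s1 * w - theta (f-1) (p q2 s2 * w
      - theta (f-1) (p q3 s3 * w - theta (f-1) (p q4 s4 * w)))) = p q0 s0 * w"
      unfolding p_def
    proof (rule hypergeometric_adjoint_odeI)
      show "let x = of_nat n + 1 + (f-1) in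
        (q0 - q1 * x + q2 * x ^ 2 - q3 * x ^ 3 + q4 * x ^ 4) * fps_nth w (Suc n)
        = (s0 - s1 * x + s2 * x ^ 2 - s3 * x ^ 3 + s4 * x ^ 4) * fps_nth w n" for n
        using hyp_coeff_Suc[OF lower(4,7,2), of n "f-a" "f-b" "f-c" "f-d"] unfolding Let_def Q w_shift by (simp only: w_def fps_nth_Abs_fps mult_ac)
    qed (simp only: Q, simp)
    show "theta (g-1) (p q1 s1 * z - theta (g-1) (p q2 s2 * z
      - theta (g-1) (p q3 s3 * z - theta (g-1) (p q4 s4 * z)))) = p q0 s0 * z"
      unfolding p_def
    proof (rule hypergeometric_adjoint_odeI)
      show "let x = of_nat n + 1 + (g-1) in
        (q0 - q1 * x + q2 * x ^ 2 - q3 * x ^ 3 + q4 * x ^ 4) * fps_nth z (Suc n)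
        = (s0 - s1 * x + s2 * x ^ 2 - s3 * x ^ 3 + s4 * x ^ 4) * fps_nth z n" for n
        using hyp_coeff_Suc[OF lower(5,8,3), of n "g-a" "g-b" "g-c" "g-d"] unfolding Let_def Q z_shift by (simp only: z_def fps_nth_Abs_fps mult_ac)
    qed (simp only: Q, simp)
    show "p q4 s4 \<noteq> 0"
    proof
      assume "p q4 s4 = 0"
      then have "fps_nth (p q4 s4) 0 = 0" by simp
      then show False by (simp add: p_def q)
    qed
    \<comment> \<open>This is the Saalschuetzian condition. With \<open>p4\<close> equal to 1 - z,
      the term \<open>2 * theta 0 p4\<close> is -2z and accounts for the 2, while the exponents add
      up to \<open>q3\<close>.\<close>
    have "s3 = q3 + 2"
      using bal by (simp add: s3_def q3_def algebra_simps)
    then show "2 * theta 0 (p q4 s4) + fps_const (f - 1 + (g - 1) - 0 - (1 - e)) * p q4 s4 = p q3 s3"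
      by (simp add: p_def theta_def q4_def s4_def q3_def algebra_simps flip: fps_const_add fps_const_sub)
    show "of_nat n + (f - 1 + 0) \<noteq> 0" "of_nat n + (g - 1 + 0) \<noteq> 0"
      "of_nat n + (f - 1 + (1 - e)) \<noteq> 0" "of_nat n + (g - 1 + (1 - e)) \<noteq> 0" for n
      using nonint by (auto intro!: not_Ints_imp)
  qed
  moreover have "fps_nth M 0 = 1 - e" "fps_nth N 0 = g - f"
    by (simp_all add: M_def N_def u_def v_def w_def z_def theta_nth)
  moreover have "g - f \<noteq> 0"
    using neg by auto
  ultimately have "fps_const (g - f) * M = fps_const (1 - e) * N"
    using fps_proportional_if_deriv[of N M] by simp
  then have "(g - f) * fps_nth M n = (1 - e) * fps_nth N n"
    by (metis fps_mult_left_const_nth)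
  moreover have "fps_nth M n = wronskian_coeff a b c d e f g n"
    unfolding M_def u_def v_def fps_nth_wronskian wronskian_coeff_def by simp
  moreover have "fps_nth N n = wronskian_coeff (f - a) (f - b) (f - c) (f - d) (1 + f - g) f (1 + f - e) n"
    unfolding N_def w_def z_def fps_nth_wronskian wronskian_coeff_def by (simp add: algebra_simps)
  ultimately show ?thesis by simp
qed

section \<open>The two-term relation for \<open>L\<close>\<close>

text \<open>In a quotient of four \<open>rGamma_series\<close> by four others the factorials cancel,
  and the powers of n combine to the parameter excess p.\<close>

lemma pochhammer_ratio_tendsto:
  fixes a1 a2 a3 a4 b1 b2 b3 b4 :: complex
  assumes "b1 \<notin> \<int>\<^sub>\<le>\<^sub>0" "b2 \<notin> \<int>\<^sub>\<le>\<^sub>0" "b3 \<notin> \<int>\<^sub>\<le>\<^sub>0" "b4 \<notin> \<int>\<^sub>\<le>\<^sub>0"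
    and "b1 + b2 + b3 + b4 = a1 + a2 + a3 + a4 + of_int p"
  shows "(\<lambda>n. of_nat n powi p * (pochhammer a1 n * pochhammer a2 n * pochhammer a3 n * pochhammer a4 n
      / (pochhammer b1 n * pochhammer b2 n * pochhammer b3 n * pochhammer b4 n)))
    \<longlonglongrightarrow> rGamma a1 * rGamma a2 * rGamma a3 * rGamma a4 * (Gamma b1 * Gamma b2 * Gamma b3 * Gamma b4)"
    (is "(\<lambda>n. of_nat n powi p * ?r n) \<longlonglongrightarrow> ?l")
proof -
  let ?s = "\<lambda>n. rGamma_series a1 n * rGamma_series a2 n * rGamma_series a3 n * rGamma_series a4 n
    / (rGamma_series b1 n * rGamma_series b2 n * rGamma_series b3 n * rGamma_series b4 n)"
  have "?s \<longlonglongrightarrow> rGamma a1 * rGamma a2 * rGamma a3 * rGamma a4 /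
    (rGamma b1 * rGamma b2 * rGamma b3 * rGamma b4)"
    using assms by (intro tendsto_intros) (auto simp: rGamma_eq_zero_iff)
  also have "rGamma a1 * rGamma a2 * rGamma a3 * rGamma a4 /
    (rGamma b1 * rGamma b2 * rGamma b3 * rGamma b4) = ?l"
    by (simp add: rGamma_inverse_Gamma divide_simps)
  finally have s: "?s \<longlonglongrightarrow> ?l" .
  have eq: "?s n = of_nat n powi p * ?r (Suc n)" if "n > 0" for n
  proof -
    let ?e = "\<lambda>z. exp (z * of_real (ln (of_nat n))) :: complex"
    have "?e b1 * ?e b2 * ?e b3 * ?e b4 = ?e (b1 + b2 + b3 + b4)"
      by (simp add: exp_add distrib_right)
    also have "\<dots> = ?e a1 * ?e a2 * ?e a3 * ?e a4 * ?e (of_int p)"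
      by (simp add: assms(5) exp_add distrib_right)
    also have "?e (of_int p) = of_nat n powi p"
      using that exp_of_real[of "ln (real n)", where 'a = complex]
      by (simp flip: exp_power_int)
    finally have e: "?e b1 * ?e b2 * ?e b3 * ?e b4 = ?e a1 * ?e a2 * ?e a3 * ?e a4 * of_nat n powi p" .
    have "?s n = (?e b1 * ?e b2 * ?e b3 * ?e b4) / (?e a1 * ?e a2 * ?e a3 * ?e a4) * ?r (Suc n)"
      by (simp add: rGamma_series_def divide_simps)
    then show ?thesis
      unfolding e by simp
  qed
  \<comment> \<open>\<open>rGamma_series\<close> at n contains n+1 Pochhammer factors but powers of
    n. The base of the power is corrected by (n+1)/n, which tends to 1, before the index is shifted
    back.\<close>
  have "(\<lambda>n. of_nat n powi p * ?r (Suc n)) \<longlonglongrightarrow> ?l"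
    by (rule Lim_transform_eventually[OF s]) (use eq in \<open>auto intro: eventually_mono[OF eventually_gt_at_top[of 0]]\<close>)
  moreover have "(\<lambda>n. (of_nat (Suc n) / of_nat n :: complex) powi p) \<longlonglongrightarrow> 1 powi p"
    by (intro tendsto_power_int LIMSEQ_Suc_n_over_n) simp
  ultimately have "(\<lambda>n. (of_nat (Suc n) / of_nat n) powi p * (of_nat n powi p * ?r (Suc n))) \<longlonglongrightarrow> 1 * ?l"
    using tendsto_mult by fastforce
  moreover have "\<forall>\<^sub>F n in sequentially. (of_nat (Suc n) / of_nat n) powi p * (of_nat n powi p * ?r (Suc n))
      = of_nat (Suc n) powi p * ?r (Suc n)"
    using eventually_gt_at_top[of 0]
    by eventually_elim (simp add: power_int_divide_distrib)
  ultimately have "(\<lambda>n. of_nat (Suc n) powi p * ?r (Suc n)) \<longlonglongrightarrow> ?l"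
    by (simp add: Lim_transform_eventually del: of_nat_Suc pochhammer_Suc)
  then show ?thesis
    by (subst (asm) filterlim_sequentially_Suc[where f = "\<lambda>n. of_nat n powi p * ?r n"])
qed

lemma hyp_coeff_tendsto:
  assumes "e \<notin> \<int>\<^sub>\<le>\<^sub>0" "f \<notin> \<int>\<^sub>\<le>\<^sub>0" "g \<notin> \<int>\<^sub>\<le>\<^sub>0" "e + f + g = 1 + a + b + c + d"
  shows "(\<lambda>n. of_nat n ^ 2 * hyp_coeff a b c d e f g n)
    \<longlonglongrightarrow> rGamma a * rGamma b * rGamma c * rGamma d * (Gamma e * Gamma f * Gamma g)"
proof -
  have "1 + e + f + g = a + b + c + d + of_int 2"
    using assms(4) by (simp add: algebra_simps)
  from pochhammer_ratio_tendsto[OF one_notin_nonpos_Ints assms(1-3) this] show ?thesis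
    by (simp add: hyp_coeff_def pochhammer_fact)
qed

lemma summable_norm_if_square_bounded:
  fixes u :: "nat \<Rightarrow> complex"
  assumes "convergent (\<lambda>n. of_nat n ^ 2 * u n)"
  shows "summable (\<lambda>n. norm (u n))"
proof -
  obtain B where B: "\<And>n. norm (of_nat n ^ 2 * u n) \<le> B"
    using convergent_imp_Bseq[OF assms] by (auto simp: Bseq_def)
  have "summable (\<lambda>n. B * inverse (real n ^ 2))"
    by (intro summable_mult inverse_power_summable) simp
  moreover have "norm (norm (u n)) \<le> B * inverse (real n ^ 2)" if "n \<ge> 1" for n
    using B[of n] that by (simp add: norm_mult norm_power field_simps)
  ultimately show ?thesis
    by (rule summable_comparison_test'[where N = 1]) auto
qed

section \<open>Dominated limits of weighted sums and convolutions\<close>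

text \<open>Tannery's theorem for a triangular array continued by zero, so that the uniform bound is
  required only below the diagonal. The weights may misbehave elsewhere.\<close>

lemma weighted_sum_tendsto:
  fixes w :: "nat \<Rightarrow> nat \<Rightarrow> complex" and v :: "nat \<Rightarrow> complex"
  assumes w: "\<And>k. (\<lambda>n. w n k) \<longlonglongrightarrow> W" and bound: "\<And>n k. k < n \<Longrightarrow> norm (w n k) \<le> B"
    and v: "summable (\<lambda>n. norm (v n))"
  shows "(\<lambda>n. \<Sum>k<n. v k * w n k) \<longlonglongrightarrow> suminf v * W"
proof -
  define a where "a = (\<lambda>k n. if k < n then v k * w n k else 0)"
  have lim: "(\<lambda>n. a k n) \<longlonglongrightarrow> v k * W" for k
  proof (rule Lim_transform_eventually)
    show "(\<lambda>n. v k * w n k) \<longlonglongrightarrow> v k * W"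
      by (intro tendsto_mult tendsto_const w)
    show "\<forall>\<^sub>F n in sequentially. v k * w n k = a k n"
      using eventually_gt_at_top[of k] by eventually_elim (simp add: a_def)
  qed
  have "0 \<le> B" using order_trans[OF norm_ge_zero bound[of 0 1]] by simp
  then have "\<forall>\<^sub>F (k, n) in at_top \<times>\<^sub>F sequentially. norm (a k n) \<le> norm (v k) * B"
    by (intro always_eventually) (auto simp: a_def norm_mult intro!: mult_left_mono bound)
  from tannerys_theorem[OF lim this] v
  have "(\<lambda>n. suminf (\<lambda>k. a k n)) \<longlonglongrightarrow> (\<Sum>k. v k * W)"
    by (simp add: summable_mult2)
  moreover have "suminf (\<lambda>k. a k n) = (\<Sum>k<n. v k * w n k)" for n
    by (subst suminf_finite[of "{..<n}"]) (auto simp: a_def)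
  ultimately show ?thesis
    using suminf_mult2[OF summable_norm_cancel[OF v], of W] by simp
qed

lemma convolution_tendsto:
  fixes x v :: "nat \<Rightarrow> complex"
  assumes x: "x \<longlonglongrightarrow> X" and v: "summable (\<lambda>n. norm (v n))"
  shows "(\<lambda>N. \<Sum>k\<le>N. x (N - k) * v k) \<longlonglongrightarrow> X * suminf v"
proof -
  obtain B where B: "\<And>n. norm (x n) \<le> B"
    using convergent_imp_Bseq[of x] x by (auto simp: Bseq_def convergent_def)
  have "(\<lambda>n. \<Sum>k<n. v k * x (n - Suc k)) \<longlonglongrightarrow> suminf v * X"
  proof (rule weighted_sum_tendsto[OF _ B v])
    show "(\<lambda>n. x (n - Suc k)) \<longlonglongrightarrow> X" for k
      by (rule LIMSEQ_offset[where k = "Suc k"]) (simp add: x)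
  qed
  from LIMSEQ_Suc[OF this] show ?thesis
    by (simp add: lessThan_Suc_atMost mult.commute)
qed

text \<open>Write N = k + (N-k) inside the sum. Its product with (N-k) - k is (N-k)^2 - k^2, which
  splits the sum into two convolutions of a convergent sequence with a summable one. The \<delta>
  part involves only n u(n) and n v(n), which tend to 0.\<close>

lemma wronskian_convolution_tendsto:
  fixes u v :: "nat \<Rightarrow> complex"
  assumes u: "(\<lambda>n. of_nat n ^ 2 * u n) \<longlonglongrightarrow> X" and v: "(\<lambda>n. of_nat n ^ 2 * v n) \<longlonglongrightarrow> Y"
  shows "(\<lambda>N. of_nat N * (\<Sum>k\<le>N. (\<delta> + of_nat (N - k) - of_nat k) * u k * v (N - k)))
    \<longlonglongrightarrow> Y * suminf u - X * suminf v"
proof -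
  have su: "summable (\<lambda>n. norm (u n))" and sv: "summable (\<lambda>n. norm (v n))"
    using summable_norm_if_square_bounded u v by (auto simp: convergent_def)
  have small: "(\<lambda>n. of_nat n * w n) \<longlonglongrightarrow> 0" if "(\<lambda>n. of_nat n ^ 2 * w n) \<longlonglongrightarrow> W" for w :: "nat \<Rightarrow> complex" and W
  proof (rule Lim_transform_eventually)
    show "(\<lambda>n. inverse (of_nat n) * (of_nat n ^ 2 * w n)) \<longlonglongrightarrow> 0"
      using tendsto_mult[OF lim_inverse_n that] by simp
    show "\<forall>\<^sub>F n in sequentially. inverse (of_nat n) * (of_nat n ^ 2 * w n) = of_nat n * w n"
      using eventually_gt_at_top[of 0] by eventually_elim (simp add: power2_eq_square field_simps)
  qed
  have flip: "(\<Sum>k\<le>N. x k * y (N - k)) = (\<Sum>k\<le>N. x (N - k) * y k)" for x y :: "nat \<Rightarrow> complex" and N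
    by (rule sum.reindex_bij_witness[where i = "\<lambda>k. N - k" and j = "\<lambda>k. N - k"]) auto
  have "(\<lambda>N. (\<Sum>k\<le>N. (of_nat (N - k) ^ 2 * v (N - k)) * u k) - (\<Sum>k\<le>N. (of_nat (N - k) ^ 2 * u (N - k)) * v k)
      + \<delta> * ((\<Sum>k\<le>N. (of_nat (N - k) * u (N - k)) * v k) + (\<Sum>k\<le>N. (of_nat (N - k) * v (N - k)) * u k)))
    \<longlonglongrightarrow> Y * suminf u - X * suminf v + \<delta> * (0 * suminf v + 0 * suminf u)"
    by (intro tendsto_add tendsto_diff tendsto_mult tendsto_const
       convolution_tendsto[where x = "\<lambda>n. of_nat n ^ 2 * _ n"] convolution_tendsto[where x = "\<lambda>n. of_nat n * _ n"]
       u v su sv small[OF u] small[OF v])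
  moreover have "of_nat N * (\<Sum>k\<le>N. (\<delta> + of_nat (N - k) - of_nat k) * u k * v (N - k))
     = (\<Sum>k\<le>N. (of_nat (N - k) ^ 2 * v (N - k)) * u k) - (\<Sum>k\<le>N. (of_nat (N - k) ^ 2 * u (N - k)) * v k)
      + \<delta> * ((\<Sum>k\<le>N. (of_nat (N - k) * u (N - k)) * v k) + (\<Sum>k\<le>N. (of_nat (N - k) * v (N - k)) * u k))" for N
  proof -
    have "of_nat N * (\<Sum>k\<le>N. (\<delta> + of_nat (N - k) - of_nat k) * u k * v (N - k))
      = (\<Sum>k\<le>N. (of_nat (N - k) ^ 2 * v (N - k)) * u k - (of_nat k ^ 2 * u k) * v (N - k)
        + \<delta> * ((of_nat k * u k) * v (N - k) + (of_nat (N - k) * v (N - k)) * u k))"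
      unfolding sum_distrib_left
    proof (intro sum.cong refl)
      fix k assume "k \<in> {..N}"
      then have "of_nat N = (of_nat k + of_nat (N - k) :: complex)"
        by (simp flip: of_nat_add)
      then show "of_nat N * ((\<delta> + of_nat (N - k) - of_nat k) * u k * v (N - k))
        = (of_nat (N - k) ^ 2 * v (N - k)) * u k - (of_nat k ^ 2 * u k) * v (N - k)
        + \<delta> * ((of_nat k * u k) * v (N - k) + (of_nat (N - k) * v (N - k)) * u k)"
        by algebra
    qed
    also have "\<dots> = (\<Sum>k\<le>N. (of_nat (N - k) ^ 2 * v (N - k)) * u k) - (\<Sum>k\<le>N. (of_nat k ^ 2 * u k) * v (N - k))
      + \<delta> * ((\<Sum>k\<le>N. (of_nat k * u k) * v (N - k)) + (\<Sum>k\<le>N. (of_nat (N - k) * v (N - k)) * u k))"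
      by (simp only: sum.distrib sum_subtractf flip: sum_distrib_left)
    finally show ?thesis
      by (simp only: flip[of "\<lambda>k. of_nat k ^ 2 * u k"] flip[of "\<lambda>k. of_nat k * u k"])
  qed
  ultimately show ?thesis by simp
qed

section \<open>Asymptotics of the Wronskian coefficients\<close>

lemma sinpi_eq_0_iff: "sinpi z = 0 \<longleftrightarrow> z \<in> \<int>"
proof
  assume "sinpi z = 0"
  then obtain n :: int where "of_real pi * z = of_real (of_int n * pi)"
    by (auto simp: sinpi_def sin_eq_0)
  then have "z = of_int n" by simp
  then show "z \<in> \<int>" by simp
qed (auto elim!: Ints_cases simp: sinpi_def sin_eq_0 mult.commute)

text \<open>By the convolution limit each of the two series is multiplied by the asymptotic constant
  of the coefficients of the other one. Up to Gamma factors this is the combination that defines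
  \<open>L\<close>.\<close>

lemma wronskian_coeff_tendsto:
  assumes bal: "e + f + g = 1 + a + b + c + d"
    and nonint: "e \<notin> \<int>" "f \<notin> \<int>" "g \<notin> \<int>" "f - e \<notin> \<int>" "g - e \<notin> \<int>"
  shows "(\<lambda>n. of_nat n * wronskian_coeff a b c d e f g n)
    \<longlonglongrightarrow> (1 - e) * of_real pi * L a b c d e f g * (Gamma f * Gamma (1 + f - e) * Gamma g * Gamma (1 + g - e))"
proof -
  have lower: "2 - e \<notin> \<int>\<^sub>\<le>\<^sub>0" "1 + f - e \<notin> \<int>\<^sub>\<le>\<^sub>0" "1 + g - e \<notin> \<int>\<^sub>\<le>\<^sub>0" "e \<notin> \<int>\<^sub>\<le>\<^sub>0" "f \<notin> \<int>\<^sub>\<le>\<^sub>0" "g \<notin> \<int>\<^sub>\<le>\<^sub>0"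
    using nonint by (auto simp: not_Ints_imp simp flip: add_diff_eq)
  have bal': "(2 - e) + (1 + f - e) + (1 + g - e) = 1 + (1 + a - e) + (1 + b - e) + (1 + c - e) + (1 + d - e)"
    using bal by (simp add: algebra_simps)
  define C where "C = rGamma a * rGamma b * rGamma c * rGamma d * (Gamma e * Gamma f * Gamma g)"
  define C' where "C' = rGamma (1 + a - e) * rGamma (1 + b - e) * rGamma (1 + c - e) * rGamma (1 + d - e)
    * (Gamma (2 - e) * Gamma (1 + f - e) * Gamma (1 + g - e))"
  have lim: "(\<lambda>n. of_nat n * wronskian_coeff a b c d e f g n)
    \<longlonglongrightarrow> C' * hyp4F3 a b c d e f g
      - C * hyp4F3 (1 + a - e) (1 + b - e) (1 + c - e) (1 + d - e) (2 - e) (1 + f - e) (1 + g - e)"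
    unfolding wronskian_coeff_def hyp4F3_eq_suminf C_def C'_def
    by (intro wronskian_convolution_tendsto hyp_coeff_tendsto bal bal' lower)
  \<comment> \<open>The reflection formula at e, with one application of the functional equation
    because \<open>L\<close> contains 2 - e instead of 1 - e.\<close>
  have "Gamma e * Gamma (2 - e) * sinpi e = (1 - e) * of_real pi"
  proof -
    have "Gamma (1 - e + 1) = (1 - e) * Gamma (1 - e)"
      using nonint(1) by (intro Gamma_plus1) (auto dest: nonpos_Ints_Int)
    moreover have "Gamma e * Gamma (1 - e) * sinpi e = of_real pi"
      using nonint(1) by (subst Gamma_reflection_complex) (simp add: sinpi_def[symmetric] sinpi_eq_0_iff)
    moreover have "1 - e + 1 = 2 - e" by simp
    ultimately show ?thesis by algebra
  qed
  then have "(1 - e) * of_real pi * L a b c d e f g * (Gamma f * Gamma (1 + f - e) * Gamma g * Gamma (1 + g - e))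
    = Gamma e * Gamma (2 - e) * sinpi e * L a b c d e f g * (Gamma f * Gamma (1 + f - e) * Gamma g * Gamma (1 + g - e))"
    by simp
  also have "\<dots> = C' * hyp4F3 a b c d e f g
      - C * hyp4F3 (1 + a - e) (1 + b - e) (1 + c - e) (1 + d - e) (2 - e) (1 + f - e) (1 + g - e)"
  proof -
    have g: "Gamma z * rGamma z = 1" if "z \<notin> \<int>\<^sub>\<le>\<^sub>0" for z :: complex
      using that by (simp add: rGamma_inverse_Gamma Gamma_eq_zero_iff)
    have "Gamma e * Gamma (2 - e) * sinpi e * (x / sinpi e * (r1 * r2 * r3 * r4 * rGamma e * rGamma f * rGamma g)
        - y / sinpi e * (s1 * s2 * s3 * s4 * rGamma (2 - e) * rGamma (1 + f - e) * rGamma (1 + g - e)))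
          * (Gamma f * Gamma (1 + f - e) * Gamma g * Gamma (1 + g - e))
      = (Gamma e * rGamma e) * (Gamma f * rGamma f) * (Gamma g * rGamma g) * (r1 * r2 * r3 * r4 *
        (Gamma (2 - e) * Gamma (1 + f - e) * Gamma (1 + g - e))) * x
      - (Gamma (2 - e) * rGamma (2 - e)) * (Gamma (1 + f - e) * rGamma (1 + f - e)) *
        (Gamma (1 + g - e) * rGamma (1 + g - e)) * (s1 * s2 * s3 * s4 * (Gamma e * Gamma f * Gamma g)) * y"
      for x y r1 r2 r3 r4 s1 s2 s3 s4
    proof -
      have s: "sinpi e \<noteq> 0" using nonint(1) by (simp add: sinpi_eq_0_iff)
      define X Y where "X = x / sinpi e" and "Y = y / sinpi e"
      then have "x = sinpi e * X" "y = sinpi e * Y" using s by auto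
      then show ?thesis unfolding X_def[symmetric] Y_def[symmetric] by algebra
    qed
    from this[of "hyp4F3 a b c d e f g"] show ?thesis
      unfolding L_def C_def C'_def g[OF lower(1)] g[OF lower(2)] g[OF lower(3)] g[OF lower(4)] g[OF lower(5)]
        g[OF lower(6)] by simp
  qed
  finally show ?thesis
    using lim by simp
qed

text \<open>Multiply \<open>wronskian_coeff_dual\<close> by n and pass to the limit. The product
  \<open>G\<close> of Gamma values is common to both parameter sets, and the factors
  \<open>1 - e\<close> and \<open>g - f\<close> from the limits match those of the coefficient
  identity, so everything but the two \<open>L\<close> values cancels.\<close>

lemma L_dual:
  assumes bal: "e + f + g = 1 + a + b + c + d"
    and nonint: "e \<notin> \<int>" "f \<notin> \<int>" "g \<notin> \<int>" "f - e \<notin> \<int>" "g - e \<notin> \<int>" "f - g \<notin> \<int>"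
  shows "L a b c d e f g = L (f - a) (f - b) (f - c) (f - d) (1 + f - g) f (1 + f - e)"
proof -
  have neg: "g - f \<notin> \<int>" "e - f \<notin> \<int>" "e - g \<notin> \<int>"
    using nonint by (metis minus_diff_eq minus_in_Ints_iff)+
  define G where "G = Gamma f * Gamma (1 + f - e) * Gamma g * Gamma (1 + g - e)"
  have "(\<lambda>n. of_nat n * wronskian_coeff (f-a) (f-b) (f-c) (f-d) (1+f-g) f (1+f-e) n)
    \<longlonglongrightarrow> (1 - (1+f-g)) * of_real pi * L (f-a) (f-b) (f-c) (f-d) (1+f-g) f (1+f-e)
      * (Gamma f * Gamma (1 + f - (1+f-g)) * Gamma (1+f-e) * Gamma (1 + (1+f-e) - (1+f-g)))"
  proof (rule wronskian_coeff_tendsto)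
    show "1 + f - g + f + (1 + f - e) = 1 + (f - a) + (f - b) + (f - c) + (f - d)"
      using bal by algebra
  qed (use nonint neg in \<open>auto simp flip: add_diff_eq\<close>)
  also have "(1 - (1+f-g)) * of_real pi * L (f-a) (f-b) (f-c) (f-d) (1+f-g) f (1+f-e)
      * (Gamma f * Gamma (1 + f - (1+f-g)) * Gamma (1+f-e) * Gamma (1 + (1+f-e) - (1+f-g)))
     = (g - f) * of_real pi * L (f-a) (f-b) (f-c) (f-d) (1+f-g) f (1+f-e) * G"
    by (simp add: G_def algebra_simps)
  finally have l1: "(\<lambda>n. (1 - e) * (of_nat n * wronskian_coeff (f-a) (f-b) (f-c) (f-d) (1+f-g) f (1+f-e) n))
    \<longlonglongrightarrow> (1 - e) * ((g - f) * of_real pi * L (f-a) (f-b) (f-c) (f-d) (1+f-g) f (1+f-e) * G)"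
    by (intro tendsto_mult_left)
  have l2: "(\<lambda>n. (g - f) * (of_nat n * wronskian_coeff a b c d e f g n))
    \<longlonglongrightarrow> (g - f) * ((1 - e) * of_real pi * L a b c d e f g * G)"
    unfolding G_def by (intro tendsto_mult_left wronskian_coeff_tendsto bal nonint)
  have eq: "(1 - e) * (of_nat n * wronskian_coeff (f-a) (f-b) (f-c) (f-d) (1+f-g) f (1+f-e) n)
     = (g - f) * (of_nat n * wronskian_coeff a b c d e f g n)" for n
    using wronskian_coeff_dual[OF bal nonint, of n] by algebra
  have *: "(1 - e) * ((g - f) * of_real pi * L (f-a) (f-b) (f-c) (f-d) (1+f-g) f (1+f-e) * G)
     = (g - f) * ((1 - e) * of_real pi * L a b c d e f g * G)"
    using LIMSEQ_unique[OF l1[unfolded eq] l2] .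
  moreover have "1 - e \<noteq> 0" "g - f \<noteq> 0"
    using nonint neg by auto
  moreover have "G \<noteq> 0"
  proof -
    have "1 + f - e \<notin> \<int>\<^sub>\<le>\<^sub>0" "1 + g - e \<notin> \<int>\<^sub>\<le>\<^sub>0" "f \<notin> \<int>\<^sub>\<le>\<^sub>0" "g \<notin> \<int>\<^sub>\<le>\<^sub>0"
      using nonint by (auto simp: not_Ints_imp simp flip: add_diff_eq)
    then show ?thesis by (simp add: G_def Gamma_eq_zero_iff)
  qed
  moreover have "of_real pi \<noteq> (0::complex)" by simp
  ultimately show ?thesis by simp
qed

section \<open>Partial fractions\<close>

text \<open>The residue at \<open>p i\<close> of the product of all (s - q j) / (s - p j), provided
  the poles are distinct.\<close>

definition pf_residue :: "('i \<Rightarrow> 'a::field) \<Rightarrow> ('i \<Rightarrow> 'a) \<Rightarrow> 'i set \<Rightarrow> 'i \<Rightarrow> 'a" where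
  "pf_residue p q I i = (\<Prod>j\<in>I. p i - q j) / (\<Prod>j\<in>I - {i}. p i - p j)"

lemma pf_residue_insert:
  fixes p q :: "'i \<Rightarrow> 'a::field"
  assumes "finite I" "inj_on p (insert l I)" "l \<notin> I"
  shows "i \<in> I \<Longrightarrow> pf_residue p q (insert l I) i = pf_residue p q I i * (1 + (p l - q l) / (p i - p l))"
    "pf_residue p q (insert l I) l = (p l - q l) * (\<Prod>j\<in>I. (p l - q j) / (p l - p j))"
proof -
  show "pf_residue p q (insert l I) l = (p l - q l) * (\<Prod>j\<in>I. (p l - q j) / (p l - p j))"
    using assms by (simp add: pf_residue_def prod_dividef)
  assume i: "i \<in> I"
  then have "insert l I - {i} = insert l (I - {i})" "p i \<noteq> p l"
    using assms by (auto simp: inj_on_def)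
  then show "pf_residue p q (insert l I) i = pf_residue p q I i * (1 + (p l - q l) / (p i - p l))"
    using assms i by (simp add: pf_residue_def divide_simps)
qed

text \<open>The residue at the newly inserted pole is governed by the old product evaluated there,
  which the induction hypothesis expands in turn. Hence the induction is over arbitrary s.\<close>

lemma prod_partial_fractions:
  fixes p q :: "'i \<Rightarrow> 'a::field"
  assumes "finite I" "inj_on p I" "s \<notin> p ` I"
  shows "(\<Prod>i\<in>I. (s - q i) / (s - p i)) = 1 + (\<Sum>i\<in>I. pf_residue p q I i / (s - p i))"
  using assms
proof (induction I arbitrary: s rule: finite_induct)
  case empty
  then show ?case by simp
next
  case (insert l I)
  note res = pf_residue_insert[OF insert.hyps(1) insert.prems(1) insert.hyps(2), where q = q]
  have inj: "inj_on p I" and pl: "p l \<notin> p ` I"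
    using insert.hyps insert.prems by (auto simp: inj_on_def)
  have s: "s \<notin> p ` I" "s \<noteq> p l" using insert.prems by auto
  define P where "P = (\<Sum>i\<in>I. pf_residue p q I i / (s - p i))"
  have "(\<Sum>i\<in>insert l I. pf_residue p q (insert l I) i / (s - p i))
    = (p l - q l) / (s - p l) * (1 + (\<Sum>i\<in>I. pf_residue p q I i / (p l - p i)))
      + (\<Sum>i\<in>I. pf_residue p q I i * (1 + (p l - q l) / (p i - p l)) / (s - p i))"
    using insert.hyps by (simp add: res insert.IH[OF inj pl])
  also have "\<dots> = (p l - q l) / (s - p l)
    + (\<Sum>i\<in>I. (p l - q l) / (s - p l) * (pf_residue p q I i / (p l - p i))
      + pf_residue p q I i * (1 + (p l - q l) / (p i - p l)) / (s - p i))"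
    by (simp add: ring_distribs sum.distrib sum_distrib_left)
  also have "(\<Sum>i\<in>I. (p l - q l) / (s - p l) * (pf_residue p q I i / (p l - p i))
      + pf_residue p q I i * (1 + (p l - q l) / (p i - p l)) / (s - p i))
    = (\<Sum>i\<in>I. (1 + (p l - q l) / (s - p l)) * (pf_residue p q I i / (s - p i)))"
  proof (intro sum.cong refl)
    fix i assume "i \<in> I"
    then have ne: "s - p i \<noteq> 0" "s - p l \<noteq> 0" "p l - p i \<noteq> 0" using s pl by auto
    \<comment> \<open>With these names all three denominators are u, v and u + v, and the step
      reduces to 1/(uv) = (1/u + 1/v) / (u + v).\<close>
    define u v where "u = s - p l" and "v = p l - p i"
    have uv: "s - p i = u + v" "p i - p l = - v" by (simp_all add: u_def v_def)
    have "inverse u * inverse v = (inverse u + inverse v) * inverse (u + v)"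
      using ne unfolding uv u_def[symmetric] v_def[symmetric] by (simp add: field_simps)
    then show "(p l - q l) / (s - p l) * (pf_residue p q I i / (p l - p i))
      + pf_residue p q I i * (1 + (p l - q l) / (p i - p l)) / (s - p i)
      = (1 + (p l - q l) / (s - p l)) * (pf_residue p q I i / (s - p i))"
      unfolding uv u_def[symmetric] v_def[symmetric] divide_inverse inverse_minus_eq by algebra
  qed
  also have "\<dots> = (1 + (p l - q l) / (s - p l)) * P"
    by (simp add: P_def sum_distrib_left)
  finally have "1 + (\<Sum>i\<in>insert l I. pf_residue p q (insert l I) i / (s - p i))
     = (1 + (p l - q l) / (s - p l)) * (1 + P)"
    unfolding distrib_left distrib_right mult_1_left mult_1_right by (simp only: add_ac)
  also have "1 + (p l - q l) / (s - p l) = (s - q l) / (s - p l)"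
    using s by (simp add: field_simps)
  finally show ?case
    using insert.hyps insert.IH[OF inj s(1)] by (simp add: P_def)
qed

text \<open>Both sides are the coefficient of 1/s in the expansion of the product at infinity. The
  induction replaces this expansion by an exact cancellation.\<close>

lemma sum_pf_residue:
  fixes p q :: "'i \<Rightarrow> 'a::field"
  assumes "finite I" "inj_on p I"
  shows "(\<Sum>i\<in>I. pf_residue p q I i) = (\<Sum>i\<in>I. p i - q i)"
  using assms
proof (induction I rule: finite_induct)
  case (insert l I)
  note res = pf_residue_insert[OF insert.hyps(1) insert.prems(1) insert.hyps(2), where q = q]
  have inj: "inj_on p I" and pl: "p l \<notin> p ` I"
    using insert.hyps insert.prems by (auto simp: inj_on_def)
  have "(\<Sum>i\<in>insert l I. pf_residue p q (insert l I) i)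
    = (p l - q l) * (1 + (\<Sum>i\<in>I. pf_residue p q I i / (p l - p i)))
      + (\<Sum>i\<in>I. pf_residue p q I i * (1 + (p l - q l) / (p i - p l)))"
    using insert.hyps by (simp add: res prod_partial_fractions[OF insert.hyps(1) inj pl])
  also have "\<dots> = (p l - q l) + (\<Sum>i\<in>I. (p l - q l) * (pf_residue p q I i / (p l - p i))
      + pf_residue p q I i * (1 + (p l - q l) / (p i - p l)))"
    by (simp add: ring_distribs sum.distrib sum_distrib_left)
  also have "(\<Sum>i\<in>I. (p l - q l) * (pf_residue p q I i / (p l - p i))
      + pf_residue p q I i * (1 + (p l - q l) / (p i - p l))) = (\<Sum>i\<in>I. pf_residue p q I i)"
  proof (intro sum.cong refl)
    fix i
    define v where "v = p l - p i"
    have v: "p i - p l = - v" by (simp add: v_def)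
    show "(p l - q l) * (pf_residue p q I i / (p l - p i))
      + pf_residue p q I i * (1 + (p l - q l) / (p i - p l)) = pf_residue p q I i"
      unfolding v v_def[symmetric] divide_inverse inverse_minus_eq by (simp add: algebra_simps)
  qed
  finally show ?case
    using insert.hyps insert.IH[OF inj] by simp
qed auto

section \<open>Residues for arithmetic progressions of zeros and poles\<close>

lemma prod_shift_eq_pochhammer:
  fixes x :: "'a::comm_ring_1"
  assumes "k \<le> n"
  shows "(\<Prod>j<n. x + of_nat j - of_nat k) = (-1) ^ k * pochhammer (1 - x) k * pochhammer x (n - k)"
proof -
  have "{..<n} = {..<k} \<union> {k..<n}" using assms by auto
  then have "(\<Prod>j<n. x + of_nat j - of_nat k)
    = (\<Prod>j<k. x + of_nat j - of_nat k) * (\<Prod>j=k..<n. x + of_nat j - of_nat k)"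
    by (simp add: prod.union_disjoint ivl_disj_int)
  also have "(\<Prod>j=k..<n. x + of_nat j - of_nat k) = (\<Prod>j<n - k. x + of_nat j)"
    by (rule prod.reindex_bij_witness[where i = "\<lambda>j. j + k" and j = "\<lambda>j. j - k"])
      (use assms in \<open>auto simp: of_nat_diff\<close>)
  also have "(\<Prod>j<k. x + of_nat j - of_nat k) = (\<Prod>j<k. - (1 - x + of_nat j))"
    by (rule prod.reindex_bij_witness[where i = "\<lambda>j. k - 1 - j" and j = "\<lambda>j. k - 1 - j"])
      (auto simp: of_nat_diff)
  also have "\<dots> = (-1) ^ k * pochhammer (1 - x) k"
    unfolding pochhammer_prod lessThan_atLeast0[symmetric]
    by (subst prod_uminus) simp
  finally show ?thesis
    by (simp add: pochhammer_prod lessThan_atLeast0)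
qed

lemma prod_shift_punctured:
  assumes "k < n"
  shows "(\<Prod>j\<in>{..<n} - {k}. of_nat j - of_nat k :: 'a::{comm_ring_1,semiring_char_0}) = (-1) ^ k * fact k * fact (n - k - 1)"
proof -
  have "{..<n} - {k} = {..<k} \<union> {Suc k..<n}" using assms by auto
  then have "(\<Prod>j\<in>{..<n} - {k}. of_nat j - of_nat k :: 'a)
    = (\<Prod>j<k. of_nat j - of_nat k) * (\<Prod>j=Suc k..<n. of_nat j - of_nat k)"
    by (simp add: prod.union_disjoint disjoint_iff)
  also have "(\<Prod>j=Suc k..<n. of_nat j - of_nat k :: 'a) = (\<Prod>j<n - k - 1. 1 + of_nat j)"
    by (rule prod.reindex_bij_witness[where i = "\<lambda>j. j + Suc k" and j = "\<lambda>j. j - Suc k"])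
      (use assms in \<open>auto simp: of_nat_diff\<close>)
  also have "(\<Prod>j<k. of_nat j - of_nat k :: 'a) = (\<Prod>j<k. - (1 + of_nat j))"
    by (rule prod.reindex_bij_witness[where i = "\<lambda>j. k - 1 - j" and j = "\<lambda>j. k - 1 - j"])
      (auto simp: of_nat_diff)
  also have "\<dots> = (-1) ^ k * pochhammer 1 k"
    unfolding pochhammer_prod lessThan_atLeast0[symmetric]
    by (subst prod_uminus) simp
  finally show ?thesis
    by (simp add: pochhammer_prod lessThan_atLeast0[symmetric] pochhammer_fact)
qed

lemma prod_Times_minus_singleton:
  assumes "finite P" "finite Q" "i \<in> P"
  shows "(\<Prod>x\<in>P \<times> Q - {(i, k)}. h (fst x) (snd x))
    = (\<Prod>j\<in>Q - {k}. h i j) * (\<Prod>i'\<in>P - {i}. \<Prod>j\<in>Q. h i' j)"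
proof -
  have "P \<times> Q - {(i, k)} = Pair i ` (Q - {k}) \<union> (P - {i}) \<times> Q"
    using assms(3) by auto
  moreover have "Pair i ` (Q - {k}) \<inter> ((P - {i}) \<times> Q) = {}" by auto
  ultimately have "(\<Prod>x\<in>P \<times> Q - {(i, k)}. h (fst x) (snd x))
    = (\<Prod>x\<in>Pair i ` (Q - {k}). h (fst x) (snd x)) * (\<Prod>x\<in>(P - {i}) \<times> Q. h (fst x) (snd x))"
    using assms by (simp add: prod.union_disjoint)
  also have "(\<Prod>x\<in>Pair i ` (Q - {k}). h (fst x) (snd x)) = (\<Prod>j\<in>Q - {k}. h i j)"
    by (subst prod.reindex) (auto simp: inj_on_def)
  also have "(\<Prod>x\<in>(P - {i}) \<times> Q. h (fst x) (snd x)) = (\<Prod>i'\<in>P - {i}. \<Prod>j\<in>Q. h i' j)"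
    by (simp add: prod.cartesian_product case_prod_beta)
  finally show ?thesis .
qed

text \<open>Each progression contributes two Pochhammer symbols, from its factors before and after
  position k, together with a sign (-1)^k. The r signs of the numerator cancel against one from the
  punctured progression of the pole itself and r - 1 from the others. The puncture also accounts for
  the factorial of n - k - 1.\<close>

lemma pf_residue_shifted:
  fixes \<alpha> \<beta> :: "nat \<Rightarrow> complex"
  assumes i: "i < r" and k: "k < n"
  shows "pf_residue (\<lambda>x. - \<alpha> (fst x) - of_nat (snd x)) (\<lambda>x. - \<beta> (fst x) - of_nat (snd x)) ({..<r} \<times> {..<n}) (i, k)
    = (\<Prod>i'<r. pochhammer (1 + \<alpha> i - \<beta> i') k * pochhammer (\<beta> i' - \<alpha> i) (n - k))
      / (fact k * fact (n - k - 1) *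
         (\<Prod>i'\<in>{..<r} - {i}. pochhammer (1 + \<alpha> i - \<alpha> i') k * pochhammer (\<alpha> i' - \<alpha> i) (n - k)))"
proof -
  have s: "(-1::complex) ^ k \<noteq> 0" by simp
  have shift: "(\<Prod>j<n. - \<alpha> i - of_nat k - (- y - of_nat j))
      = (-1) ^ k * (pochhammer (1 + \<alpha> i - y) k * pochhammer (y - \<alpha> i) (n - k))" for y
    using prod_shift_eq_pochhammer[of k n "y - \<alpha> i"] k by (simp add: algebra_simps)
  have "(\<Prod>x\<in>{..<r} \<times> {..<n}. - \<alpha> i - of_nat k - (- \<beta> (fst x) - of_nat (snd x)))
    = (\<Prod>i'<r. \<Prod>j<n. - \<alpha> i - of_nat k - (- \<beta> i' - of_nat j))"
    by (simp add: prod.cartesian_product case_prod_beta)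
  also have "\<dots> = (\<Prod>i'<r. (-1) ^ k * (pochhammer (1 + \<alpha> i - \<beta> i') k * pochhammer (\<beta> i' - \<alpha> i) (n - k)))"
    unfolding shift ..
  also have "\<dots> = ((-1) ^ k) ^ r * (\<Prod>i'<r. pochhammer (1 + \<alpha> i - \<beta> i') k * pochhammer (\<beta> i' - \<alpha> i) (n - k))"
    by (simp only: prod.distrib prod_constant card_lessThan)
  finally have num: "(\<Prod>x\<in>{..<r} \<times> {..<n}. - \<alpha> i - of_nat k - (- \<beta> (fst x) - of_nat (snd x))) = \<dots>" .
  have sgn: "(-1) ^ k * fact k * fact (n - k - 1) * (((-1) ^ k) ^ (r - 1) * D)
      = ((-1) ^ k) ^ r * (fact k * fact (n - k - 1) * D)" for D :: complex
  proof -
    have "((-1::complex) ^ k) ^ r = (-1) ^ k * ((-1) ^ k) ^ (r - 1)"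
      using i by (cases r) simp_all
    then show ?thesis by (simp only: mult_ac)
  qed
  have "(\<Prod>x\<in>{..<r} \<times> {..<n} - {(i, k)}. - \<alpha> i - of_nat k - (- \<alpha> (fst x) - of_nat (snd x)))
    = (\<Prod>j\<in>{..<n} - {k}. - \<alpha> i - of_nat k - (- \<alpha> i - of_nat j)) *
      (\<Prod>i'\<in>{..<r} - {i}. \<Prod>j<n. - \<alpha> i - of_nat k - (- \<alpha> i' - of_nat j))"
    using i by (intro prod_Times_minus_singleton) auto
  also have "(\<Prod>j\<in>{..<n} - {k}. - \<alpha> i - of_nat k - (- \<alpha> i - of_nat j)) = (-1) ^ k * fact k * fact (n - k - 1)"
    using prod_shift_punctured[OF k, where 'a = complex] by simp
  also have "(\<Prod>i'\<in>{..<r} - {i}. \<Prod>j<n. - \<alpha> i - of_nat k - (- \<alpha> i' - of_nat j))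
    = ((-1) ^ k) ^ (r - 1) * (\<Prod>i'\<in>{..<r} - {i}. pochhammer (1 + \<alpha> i - \<alpha> i') k * pochhammer (\<alpha> i' - \<alpha> i) (n - k))"
    unfolding shift using i by (simp only: prod.distrib prod_constant) simp
  finally have den: "(\<Prod>x\<in>{..<r} \<times> {..<n} - {(i, k)}. - \<alpha> i - of_nat k - (- \<alpha> (fst x) - of_nat (snd x)))
    = ((-1) ^ k) ^ r * (fact k * fact (n - k - 1) *
       (\<Prod>i'\<in>{..<r} - {i}. pochhammer (1 + \<alpha> i - \<alpha> i') k * pochhammer (\<alpha> i' - \<alpha> i) (n - k)))"
    unfolding sgn .
  show ?thesis
    unfolding pf_residue_def fst_conv snd_conv num den
    using s by (intro mult_divide_mult_cancel_left) simp
qed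

section \<open>Residue series of quotients of Gamma functions\<close>

text \<open>The residue of \<open>(1+s)\<^sub>n (e+s)\<^sub>n (f+s)\<^sub>n (g+s)\<^sub>n / ((a+s)\<^sub>n (b+s)\<^sub>n (c+s)\<^sub>n (d+s)\<^sub>n)\<close> at \<open>s = -a-k\<close> is a term of a
  hypergeometric series times this factor at \<open>m = n-k > 0\<close>.\<close>

definition residue_factor :: "complex \<Rightarrow> complex \<Rightarrow> complex \<Rightarrow> complex \<Rightarrow> complex \<Rightarrow> complex \<Rightarrow> complex \<Rightarrow> nat \<Rightarrow> complex" where
  "residue_factor a b c d e f g m =
    (pochhammer (1 - a) m * pochhammer (e - a) m * pochhammer (f - a) m * pochhammer (g - a) m) /
    (fact (m - 1) * pochhammer (b - a) m * pochhammer (c - a) m * pochhammer (d - a) m)"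

definition residue_coeff :: "complex \<Rightarrow> complex \<Rightarrow> complex \<Rightarrow> complex \<Rightarrow> complex \<Rightarrow> complex \<Rightarrow> complex \<Rightarrow> nat \<Rightarrow> nat \<Rightarrow> complex" where
  "residue_coeff a b c d e f g n k =
    hyp_coeff a (1 + a - e) (1 + a - f) (1 + a - g) (1 + a - b) (1 + a - c) (1 + a - d) k
      * residue_factor a b c d e f g (n - k)"

text \<open>Non-integral differences keep the 4n poles distinct. In the sum of residues, pole and
  zero at the same position of a progression differ by a constant, so the total is linear in n
  although the individual residue coefficients can grow quadratically.\<close>

lemma
  fixes a b c d e f g :: complex
  assumes ab: "b - a \<notin> \<int>" "c - a \<notin> \<int>" "d - a \<notin> \<int>" "c - b \<notin> \<int>" "d - b \<notin> \<int>" "d - c \<notin> \<int>"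
  shows pochhammer_quotient_partial_fractions:
    "\<lbrakk>\<forall>k. s + a + of_nat k \<noteq> 0; \<forall>k. s + b + of_nat k \<noteq> 0; \<forall>k. s + c + of_nat k \<noteq> 0; \<forall>k. s + d + of_nat k \<noteq> 0\<rbrakk> \<Longrightarrow>
      (pochhammer (1 + s) n * pochhammer (e + s) n * pochhammer (f + s) n * pochhammer (g + s) n) /
      (pochhammer (a + s) n * pochhammer (b + s) n * pochhammer (c + s) n * pochhammer (d + s) n)
      = 1 + (\<Sum>k<n. residue_coeff a b c d e f g n k / (s + a + of_nat k))
          + (\<Sum>k<n. residue_coeff b a c d e f g n k / (s + b + of_nat k))
          + (\<Sum>k<n. residue_coeff c a b d e f g n k / (s + c + of_nat k))
          + (\<Sum>k<n. residue_coeff d a b c e f g n k / (s + d + of_nat k))"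
    and sum_residue_coeff:
    "(\<Sum>k<n. residue_coeff a b c d e f g n k) + (\<Sum>k<n. residue_coeff b a c d e f g n k)
      + (\<Sum>k<n. residue_coeff c a b d e f g n k) + (\<Sum>k<n. residue_coeff d a b c e f g n k)
      = of_nat n * (1 + e + f + g - a - b - c - d)"
proof -
  define \<alpha> \<beta> where "\<alpha> = (!) [a, b, c, d]" and "\<beta> = (!) [1, e, f, g]"
  have \<alpha>: "\<alpha> 0 = a" "\<alpha> 1 = b" "\<alpha> 2 = c" "\<alpha> 3 = d" and \<beta>: "\<beta> 0 = 1" "\<beta> 1 = e" "\<beta> 2 = f" "\<beta> 3 = g"
    by (simp_all add: \<alpha>_def \<beta>_def)
  define p q where "p = (\<lambda>x. - \<alpha> (fst x) - of_nat (snd x))" and "q = (\<lambda>x. - \<beta> (fst x) - of_nat (snd x))"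
  define I where "I = {..<4::nat} \<times> {..<n}"
  have ba: "a - b \<notin> \<int>" "a - c \<notin> \<int>" "a - d \<notin> \<int>" "b - c \<notin> \<int>" "b - d \<notin> \<int>" "c - d \<notin> \<int>"
    using ab by (metis minus_diff_eq minus_in_Ints_iff)+
  have less4: "{..<4} = {0, 1, 2, 3::nat}" by auto
  have nonint: "\<alpha> i - \<alpha> j \<notin> \<int>" if "i < 4" "j < 4" "i \<noteq> j" for i j
  proof -
    have "\<forall>i\<in>{0, 1, 2, 3}. \<forall>j\<in>{0, 1, 2, 3}. i \<noteq> j \<longrightarrow> \<alpha> i - \<alpha> j \<notin> \<int>"
      using \<alpha> ab ba by simp
    then show ?thesis
      unfolding less4[symmetric] using that by simp
  qed
  have inj: "inj_on p I"
  proof (rule inj_onI)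
    fix x y assume xy: "x \<in> I" "y \<in> I" "p x = p y"
    have "\<alpha> (fst x) - \<alpha> (fst y) = of_nat (snd y) - of_nat (snd x)"
      using xy(3) by (simp add: p_def algebra_simps)
    then have "\<alpha> (fst x) - \<alpha> (fst y) \<in> \<int>" by simp
    then have "fst x = fst y"
      using nonint[of "fst x" "fst y"] xy by (cases "fst x = fst y") (simp_all add: I_def mem_Times_iff)
    with xy(3) show "x = y" by (simp add: p_def prod_eq_iff)
  qed
  have fin: "finite I" by (simp add: I_def)
  have sumI: "(\<Sum>x\<in>I. h x) = (\<Sum>k<n. h (0, k)) + (\<Sum>k<n. h (1, k)) + (\<Sum>k<n. h (2, k)) + (\<Sum>k<n. h (3, k))"
    for h :: "nat \<times> nat \<Rightarrow> complex"
    proof -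
    have "(\<Sum>x\<in>I. h x) = (\<Sum>i\<in>{0, 1, 2, 3}. \<Sum>k<n. h (i, k))"
      unfolding I_def less4 sum.cartesian_product by (simp add: case_prod_beta)
    then show ?thesis by (simp add: add.assoc)
  qed
  have prodI: "(\<Prod>x\<in>I. h x) = (\<Prod>k<n. h (0, k)) * (\<Prod>k<n. h (1, k)) * (\<Prod>k<n. h (2, k)) * (\<Prod>k<n. h (3, k))"
    for h :: "nat \<times> nat \<Rightarrow> complex"
    proof -
    have "(\<Prod>x\<in>I. h x) = (\<Prod>i\<in>{0, 1, 2, 3}. \<Prod>k<n. h (i, k))"
      unfolding I_def less4 prod.cartesian_product by (simp add: case_prod_beta)
    then show ?thesis by (simp add: mult.assoc)
  qed
  have m4: "{0, 1, 2, 3} - {0} = {1, 2, 3::nat}" "{0, 1, 2, 3} - {1} = {0, 2, 3::nat}"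
    "{0, 1, 2, 3} - {2} = {0, 1, 3::nat}" "{0, 1, 2, 3} - {3} = {0, 1, 2::nat}" by auto
  note R = pf_residue_shifted[of _ 4 _ n \<alpha> \<beta>, folded p_def q_def I_def, unfolded less4]
  have res: "k < n \<Longrightarrow> pf_residue p q I (0, k) = residue_coeff a b c d e f g n k"
    "k < n \<Longrightarrow> pf_residue p q I (1, k) = residue_coeff b a c d e f g n k"
    "k < n \<Longrightarrow> pf_residue p q I (2, k) = residue_coeff c a b d e f g n k"
    "k < n \<Longrightarrow> pf_residue p q I (3, k) = residue_coeff d a b c e f g n k" for k
    by (simp_all only: R m4) (simp_all add: \<alpha>[unfolded One_nat_def] \<beta>[unfolded One_nat_def] residue_coeff_def hyp_coeff_def residue_factor_def mult_ac)
  show "(\<Sum>k<n. residue_coeff a b c d e f g n k) + (\<Sum>k<n. residue_coeff b a c d e f g n k)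
      + (\<Sum>k<n. residue_coeff c a b d e f g n k) + (\<Sum>k<n. residue_coeff d a b c e f g n k)
      = of_nat n * (1 + e + f + g - a - b - c - d)"
    (is "?S = _")
  proof -
    have "?S = (\<Sum>x\<in>I. pf_residue p q I x)"
      unfolding sumI by (simp add: res flip: One_nat_def)
    also have "\<dots> = (\<Sum>x\<in>I. p x - q x)"
      by (rule sum_pf_residue[OF fin inj])
    also have "\<dots> = of_nat n * (1 + e + f + g - a - b - c - d)"
      unfolding sumI p_def q_def fst_conv snd_conv \<alpha> \<beta> by (simp add: algebra_simps)
    finally show ?thesis .
  qed
  assume s: "\<forall>k. s + a + of_nat k \<noteq> 0" "\<forall>k. s + b + of_nat k \<noteq> 0" "\<forall>k. s + c + of_nat k \<noteq> 0" "\<forall>k. s + d + of_nat k \<noteq> 0"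
  have "s \<noteq> p x" if "x \<in> I" for x
  proof
    assume "s = p x"
    then have "s + \<alpha> (fst x) + of_nat (snd x) = 0" by (simp add: p_def)
    moreover have "\<alpha> (fst x) \<in> {a, b, c, d}"
      using that \<alpha> by (auto simp: I_def less4)
    ultimately show False using s by auto
  qed
  then have "s \<notin> p ` I" by auto
  from prod_partial_fractions[OF fin inj this, of q]
  have "(\<Prod>x\<in>I. (s - q x) / (s - p x)) = 1 + (\<Sum>x\<in>I. pf_residue p q I x / (s - p x))" .
  moreover have "(\<Prod>x\<in>I. (s - q x) / (s - p x)) = 
      (pochhammer (1 + s) n * pochhammer (e + s) n * pochhammer (f + s) n * pochhammer (g + s) n) /
      (pochhammer (a + s) n * pochhammer (b + s) n * pochhammer (c + s) n * pochhammer (d + s) n)"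
      proof -
    have sub: "s - (- x - y) = x + s + y" for x y :: complex by simp
    show ?thesis
      unfolding prod_dividef prodI p_def q_def fst_conv snd_conv \<alpha> \<beta> sub pochhammer_prod lessThan_atLeast0 ..
  qed
  moreover have "(\<Sum>x\<in>I. pf_residue p q I x / (s - p x))
      = (\<Sum>k<n. residue_coeff a b c d e f g n k / (s + a + of_nat k))
          + (\<Sum>k<n. residue_coeff b a c d e f g n k / (s + b + of_nat k))
          + (\<Sum>k<n. residue_coeff c a b d e f g n k / (s + c + of_nat k))
          + (\<Sum>k<n. residue_coeff d a b c e f g n k / (s + d + of_nat k))"
  proof -
    have sp: "s - p (0, k) = s + a + of_nat k" "s - p (1, k) = s + b + of_nat k"
      "s - p (2, k) = s + c + of_nat k" "s - p (3, k) = s + d + of_nat k" for k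
      unfolding p_def fst_conv snd_conv \<alpha> by simp_all
    show ?thesis
      unfolding sumI sp by (simp add: res flip: One_nat_def)
  qed
  ultimately show "(pochhammer (1 + s) n * pochhammer (e + s) n * pochhammer (f + s) n * pochhammer (g + s) n) /
      (pochhammer (a + s) n * pochhammer (b + s) n * pochhammer (c + s) n * pochhammer (d + s) n)
      = 1 + (\<Sum>k<n. residue_coeff a b c d e f g n k / (s + a + of_nat k))
          + (\<Sum>k<n. residue_coeff b a c d e f g n k / (s + b + of_nat k))
          + (\<Sum>k<n. residue_coeff c a b d e f g n k / (s + c + of_nat k))
          + (\<Sum>k<n. residue_coeff d a b c e f g n k / (s + d + of_nat k))"
    by (simp add: add.assoc)
qed

lemma residue_factor_tendsto:
  assumes "b - a \<notin> \<int>\<^sub>\<le>\<^sub>0" "c - a \<notin> \<int>\<^sub>\<le>\<^sub>0" "d - a \<notin> \<int>\<^sub>\<le>\<^sub>0" and bal: "e + f + g = 1 + a + b + c + d"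
  shows "(\<lambda>m. residue_factor a b c d e f g m / of_nat m ^ 2)
    \<longlonglongrightarrow> rGamma (1 - a) * rGamma (e - a) * rGamma (f - a) * rGamma (g - a)
      * (Gamma (b - a) * Gamma (c - a) * Gamma (d - a))"
proof -
  \<comment> \<open>Growth of order m rather than m^2: the limit lemma needs m! =
    \<open>pochhammer 1 m\<close> below, while \<open>residue_factor\<close> has the factorial of m
    - 1. The second factor m comes from this difference.\<close>
  have "1 + (b - a) + (c - a) + (d - a) = (1 - a) + (e - a) + (f - a) + (g - a) + of_int (-1)"
    using bal by (simp add: algebra_simps)
  from pochhammer_ratio_tendsto[OF one_notin_nonpos_Ints assms(1-3) this]
  have "(\<lambda>m. of_nat m powi - 1 * (pochhammer (1 - a) m * pochhammer (e - a) m * pochhammer (f - a) m * pochhammer (g - a) m /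
      (pochhammer 1 m * pochhammer (b - a) m * pochhammer (c - a) m * pochhammer (d - a) m)))
    \<longlonglongrightarrow> rGamma (1 - a) * rGamma (e - a) * rGamma (f - a) * rGamma (g - a)
      * (Gamma (b - a) * Gamma (c - a) * Gamma (d - a))"
    by simp
  then show ?thesis
  proof (rule Lim_transform_eventually)
    show "\<forall>\<^sub>F m in sequentially. of_nat m powi - 1 * (pochhammer (1 - a) m * pochhammer (e - a) m * pochhammer (f - a) m * pochhammer (g - a) m /
      (pochhammer 1 m * pochhammer (b - a) m * pochhammer (c - a) m * pochhammer (d - a) m))
      = residue_factor a b c d e f g m / of_nat m ^ 2"
      using eventually_gt_at_top[of 0]
    proof eventually_elim
      case (elim m)
      have "pochhammer 1 m = (of_nat m * fact (m - 1) :: complex)"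
        using elim by (simp add: pochhammer_fact[symmetric] fact_reduce)
      then show ?case
        using elim by (simp add: residue_factor_def power_int_minus power2_eq_square divide_simps)
    qed
  qed
qed


section \<open>Truncated cotangent series and the Digamma function\<close>

text \<open>Differentiate the reflection formula for
  \<open>rGamma z * rGamma (1 - z)\<close>.\<close>

lemma Digamma_reflection:
  fixes z :: complex
  assumes "z \<notin> \<int>"
  shows "sinpi z * (Digamma (1 - z) - Digamma z) = of_real pi * cos (of_real pi * z)"
proof -
  have z: "z \<notin> \<int>\<^sub>\<le>\<^sub>0" "1 - z \<notin> \<int>\<^sub>\<le>\<^sub>0" using assms by (auto dest!: nonpos_Ints_Int)
  have eq: "rGamma w * rGamma (1 - w) = sin (of_real pi * w) / of_real pi" for w :: complex
    by (rule rGamma_reflection_complex)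
  have "((\<lambda>w. rGamma w * rGamma (1 - w)) has_field_derivative
      (- rGamma z * Digamma z) * rGamma (1 - z) + (- rGamma (1 - z) * Digamma (1 - z)) * (-1) * rGamma z) (at z)"
    using z by (auto intro!: derivative_eq_intros DERIV_chain2[where f = rGamma] has_field_derivative_rGamma_no_nonpos_int)
  moreover have "((\<lambda>w. sin (of_real pi * w) / of_real pi) has_field_derivative cos (of_real pi * z)) (at z)"
    by (auto intro!: derivative_eq_intros)
  ultimately have "(- rGamma z * Digamma z) * rGamma (1 - z) + (- rGamma (1 - z) * Digamma (1 - z)) * (-1) * rGamma z
      = cos (of_real pi * z)"
    unfolding eq by (rule DERIV_unique)
  then have "(rGamma z * rGamma (1 - z)) * (Digamma (1 - z) - Digamma z) = cos (of_real pi * z)"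
    by (simp add: algebra_simps)
  then show ?thesis unfolding eq by (simp add: sinpi_def field_simps)
qed

text \<open>A truncation of the partial fraction series of \<open>\<pi> cot (\<pi> z)\<close>; its summands range over the
  integers from \<open>-n\<close> to \<open>n-1\<close>.\<close>

definition reciprocal_sum :: "complex \<Rightarrow> nat \<Rightarrow> nat \<Rightarrow> complex" where
  "reciprocal_sum z n k = (\<Sum>j<n. 1 / (of_nat j + z + of_nat k)) + (\<Sum>j<n. 1 / (- 1 - of_nat j + z + of_nat k))"

lemma reciprocal_sum_eq:
  assumes "k < n"
  shows "reciprocal_sum z n k = (\<Sum>i<n + k. inverse (z + of_nat i)) - (\<Sum>i<n - k. inverse (1 - z + of_nat i))"
proof -
  have "(\<Sum>j<n. 1 / (of_nat j + z + of_nat k)) = (\<Sum>i=k..<n + k. inverse (z + of_nat i))"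
    by (rule sum.reindex_bij_witness[where i = "\<lambda>i. i - k" and j = "\<lambda>j. j + k"])
      (auto simp: inverse_eq_divide add_ac)
  moreover have "(\<Sum>j<n. 1 / (- 1 - of_nat j + z + of_nat k))
      = (\<Sum>j<k. 1 / (- 1 - of_nat j + z + of_nat k)) + (\<Sum>j=k..<n. 1 / (- 1 - of_nat j + z + of_nat k))"
  proof -
    have "{..<n} = {..<k} \<union> {k..<n}" using assms by auto
    then show ?thesis by (simp add: sum.union_disjoint ivl_disj_int)
  qed
  moreover have "(\<Sum>j<k. 1 / (- 1 - of_nat j + z + of_nat k)) = (\<Sum>i<k. inverse (z + of_nat i))"
    by (rule sum.reindex_bij_witness[where i = "\<lambda>i. k - 1 - i" and j = "\<lambda>j. k - 1 - j"])
      (auto simp: inverse_eq_divide of_nat_diff)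
  moreover have "(\<Sum>j=k..<n. 1 / (- 1 - of_nat j + z + of_nat k)) = (\<Sum>i<n - k. - inverse (1 - z + of_nat i))"
    by (rule sum.reindex_bij_witness[where i = "\<lambda>i. i + k" and j = "\<lambda>j. j - k"])
      (use assms in \<open>auto simp: of_nat_diff inverse_eq_divide minus_divide_right algebra_simps\<close>)
  moreover have "(\<Sum>i<n + k. inverse (z + of_nat i)) = (\<Sum>i<k. inverse (z + of_nat i)) + (\<Sum>i=k..<n + k. inverse (z + of_nat i))"
  proof -
    have "{..<n + k} = {..<k} \<union> {k..<n + k}" by auto
    then show ?thesis by (simp add: sum.union_disjoint ivl_disj_int)
  qed
  ultimately show ?thesis
    by (simp add: reciprocal_sum_def sum_negf)
qed

text \<open>The truncation is centred at 0 and not at the pole, so n + k terms on one side face n -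
  k on the other. The resulting logarithm vanishes in the limit for fixed k but is unbounded for k
  close to n; the second claim isolates it with a uniformly bounded remainder.\<close>

lemma reciprocal_sum_tendsto:
  assumes "z \<notin> \<int>"
  shows "(\<lambda>n. reciprocal_sum z n k) \<longlonglongrightarrow> Digamma (1 - z) - Digamma z"
    and "\<exists>C. \<forall>n k. k < n \<longrightarrow> norm (reciprocal_sum z n k - of_real (ln (real (n + k) / real (n - k)))) \<le> C"
proof -
  have z: "z \<noteq> 0" "1 - z \<noteq> 0" using assms by auto
  define D where "D = (\<lambda>z m. of_real (ln (real m)) - (\<Sum>i<m. inverse (z + of_nat i)) :: complex)"
  have D: "D z \<longlonglongrightarrow> Digamma z" "D (1 - z) \<longlonglongrightarrow> Digamma (1 - z)"
    unfolding D_def by (intro Digamma_LIMSEQ z)+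
  have eq: "reciprocal_sum z n k = D (1 - z) (n - k) - D z (n + k) + of_real (ln (real (n + k) / real (n - k)))" if "k < n" for n k
    using that by (simp add: reciprocal_sum_eq D_def ln_div)
  show "(\<lambda>n. reciprocal_sum z n k) \<longlonglongrightarrow> Digamma (1 - z) - Digamma z"
  proof (rule Lim_transform_eventually)
    have "(\<lambda>n. ln (real (n + k) / real (n - k))) \<longlonglongrightarrow> 0"
    proof (rule LIMSEQ_offset[where k = k], rule Lim_transform_eventually)
      have "(\<lambda>n. ln (1 + real (2 * k) * inverse (real n))) \<longlonglongrightarrow> ln (1 + real (2 * k) * 0)"
        by (intro tendsto_intros lim_inverse_n) simp
      then show "(\<lambda>n. ln (1 + real (2 * k) * inverse (real n))) \<longlonglongrightarrow> 0" by simp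
      show "\<forall>\<^sub>F n in sequentially. ln (1 + real (2 * k) * inverse (real n)) = ln (real (n + k + k) / real (n + k - k))"
        using eventually_gt_at_top[of 0] by eventually_elim (simp add: field_simps)
    qed
    then have "(\<lambda>n. of_real (ln (real (n + k) / real (n - k))) :: complex) \<longlonglongrightarrow> of_real 0"
      by (rule tendsto_of_real)
    moreover have "(\<lambda>n. D (1 - z) (n - k)) \<longlonglongrightarrow> Digamma (1 - z)"
      by (rule LIMSEQ_offset[where k = k]) (simp add: D)
    moreover have "(\<lambda>n. D z (n + k)) \<longlonglongrightarrow> Digamma z"
      by (rule LIMSEQ_ignore_initial_segment) (rule D)
    ultimately show "(\<lambda>n. D (1 - z) (n - k) - D z (n + k) + of_real (ln (real (n + k) / real (n - k))))
      \<longlonglongrightarrow> Digamma (1 - z) - Digamma z"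
      using tendsto_add[OF tendsto_diff[of "\<lambda>n. D (1 - z) (n - k)" _ _ "\<lambda>n. D z (n + k)"]] by fastforce
    show "\<forall>\<^sub>F n in sequentially. D (1 - z) (n - k) - D z (n + k) + of_real (ln (real (n + k) / real (n - k))) = reciprocal_sum z n k"
      using eventually_gt_at_top[of k] by eventually_elim (simp add: eq)
  qed
  obtain C1 C2 where C: "\<And>m. norm (D z m) \<le> C1" "\<And>m. norm (D (1 - z) m) \<le> C2"
    using convergent_imp_Bseq[of "D z"] convergent_imp_Bseq[of "D (1 - z)"] D
    by (auto simp: Bseq_def convergent_def)
  show "\<exists>C. \<forall>n k. k < n \<longrightarrow> norm (reciprocal_sum z n k - of_real (ln (real (n + k) / real (n - k)))) \<le> C"
  proof (intro exI allI impI)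
    fix n k :: nat assume "k < n"
    then show "norm (reciprocal_sum z n k - of_real (ln (real (n + k) / real (n - k)))) \<le> C2 + C1"
      using norm_triangle_le_diff[OF add_mono[OF C(2) C(1)]] by (simp add: eq)
  qed
qed

section \<open>Limits of the truncated residue relations\<close>

definition residue_series :: "complex \<Rightarrow> complex \<Rightarrow> complex \<Rightarrow> complex \<Rightarrow> complex \<Rightarrow> complex \<Rightarrow> complex \<Rightarrow> complex" where
  "residue_series a b c d e f g =
     hyp4F3 a (1 + a - e) (1 + a - f) (1 + a - g) (1 + a - b) (1 + a - c) (1 + a - d)
     * (rGamma (1 - a) * rGamma (e - a) * rGamma (f - a) * rGamma (g - a)
        * (Gamma (b - a) * Gamma (c - a) * Gamma (d - a)))"

lemma LIMSEQ_real_add_over: "(\<lambda>n. (real n + c) / real n) \<longlonglongrightarrow> 1"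
proof (rule Lim_transform_eventually)
  have "(\<lambda>n. 1 + c * inverse (real n)) \<longlonglongrightarrow> 1 + c * 0"
    by (intro tendsto_intros lim_inverse_n)
  then show "(\<lambda>n. 1 + c * inverse (real n)) \<longlonglongrightarrow> 1" by simp
  show "\<forall>\<^sub>F n in sequentially. 1 + c * inverse (real n) = (real n + c) / real n"
    using eventually_gt_at_top[of 0] by eventually_elim (simp add: field_simps)
qed

text \<open>\<open>residue_factor\<close> at n - k is of order (n-k)^2, whereas the sum is divided
  by n^2. The quotient ((n-k)/n)^2 is small for k close to n, so the weights \<phi> need to be
  bounded only after multiplication by it. This leaves room for the logarithm in
  \<open>reciprocal_sum\<close>.\<close>

lemma residue_coeff_sum_tendsto:
  assumes nonint: "b - a \<notin> \<int>" "c - a \<notin> \<int>" "d - a \<notin> \<int>" and bal: "e + f + g = 1 + a + b + c + d"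
    and \<phi>: "\<And>k. (\<lambda>n. \<phi> n k) \<longlonglongrightarrow> \<Phi>"
    and bound: "\<And>n k. k < n \<Longrightarrow> ((real n - real k) / real n) ^ 2 * norm (\<phi> n k) \<le> B"
  shows "(\<lambda>n. (\<Sum>k<n. residue_coeff a b c d e f g n k * \<phi> n k) / of_nat n ^ 2)
    \<longlonglongrightarrow> residue_series a b c d e f g * \<Phi>"
proof -
  have neg: "a - b \<notin> \<int>" "a - c \<notin> \<int>" "a - d \<notin> \<int>"
    using nonint by (metis minus_diff_eq minus_in_Ints_iff)+
  have lower: "1 + a - b \<notin> \<int>\<^sub>\<le>\<^sub>0" "1 + a - c \<notin> \<int>\<^sub>\<le>\<^sub>0" "1 + a - d \<notin> \<int>\<^sub>\<le>\<^sub>0"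
    "b - a \<notin> \<int>\<^sub>\<le>\<^sub>0" "c - a \<notin> \<int>\<^sub>\<le>\<^sub>0" "d - a \<notin> \<int>\<^sub>\<le>\<^sub>0"
    using nonint neg by (auto simp: not_Ints_imp simp flip: add_diff_eq)
  define \<tau> where "\<tau> = hyp_coeff a (1 + a - e) (1 + a - f) (1 + a - g) (1 + a - b) (1 + a - c) (1 + a - d)"
  define C where "C = rGamma (1 - a) * rGamma (e - a) * rGamma (f - a) * rGamma (g - a)
        * (Gamma (b - a) * Gamma (c - a) * Gamma (d - a))"
  define z where "z = (\<lambda>m. residue_factor a b c d e f g m / of_nat m ^ 2)"
  have z: "z \<longlonglongrightarrow> C"
    unfolding z_def C_def by (intro residue_factor_tendsto lower bal)
  then obtain M where M: "\<And>m. norm (z m) \<le> M"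
    using convergent_imp_Bseq[of z] by (auto simp: Bseq_def convergent_def)
  have bal': "(1 + a - b) + (1 + a - c) + (1 + a - d) = 1 + a + (1 + a - e) + (1 + a - f) + (1 + a - g)"
    using bal by (simp add: algebra_simps)
  have \<tau>: "summable (\<lambda>n. norm (\<tau> n))"
    unfolding \<tau>_def
    by (rule summable_norm_if_square_bounded) (rule convergentI[OF hyp_coeff_tendsto[OF lower(1-3) bal']])
  define w where "w = (\<lambda>n k. of_real ((real n - real k) / real n) ^ 2 * z (n - k) * \<phi> n k)"
  have "(\<lambda>n. \<Sum>k<n. \<tau> k * w n k) \<longlonglongrightarrow> suminf \<tau> * (1 ^ 2 * C * \<Phi>)"
  proof (rule weighted_sum_tendsto[OF _ _ \<tau>])
    fix k
    have "(\<lambda>n. (real n - real k) / real n) \<longlonglongrightarrow> 1"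
      using LIMSEQ_real_add_over[of "- real k"] by simp
    then have "(\<lambda>n. of_real ((real n - real k) / real n) :: complex) \<longlonglongrightarrow> of_real 1"
      by (rule tendsto_of_real)
    moreover have "(\<lambda>n. z (n - k)) \<longlonglongrightarrow> C"
      by (rule LIMSEQ_offset[where k = k]) (simp add: z)
    ultimately show "(\<lambda>n. w n k) \<longlonglongrightarrow> 1 ^ 2 * C * \<Phi>"
      unfolding w_def of_real_1 by (intro tendsto_mult tendsto_power \<phi>)
  next
    fix n k :: nat assume kn: "k < n"
    have "norm (w n k) = norm (z (n - k)) * (((real n - real k) / real n) ^ 2 * norm (\<phi> n k))"
      by (simp add: w_def norm_mult norm_power norm_divide power_divide flip: of_real_diff)
    also have "\<dots> \<le> M * B"
      using M bound[OF kn] order_trans[OF norm_ge_zero M]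
      by (intro mult_mono) auto
    finally show "norm (w n k) \<le> M * B" .
  qed
  moreover have "(\<Sum>k<n. \<tau> k * w n k) = (\<Sum>k<n. residue_coeff a b c d e f g n k * \<phi> n k) / of_nat n ^ 2" for n
    unfolding sum_divide_distrib
  proof (intro sum.cong refl)
    fix k assume "k \<in> {..<n}"
    then have "k < n" "(of_nat n - of_nat k :: complex) = of_nat (n - k)" by (auto simp: of_nat_diff)
    then show "\<tau> k * w n k = residue_coeff a b c d e f g n k * \<phi> n k / of_nat n ^ 2"
      by (simp add: w_def z_def residue_coeff_def \<tau>_def power_divide)
  qed
  moreover have "suminf \<tau> * (1 ^ 2 * C * \<Phi>) = residue_series a b c d e f g * \<Phi>"
    by (simp add: residue_series_def hyp4F3_eq_suminf \<tau>_def C_def)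
  ultimately show ?thesis by (simp only:)
qed

text \<open>With t = (n-k)/n the quotient (n+k)/(n-k) is at most 2/t, and t^2 ln(2/t) is at most 2t.
  Thus the damping factor absorbs the logarithm.\<close>

lemma real_quotient_bounds:
  assumes "k < (n::nat)"
  shows "0 \<le> (real n - real k) / real n" "(real n - real k) / real n \<le> 1"
    "((real n - real k) / real n) ^ 2 * ln (real (n + k) / real (n - k)) \<le> 2"
proof -
  define t where "t = (real n - real k) / real n"
  show t: "0 \<le> (real n - real k) / real n" "(real n - real k) / real n \<le> 1"
    using assms by auto
  have "t > 0" using assms by (simp add: t_def)
  have "real (n + k) / real (n - k) \<le> 2 * real n / real (n - k)"
    using assms by (intro divide_right_mono) auto
  also have "\<dots> = 2 / t"
    using assms by (simp add: t_def of_nat_diff)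
  finally have "ln (real (n + k) / real (n - k)) \<le> ln (2 / t)"
    using assms by (intro ln_mono) auto
  also have "\<dots> \<le> 2 / t - 1"
    using \<open>t > 0\<close> by (intro ln_le_minus_one) auto
  finally have "t ^ 2 * ln (real (n + k) / real (n - k)) \<le> t ^ 2 * (2 / t)"
    by (intro mult_left_mono) auto
  also have "\<dots> = 2 * t"
    using \<open>t > 0\<close> by (simp add: power2_eq_square)
  also have "\<dots> \<le> 2"
    using t unfolding t_def[symmetric] by simp
  finally show "((real n - real k) / real n) ^ 2 * ln (real (n + k) / real (n - k)) \<le> 2"
    by (simp add: t_def)
qed

lemma reciprocal_sum_bound:
  assumes "z \<notin> \<int>"
  shows "\<exists>B. \<forall>n k. k < n \<longrightarrow> ((real n - real k) / real n) ^ 2 * norm (reciprocal_sum z n k) \<le> B"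
proof -
  obtain C where C: "\<And>n k. k < n \<Longrightarrow> norm (reciprocal_sum z n k - of_real (ln (real (n + k) / real (n - k)))) \<le> C"
    using reciprocal_sum_tendsto(2)[OF assms] by blast
  have C0: "0 \<le> C" using order_trans[OF norm_ge_zero C[of 0 1]] by simp
  show ?thesis
  proof (intro exI allI impI)
    fix n k :: nat assume kn: "k < n"
    define t l where "t = (real n - real k) / real n" and "l = ln (real (n + k) / real (n - k))"
    have t: "0 \<le> t" "t \<le> 1" "t ^ 2 * l \<le> 2"
      using real_quotient_bounds[OF kn] by (auto simp: t_def l_def)
    have l: "0 \<le> l"
      using kn unfolding l_def by (intro ln_ge_zero) (simp add: of_nat_diff)
    have "norm (reciprocal_sum z n k) \<le> norm (reciprocal_sum z n k - of_real l) + norm (of_real l :: complex)"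
      by (metis diff_add_cancel norm_triangle_ineq)
    also have "\<dots> \<le> C + l"
      using C[OF kn] l by (simp add: l_def)
    finally have "t ^ 2 * norm (reciprocal_sum z n k) \<le> t ^ 2 * (C + l)"
      by (intro mult_left_mono) auto
    also have "\<dots> \<le> 1 * C + 2"
      unfolding distrib_left using t C0 by (intro add_mono mult_right_mono) (auto intro: power_le_one)
    finally show "((real n - real k) / real n) ^ 2 * norm (reciprocal_sum z n k) \<le> 1 * C + 2"
      by (simp add: t_def)
  qed
qed

text \<open>For balanced parameters the residues add up to 2n exactly, which disappears after
  division by n^2.\<close>

lemma sum_residue_series_eq_0:
  assumes nonint: "b - a \<notin> \<int>" "c - a \<notin> \<int>" "d - a \<notin> \<int>" "c - b \<notin> \<int>" "d - b \<notin> \<int>" "d - c \<notin> \<int>"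
    and bal: "e + f + g = 1 + a + b + c + d"
  shows "residue_series a b c d e f g + residue_series b a c d e f g
    + residue_series c a b d e f g + residue_series d a b c e f g = 0"
proof -
  have neg: "a - b \<notin> \<int>" "a - c \<notin> \<int>" "a - d \<notin> \<int>" "b - c \<notin> \<int>" "b - d \<notin> \<int>" "c - d \<notin> \<int>"
    using nonint by (metis minus_diff_eq minus_in_Ints_iff)+
  have one: "((real n - real k) / real n) ^ 2 * norm (1::complex) \<le> 1" if "k < n" for n k :: nat
    using real_quotient_bounds[OF that] by (simp add: power_le_one)
  have bal': "e + f + g = 1 + b + a + c + d" "e + f + g = 1 + c + a + b + d" "e + f + g = 1 + d + a + b + c"
    using bal by (simp_all add: add_ac)
  note lim = residue_coeff_sum_tendsto[where \<phi> = "\<lambda>n k. 1", OF _ _ _ _ tendsto_const one, unfolded mult_1_right]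
  have "(\<lambda>n. (\<Sum>k<n. residue_coeff a b c d e f g n k) / of_nat n ^ 2
      + (\<Sum>k<n. residue_coeff b a c d e f g n k) / of_nat n ^ 2
      + (\<Sum>k<n. residue_coeff c a b d e f g n k) / of_nat n ^ 2
      + (\<Sum>k<n. residue_coeff d a b c e f g n k) / of_nat n ^ 2)
    \<longlonglongrightarrow> residue_series a b c d e f g + residue_series b a c d e f g
      + residue_series c a b d e f g + residue_series d a b c e f g"
    by (intro tendsto_add lim[OF nonint(1-3) bal] lim[OF neg(1) nonint(4,5) bal'(1)]
        lim[OF neg(2,4) nonint(6) bal'(2)] lim[OF neg(3,5,6) bal'(3)])
  also have "(\<lambda>n. (\<Sum>k<n. residue_coeff a b c d e f g n k) / of_nat n ^ 2
      + (\<Sum>k<n. residue_coeff b a c d e f g n k) / of_nat n ^ 2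
      + (\<Sum>k<n. residue_coeff c a b d e f g n k) / of_nat n ^ 2
      + (\<Sum>k<n. residue_coeff d a b c e f g n k) / of_nat n ^ 2)
    = (\<lambda>n. of_nat n * (1 + e + f + g - a - b - c - d) / of_nat n ^ 2)"
    unfolding add_divide_distrib[symmetric] sum_residue_coeff[OF nonint] ..
  also have "\<dots> = (\<lambda>n. 2 * inverse (of_nat n))"
  proof
    fix n
    have two: "1 + e + f + g - a - b - c - d = 2" using bal by (simp add: algebra_simps)
    show "of_nat n * (1 + e + f + g - a - b - c - d) / of_nat n ^ 2 = 2 * inverse (of_nat n)"
      unfolding two by (cases "n = 0") (simp_all add: power2_eq_square divide_inverse)
  qed
  finally have lim1: "(\<lambda>n. 2 * inverse (of_nat n)) \<longlonglongrightarrow> residue_series a b c d e f g + residue_series b a c d e f g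
      + residue_series c a b d e f g + residue_series d a b c e f g" .
  have lim2: "(\<lambda>n. 2 * inverse (of_nat n) :: complex) \<longlonglongrightarrow> 2 * 0"
    by (intro tendsto_mult tendsto_const lim_inverse_n)
  show ?thesis
    using LIMSEQ_unique[OF lim1 lim2] by simp
qed

text \<open>The rational truncation is summed over the integers from -n to n-1, divided by n^2.
  Directly, the nonnegative integers produce the terms of the series on the left; through partial
  fractions, the integers are summed first and yield \<open>reciprocal_sum\<close>, whose limit is
  \<Delta>.\<close>

lemma hyp4F3_eq_sum_residue_series:
  assumes nonint: "b - a \<notin> \<int>" "c - a \<notin> \<int>" "d - a \<notin> \<int>" "c - b \<notin> \<int>" "d - b \<notin> \<int>" "d - c \<notin> \<int>"
    and abcd: "a \<notin> \<int>" "b \<notin> \<int>" "c \<notin> \<int>" "d \<notin> \<int>"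
    and efg: "e \<notin> \<int>\<^sub>\<le>\<^sub>0" "f \<notin> \<int>\<^sub>\<le>\<^sub>0" "g \<notin> \<int>\<^sub>\<le>\<^sub>0"
    and bal: "e + f + g = 1 + a + b + c + d"
  defines "\<Delta> \<equiv> \<lambda>x. Digamma (1 - x) - Digamma x"
  shows "hyp4F3 a b c d e f g * (Gamma a * Gamma b * Gamma c * Gamma d * (rGamma e * rGamma f * rGamma g))
    = residue_series a b c d e f g * \<Delta> a + residue_series b a c d e f g * \<Delta> b
    + residue_series c a b d e f g * \<Delta> c + residue_series d a b c e f g * \<Delta> d"
proof -
  have neg: "a - b \<notin> \<int>" "a - c \<notin> \<int>" "a - d \<notin> \<int>" "b - c \<notin> \<int>" "b - d \<notin> \<int>" "c - d \<notin> \<int>"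
    using nonint by (metis minus_diff_eq minus_in_Ints_iff)+
  have bal': "e + f + g = 1 + b + a + c + d" "e + f + g = 1 + c + a + b + d" "e + f + g = 1 + d + a + b + c"
    using bal by (simp_all add: add_ac)
  obtain Ba where Ba: "\<And>n k. k < n \<Longrightarrow> ((real n - real k) / real n) ^ 2 * norm (reciprocal_sum a n k) \<le> Ba"
    using reciprocal_sum_bound[OF abcd(1)] by blast
  obtain Bb where Bb: "\<And>n k. k < n \<Longrightarrow> ((real n - real k) / real n) ^ 2 * norm (reciprocal_sum b n k) \<le> Bb"
    using reciprocal_sum_bound[OF abcd(2)] by blast
  obtain Bc where Bc: "\<And>n k. k < n \<Longrightarrow> ((real n - real k) / real n) ^ 2 * norm (reciprocal_sum c n k) \<le> Bc"
    using reciprocal_sum_bound[OF abcd(3)] by blast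
  obtain Bd where Bd: "\<And>n k. k < n \<Longrightarrow> ((real n - real k) / real n) ^ 2 * norm (reciprocal_sum d n k) \<le> Bd"
    using reciprocal_sum_bound[OF abcd(4)] by blast
  note lim = residue_coeff_sum_tendsto[OF _ _ _ _ reciprocal_sum_tendsto(1)]
  have "(\<lambda>n. 2 * inverse (of_nat n)
      + ((\<Sum>k<n. residue_coeff a b c d e f g n k * reciprocal_sum a n k) / of_nat n ^ 2
      + (\<Sum>k<n. residue_coeff b a c d e f g n k * reciprocal_sum b n k) / of_nat n ^ 2
      + (\<Sum>k<n. residue_coeff c a b d e f g n k * reciprocal_sum c n k) / of_nat n ^ 2
      + (\<Sum>k<n. residue_coeff d a b c e f g n k * reciprocal_sum d n k) / of_nat n ^ 2))
    \<longlonglongrightarrow> 2 * 0 + (residue_series a b c d e f g * \<Delta> a + residue_series b a c d e f g * \<Delta> b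
      + residue_series c a b d e f g * \<Delta> c + residue_series d a b c e f g * \<Delta> d)"
    unfolding \<Delta>_def
    by (intro tendsto_add tendsto_mult[OF tendsto_const lim_inverse_n]
        lim[OF nonint(1-3) bal abcd(1) Ba] lim[OF neg(1) nonint(4,5) bal'(1) abcd(2) Bb]
        lim[OF neg(2,4) nonint(6) bal'(2) abcd(3) Bc] lim[OF neg(3,5,6) bal'(3) abcd(4) Bd])
  also have "(\<lambda>n. 2 * inverse (of_nat n)
      + ((\<Sum>k<n. residue_coeff a b c d e f g n k * reciprocal_sum a n k) / of_nat n ^ 2
      + (\<Sum>k<n. residue_coeff b a c d e f g n k * reciprocal_sum b n k) / of_nat n ^ 2
      + (\<Sum>k<n. residue_coeff c a b d e f g n k * reciprocal_sum c n k) / of_nat n ^ 2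
      + (\<Sum>k<n. residue_coeff d a b c e f g n k * reciprocal_sum d n k) / of_nat n ^ 2))
    = (\<lambda>n. \<Sum>k<n. hyp_coeff a b c d e f g k * (of_real ((real n + real k) / real n) ^ 2 *
        ((pochhammer 1 (n + k) * pochhammer e (n + k) * pochhammer f (n + k) * pochhammer g (n + k)) /
         (pochhammer a (n + k) * pochhammer b (n + k) * pochhammer c (n + k) * pochhammer d (n + k)) / of_nat (n + k) ^ 2)))"
    (is "?l = ?r")
  proof
    fix n :: nat
    define P where "P = (\<lambda>s. (pochhammer (1 + s) n * pochhammer (e + s) n * pochhammer (f + s) n * pochhammer (g + s) n) /
      (pochhammer (a + s) n * pochhammer (b + s) n * pochhammer (c + s) n * pochhammer (d + s) n))"
    have ne: "of_int j + x + of_nat k \<noteq> 0" if "x \<notin> \<int>" for j k and x :: complex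
    proof
      assume "of_int j + x + of_nat k = 0"
      then have "x = of_int (- j - int k)" by (simp add: algebra_simps eq_neg_iff_add_eq_0)
      then show False using that Ints_of_int by metis
    qed
    have P: "P (of_int j) = 1 + (\<Sum>k<n. residue_coeff a b c d e f g n k / (of_int j + a + of_nat k))
          + (\<Sum>k<n. residue_coeff b a c d e f g n k / (of_int j + b + of_nat k))
          + (\<Sum>k<n. residue_coeff c a b d e f g n k / (of_int j + c + of_nat k))
          + (\<Sum>k<n. residue_coeff d a b c e f g n k / (of_int j + d + of_nat k))" for j
      unfolding P_def
      by (rule pochhammer_quotient_partial_fractions[OF nonint]) (intro allI ne abcd)+
    have swap: "(\<Sum>j<n. \<Sum>k<n. R k / (of_nat j + x + of_nat k)) + (\<Sum>j<n. \<Sum>k<n. R k / (- 1 - of_nat j + x + of_nat k))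
      = (\<Sum>k<n. R k * reciprocal_sum x n k)" for R :: "nat \<Rightarrow> complex" and x
    proof -
      have "(\<Sum>j<n. \<Sum>k<n. R k / (of_nat j + x + of_nat k)) = (\<Sum>k<n. R k * (\<Sum>j<n. 1 / (of_nat j + x + of_nat k)))"
        by (subst sum.swap) (simp add: sum_distrib_left)
      moreover have "(\<Sum>j<n. \<Sum>k<n. R k / (- 1 - of_nat j + x + of_nat k)) = (\<Sum>k<n. R k * (\<Sum>j<n. 1 / (- 1 - of_nat j + x + of_nat k)))"
        by (subst sum.swap) (simp add: sum_distrib_left)
      ultimately show ?thesis
        by (simp add: reciprocal_sum_def distrib_left sum.distrib)
    qed
    \<comment> \<open>The summand 1 of the partial fraction expansion is counted at 2n
      integers.\<close>
    have "(\<Sum>j<n. P (of_nat j)) + (\<Sum>j<n. P (- 1 - of_nat j))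
      = 2 * of_nat n + ((\<Sum>k<n. residue_coeff a b c d e f g n k * reciprocal_sum a n k)
      + (\<Sum>k<n. residue_coeff b a c d e f g n k * reciprocal_sum b n k)
      + (\<Sum>k<n. residue_coeff c a b d e f g n k * reciprocal_sum c n k)
      + (\<Sum>k<n. residue_coeff d a b c e f g n k * reciprocal_sum d n k))"
      using P[of "int j" for j] P[of "- 1 - int j" for j]
      by (simp add: sum.distrib flip: swap)
    \<comment> \<open>The factor \<open>pochhammer (1 + s) n\<close> starts at -j and reaches 0
      within n steps.\<close>
    moreover have "P (- 1 - of_nat j) = 0" if "j < n" for j
      using that by (simp add: P_def pochhammer_of_nat_eq_0_lemma)
    ultimately have sumP: "(\<Sum>j<n. P (of_nat j))
      = 2 * of_nat n + ((\<Sum>k<n. residue_coeff a b c d e f g n k * reciprocal_sum a n k)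
      + (\<Sum>k<n. residue_coeff b a c d e f g n k * reciprocal_sum b n k)
      + (\<Sum>k<n. residue_coeff c a b d e f g n k * reciprocal_sum c n k)
      + (\<Sum>k<n. residue_coeff d a b c e f g n k * reciprocal_sum d n k))"
      by simp
    have "?l n = (\<Sum>j<n. P (of_nat j)) / of_nat n ^ 2"
      unfolding sumP add_divide_distrib by (cases "n = 0") (simp_all add: power2_eq_square divide_inverse)
    also have "\<dots> = ?r n"
      unfolding sum_divide_distrib
    proof (intro sum.cong refl)
      fix k assume "k \<in> {..<n}"
      then have "n > 0" by auto
      then have nz: "of_nat n \<noteq> (0::complex)" "of_nat (n + k) \<noteq> (0::complex)" by (simp_all only: of_nat_eq_0_iff)
      \<comment> \<open>Splitting each symbol at k separates the k-th series term from a quotient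
        that depends on n + k only.\<close>
      have sh: "pochhammer (x + of_nat k) n = pochhammer x (n + k) / pochhammer x k" if "x \<notin> \<int>\<^sub>\<le>\<^sub>0" for x :: complex
        using pochhammer_product'[of x k n] pochhammer_neq_0[OF that, of k] by (simp add: add.commute field_simps)
      have nn: "a \<notin> \<int>\<^sub>\<le>\<^sub>0" "b \<notin> \<int>\<^sub>\<le>\<^sub>0" "c \<notin> \<int>\<^sub>\<le>\<^sub>0" "d \<notin> \<int>\<^sub>\<le>\<^sub>0" using abcd by auto
      have "P (of_nat k) = hyp_coeff a b c d e f g k *
        ((pochhammer 1 (n + k) * pochhammer e (n + k) * pochhammer f (n + k) * pochhammer g (n + k)) /
         (pochhammer a (n + k) * pochhammer b (n + k) * pochhammer c (n + k) * pochhammer d (n + k)))"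
        unfolding P_def sh[OF one_notin_nonpos_Ints] sh[OF efg(1)] sh[OF efg(2)] sh[OF efg(3)]
          sh[OF nn(1)] sh[OF nn(2)] sh[OF nn(3)] sh[OF nn(4)]
        by (simp add: hyp_coeff_def pochhammer_fact)
      moreover have "of_real ((real n + real k) / real n) ^ 2 = (of_nat (n + k) ^ 2 / of_nat n ^ 2 :: complex)"
        by (simp add: power_divide)
      moreover have "h * (v / u * (q / v)) = h * q / u" if "v \<noteq> 0" for h q u v :: complex
        using that by simp
      moreover have "of_nat (n + k) ^ 2 \<noteq> (0::complex)"
        using nz by (simp only: power_not_zero not_False_eq_True)
      ultimately show "P (of_nat k) / of_nat n ^ 2 = hyp_coeff a b c d e f g k * (of_real ((real n + real k) / real n) ^ 2 *
        ((pochhammer 1 (n + k) * pochhammer e (n + k) * pochhammer f (n + k) * pochhammer g (n + k)) /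
         (pochhammer a (n + k) * pochhammer b (n + k) * pochhammer c (n + k) * pochhammer d (n + k)) / of_nat (n + k) ^ 2))"
        by (simp only: not_False_eq_True)
    qed
    finally show "?l n = ?r n" .
  qed
  finally have lim1: "?r \<longlonglongrightarrow> 2 * 0 + (residue_series a b c d e f g * \<Delta> a + residue_series b a c d e f g * \<Delta> b
      + residue_series c a b d e f g * \<Delta> c + residue_series d a b c e f g * \<Delta> d)" .
  have lim2: "?r \<longlonglongrightarrow> suminf (hyp_coeff a b c d e f g) * (1 ^ 2 * (Gamma a * Gamma b * Gamma c * Gamma d * (rGamma e * rGamma f * rGamma g)))"
  proof -
    \<comment> \<open>Normalized by m^2 at m = n + k, not by n^2. The ratio ((n+k)/n)^2 appears as a
      weight, which tends to 1 and is at most 4 for k < n.\<close>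
    define y where "y = (\<lambda>m. (pochhammer 1 m * pochhammer e m * pochhammer f m * pochhammer g m) /
         (pochhammer a m * pochhammer b m * pochhammer c m * pochhammer d m) / of_nat m ^ 2)"
    have nn: "a \<notin> \<int>\<^sub>\<le>\<^sub>0" "b \<notin> \<int>\<^sub>\<le>\<^sub>0" "c \<notin> \<int>\<^sub>\<le>\<^sub>0" "d \<notin> \<int>\<^sub>\<le>\<^sub>0" using abcd by auto
    have "a + b + c + d = 1 + e + f + g + of_int (-2)"
      using bal by (simp add: algebra_simps)
    from pochhammer_ratio_tendsto[OF nn this]
    have y: "y \<longlonglongrightarrow> Gamma a * Gamma b * Gamma c * Gamma d * (rGamma e * rGamma f * rGamma g)"
      by (simp add: y_def power_int_minus divide_inverse mult_ac)
    then obtain M where M: "\<And>m. norm (y m) \<le> M"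
      using convergent_imp_Bseq[of y] by (auto simp: Bseq_def convergent_def)
    have "(\<lambda>n. \<Sum>k<n. hyp_coeff a b c d e f g k * (of_real ((real n + real k) / real n) ^ 2 * y (n + k)))
      \<longlonglongrightarrow> suminf (hyp_coeff a b c d e f g) * (1 ^ 2 * (Gamma a * Gamma b * Gamma c * Gamma d * (rGamma e * rGamma f * rGamma g)))"
    proof (rule weighted_sum_tendsto)
      fix k
      have "(\<lambda>n. (real n + real k) / real n) \<longlonglongrightarrow> 1"
        by (rule LIMSEQ_real_add_over)
      then have "(\<lambda>n. of_real ((real n + real k) / real n) :: complex) \<longlonglongrightarrow> of_real 1"
        by (rule tendsto_of_real)
      moreover have "(\<lambda>n. y (n + k)) \<longlonglongrightarrow> Gamma a * Gamma b * Gamma c * Gamma d * (rGamma e * rGamma f * rGamma g)"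
        by (rule LIMSEQ_ignore_initial_segment) (rule y)
      ultimately show "(\<lambda>n. of_real ((real n + real k) / real n) ^ 2 * y (n + k))
        \<longlonglongrightarrow> 1 ^ 2 * (Gamma a * Gamma b * Gamma c * Gamma d * (rGamma e * rGamma f * rGamma g))"
        unfolding of_real_1 by (intro tendsto_mult tendsto_power)
    next
      fix n k :: nat assume "k < n"
      then have "((real n + real k) / real n) ^ 2 \<le> 2 ^ 2"
        by (intro power_mono) (auto simp: field_simps)
      moreover have "norm (of_real ((real n + real k) / real n) ^ 2 * y (n + k)) = ((real n + real k) / real n) ^ 2 * norm (y (n + k))"
        by (simp add: norm_mult norm_power norm_divide power_divide flip: of_nat_add)
      ultimately show "norm (of_real ((real n + real k) / real n) ^ 2 * y (n + k)) \<le> 2 ^ 2 * M"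
        using M[of "n + k"] by (simp add: mult_mono)
    next
      show "summable (\<lambda>n. norm (hyp_coeff a b c d e f g n))"
        using hyp_coeff_tendsto[OF efg bal] by (intro summable_norm_if_square_bounded) (auto simp: convergent_def)
    qed
    then show ?thesis by (simp only: y_def)
  qed
  show ?thesis
    using LIMSEQ_unique[OF lim1 lim2] by (simp add: hyp4F3_eq_suminf)
qed

section \<open>Trigonometric identities\<close>

text \<open>In these exponentials sines and cosines of sums become Laurent polynomials, so the
  identities below reduce to rational identities in nonzero variables.\<close>

definition epi :: "complex \<Rightarrow> complex" where
  "epi z = exp (\<i> * of_real pi * z)"

definition cospi :: "complex \<Rightarrow> complex" where
  "cospi z = cos (of_real pi * z)"

lemma epi_nonzero [simp]: "epi z \<noteq> 0"
  by (simp add: epi_def)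

lemma epi_add: "epi (x + y) = epi x * epi y"
  by (simp add: epi_def distrib_left exp_add)

lemma epi_diff: "epi (x - y) = epi x / epi y"
  by (simp add: epi_def right_diff_distrib exp_diff)

lemma epi_numeral: "epi (numeral n * x) = epi x ^ numeral n"
proof -
  have "\<i> * of_real pi * (numeral n * x) = of_nat (numeral n) * (\<i> * of_real pi * x)"
    by simp
  then show ?thesis
    unfolding epi_def by (simp only: exp_of_nat_mult)
qed

lemma sinpi_epi: "sinpi z = - \<i> / 2 * (epi z - 1 / epi z)"
proof -
  have "sinpi z = (epi z - 1 / epi z) / (2 * \<i>)"
    unfolding sinpi_def sin_exp_eq epi_def exp_minus inverse_eq_divide mult.assoc minus_mult_left[symmetric] ..
  also have "x / (2 * \<i>) = - \<i> / 2 * x" for x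
    by (simp add: field_simps)
  finally show ?thesis .
qed

lemma cospi_epi: "cospi z = (epi z + 1 / epi z) / 2"
  unfolding cospi_def cos_exp_eq epi_def exp_minus inverse_eq_divide mult.assoc minus_mult_left[symmetric] ..

lemma sinpi_diff_epi: "sinpi (x - y) = - \<i> / 2 * (epi x / epi y - epi y / epi x)"
  by (simp add: sinpi_epi epi_diff)

text \<open>Three sines of shifted z lie in the two-dimensional space spanned by sin(pi z) and
  cos(pi z); this is their linear relation.\<close>

lemma trig_three_point:
  "sinpi (d - c) * sinpi (z - b) - sinpi (d - b) * sinpi (z - c) + sinpi (c - b) * sinpi (z - d) = 0"
proof -
  have "(D / C - C / D) * (Z / B - B / Z) - (D / B - B / D) * (Z / C - C / Z) + (C / B - B / C) * (Z / D - D / Z) = 0"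
    if "B \<noteq> 0" "C \<noteq> 0" "D \<noteq> 0" "Z \<noteq> 0" for B C D Z :: complex
    using that by (simp add: field_simps)
  from this[of "epi b" "epi c" "epi d" "epi z"] 
  have "(- \<i> / 2) * (- \<i> / 2) * ((epi d / epi c - epi c / epi d) * (epi z / epi b - epi b / epi z)
    - (epi d / epi b - epi b / epi d) * (epi z / epi c - epi c / epi z)
    + (epi c / epi b - epi b / epi c) * (epi z / epi d - epi d / epi z)) = 0"
    by simp
  then show ?thesis
    unfolding sinpi_diff_epi by algebra
qed

text \<open>The left side alternates in b, c, d, which explains the product of the three sine
  differences on the right. The arguments a + b + c + d - 3x come from the triple product
  \<open>Q\<close> in \<open>trig_quadratic\<close>.\<close>

lemma trig_four_point:
  "sinpi (d - c) * sinpi (a + b + c + d - 3 * b) - sinpi (d - b) * sinpi (a + b + c + d - 3 * c)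
    + sinpi (c - b) * sinpi (a + b + c + d - 3 * d)
    = - 4 * sinpi a * sinpi (d - c) * sinpi (d - b) * sinpi (c - b)"
proof -
  have *: "(D / C - C / D) * (A * B * C * D / B ^ 3 - B ^ 3 / (A * B * C * D))
     - (D / B - B / D) * (A * B * C * D / C ^ 3 - C ^ 3 / (A * B * C * D))
     + (C / B - B / C) * (A * B * C * D / D ^ 3 - D ^ 3 / (A * B * C * D))
    = (A - 1 / A) * (D / C - C / D) * (D / B - B / D) * (C / B - B / C)"
    if "A \<noteq> 0" "B \<noteq> 0" "C \<noteq> 0" "D \<noteq> 0" for A B C D :: complex
    using that by (simp add: divide_simps) algebra
  have t: "4 * (- \<i> / 2) * (- \<i> / 2) = -1"
    by (simp add: field_simps)
  \<comment> \<open>Here t is -\<i>/2. The relation \<open>4 * t * t = -1\<close> accounts for the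
    two additional sine factors on the right.\<close>
  have **: "t * p1 * (t * q1) - t * p2 * (t * q2) + t * p3 * (t * q3) = - 4 * (t * x) * (t * p1) * (t * p2) * (t * p3)"
    if "4 * t * t = -1" "p1 * q1 - p2 * q2 + p3 * q3 = x * p1 * p2 * p3" for t x p1 p2 p3 q1 q2 q3 :: complex
    using that by algebra
  show ?thesis
    unfolding sinpi_diff_epi sinpi_epi[of a] epi_add epi_numeral
    by (rule **[OF t *]) simp_all
qed

lemma sinpi_mult3:
  "4 * (sinpi x * sinpi y * sinpi z)
    = sinpi (x + y - z) + sinpi (x - y + z) + sinpi (y + z - x) - sinpi (x + y + z)"
proof -
  have *: "(X * Y / Z - Z / (X * Y)) + (X / Y * Z - 1 / (X / Y * Z)) + (Y * Z / X - X / (Y * Z)) - (X * Y * Z - 1 / (X * Y * Z))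
    = - (X - 1 / X) * (Y - 1 / Y) * (Z - 1 / Z)"
    if "X \<noteq> 0" "Y \<noteq> 0" "Z \<noteq> 0" for X Y Z :: complex
    using that by (simp add: divide_simps) algebra
  have t: "4 * (- \<i> / 2) * (- \<i> / 2) = -1"
    by (simp add: field_simps)
  have **: "4 * (t * x * (t * y) * (t * z)) = t * p + t * q + t * r - t * s"
    if "4 * t * t = -1" "p + q + r - s = - x * y * z" for t x y z p q r s :: complex
    using that by algebra
  show ?thesis
    unfolding sinpi_diff_epi sinpi_epi[of x] sinpi_epi[of y] sinpi_epi[of z] sinpi_epi[of "x - y + z"]
      sinpi_epi[of "x + y + z"] epi_add epi_diff
    by (rule **[OF t *]) simp_all
qed

text \<open>The triple products of sines are 3x3 minors for the functions X^-2, 1, X^2 of X =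
  exp(\<i> pi x). In the first two claims the weights lie in the span of these functions, so a 4x4
  determinant with dependent rows is expanded. In the third they do not: each of the two
  exponentials of the cosine gives a full Vandermonde determinant of the squares, and the two have
  opposite signs.\<close>

lemma vandermonde_four_point:
  shows "- cospi (w - 2 * a) * (sinpi (d - c) * sinpi (d - b) * sinpi (c - b))
    + cospi (w - 2 * b) * (sinpi (d - c) * sinpi (c - a) * sinpi (d - a))
    - cospi (w - 2 * c) * (sinpi (d - b) * sinpi (b - a) * sinpi (d - a))
    + cospi (w - 2 * d) * (sinpi (c - b) * sinpi (b - a) * sinpi (c - a)) = 0" (is ?A)
  and "- (sinpi (d - c) * sinpi (d - b) * sinpi (c - b))
    + (sinpi (d - c) * sinpi (c - a) * sinpi (d - a))
    - (sinpi (d - b) * sinpi (b - a) * sinpi (d - a))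
    + (sinpi (c - b) * sinpi (b - a) * sinpi (c - a)) = 0" (is ?B)
  and "- cospi (a + b + c + d - 4 * a) * (sinpi (d - c) * sinpi (d - b) * sinpi (c - b))
    + cospi (a + b + c + d - 4 * b) * (sinpi (d - c) * sinpi (c - a) * sinpi (d - a))
    - cospi (a + b + c + d - 4 * c) * (sinpi (d - b) * sinpi (b - a) * sinpi (d - a))
    + cospi (a + b + c + d - 4 * d) * (sinpi (c - b) * sinpi (b - a) * sinpi (c - a)) = 0" (is ?C)
proof -
  define s where "s = (\<lambda>X Y. X / Y - Y / X :: complex)"
  have **: "- (h1 / 2) * (t * p1 * (t * p2) * (t * p3)) + (h2 / 2) * (t * p4 * (t * p5) * (t * p6))
     - (h3 / 2) * (t * p7 * (t * p8) * (t * p9)) + (h4 / 2) * (t * q1 * (t * q2) * (t * q3)) = 0"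
    if "- h1 * (p1 * p2 * p3) + h2 * (p4 * p5 * p6) - h3 * (p7 * p8 * p9) + h4 * (q1 * q2 * q3) = 0"
    for t h1 h2 h3 h4 p1 p2 p3 p4 p5 p6 p7 p8 p9 q1 q2 q3 :: complex
  proof -
    have "- (h1 / 2) * (t * p1 * (t * p2) * (t * p3)) + (h2 / 2) * (t * p4 * (t * p5) * (t * p6))
     - (h3 / 2) * (t * p7 * (t * p8) * (t * p9)) + (h4 / 2) * (t * q1 * (t * q2) * (t * q3))
     = t ^ 3 / 2 * (- h1 * (p1 * p2 * p3) + h2 * (p4 * p5 * p6) - h3 * (p7 * p8 * p9) + h4 * (q1 * q2 * q3))"
      by algebra
    then show ?thesis by (simp only: that mult_zero_right)
  qed
  have A: "- (W / A ^ 2 + 1 / (W / A ^ 2)) * (s D C * s D B * s C B) + (W / B ^ 2 + 1 / (W / B ^ 2)) * (s D C * s C A * s D A)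
     - (W / C ^ 2 + 1 / (W / C ^ 2)) * (s D B * s B A * s D A) + (W / D ^ 2 + 1 / (W / D ^ 2)) * (s C B * s B A * s C A) = 0"
    if "A \<noteq> 0" "B \<noteq> 0" "C \<noteq> 0" "D \<noteq> 0" "W \<noteq> 0" for A B C D W
    using that unfolding s_def by (simp add: divide_simps) algebra
  have B: "- (s D C * s D B * s C B) + (s D C * s C A * s D A) - (s D B * s B A * s D A) + (s C B * s B A * s C A) = 0"
    if "A \<noteq> 0" "B \<noteq> 0" "C \<noteq> 0" "D \<noteq> 0" for A B C D
    using that unfolding s_def by (simp add: divide_simps) algebra
  have C: "- (A * B * C * D / A ^ 4 + 1 / (A * B * C * D / A ^ 4)) * (s D C * s D B * s C B)
     + (A * B * C * D / B ^ 4 + 1 / (A * B * C * D / B ^ 4)) * (s D C * s C A * s D A)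
     - (A * B * C * D / C ^ 4 + 1 / (A * B * C * D / C ^ 4)) * (s D B * s B A * s D A)
     + (A * B * C * D / D ^ 4 + 1 / (A * B * C * D / D ^ 4)) * (s C B * s B A * s C A) = 0"
    if "A \<noteq> 0" "B \<noteq> 0" "C \<noteq> 0" "D \<noteq> 0" for A B C D
  proof -
    define P where "P = A * B * C * D"
    \<comment> \<open>After clearing denominators, the two summands belong to the expansions of the
      Vandermonde determinant along the powers 0 and 3 of the squares.\<close>
    have key: "(P / X ^ 4 + 1 / (P / X ^ 4)) * (s U Z * s U Y * s Z Y)
      = 1 / P ^ 3 * ((Y\<^sup>2 * Z\<^sup>2 * U\<^sup>2 + X ^ 6) * ((U\<^sup>2 - Z\<^sup>2) * (U\<^sup>2 - Y\<^sup>2) * (Z\<^sup>2 - Y\<^sup>2)))"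
      if "X \<noteq> 0" "Y \<noteq> 0" "Z \<noteq> 0" "U \<noteq> 0" "P = X * Y * Z * U" for X Y Z U
      using that(1-4) unfolding s_def that(5) by (simp add: divide_simps) algebra
    have "P = B * A * C * D" "P = C * A * B * D" "P = D * A * B * C"
      by (simp_all add: P_def)
    note k = key[OF that P_def] key[OF that(2,1,3,4) this(1)] key[OF that(3,1,2,4) this(2)] key[OF that(4,1,2,3) this(3)]
    have "- ((P / A ^ 4 + 1 / (P / A ^ 4)) * (s D C * s D B * s C B))
      + (P / B ^ 4 + 1 / (P / B ^ 4)) * (s D C * s D A * s C A)
      - (P / C ^ 4 + 1 / (P / C ^ 4)) * (s D B * s D A * s B A)
      + (P / D ^ 4 + 1 / (P / D ^ 4)) * (s C B * s C A * s B A) = 0"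
      unfolding k by algebra
    then show ?thesis
      unfolding P_def[symmetric] minus_mult_left[symmetric] by (simp add: mult_ac)
  qed
  have sd: "sinpi (x - y) = - \<i> / 2 * s (epi x) (epi y)" for x y
    by (simp add: s_def sinpi_diff_epi)
  show ?A
    unfolding sd cospi_epi epi_diff epi_numeral by (rule **[OF A]) simp_all
  show ?C
    unfolding sd cospi_epi epi_diff epi_add epi_numeral by (rule **[OF C]) simp_all
  have "(- \<i> / 2) ^ 3 * (- (s (epi d) (epi c) * s (epi d) (epi b) * s (epi c) (epi b)) + (s (epi d) (epi c) * s (epi c) (epi a) * s (epi d) (epi a))
     - (s (epi d) (epi b) * s (epi b) (epi a) * s (epi d) (epi a)) + (s (epi c) (epi b) * s (epi b) (epi a) * s (epi c) (epi a))) = 0"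
    by (subst B) simp_all
  then show ?B
    unfolding sd power3_eq_cube by algebra
qed


lemma sinpi_plus_1: "sinpi (1 + z) = - sinpi z"
  by (simp add: sinpi_def distrib_left sin_add)

lemma sinpi_minus: "sinpi (- z) = - sinpi z"
  by (simp add: sinpi_def)

lemma sinpi_swap: "sinpi (x - y) = - sinpi (y - x)"
  using sinpi_minus[of "y - x"] by simp

lemma sinpi_times_sinpi: "2 * (sinpi x * sinpi y) = cospi (x - y) - cospi (x + y)"
  by (simp add: sinpi_def cospi_def sin_times_sin right_diff_distrib distrib_left)

text \<open>The terms containing \<open>Q a\<close> form a three-node sum, which \<open>D\<close>
  evaluates as -sin(pi a) times a product of sine differences. This supplies precisely the node a
  missing from the remaining terms, and the complete four-node relation is \<open>V\<close>.\<close>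

lemma trig_quadratic:
  fixes a b c d e f g :: complex
  assumes bal: "e + f + g = 1 + a + b + c + d"
  defines "Q \<equiv> \<lambda>x. sinpi (e - x) * sinpi (f - x) * sinpi (g - x)"
  shows "sinpi (d - c) * Q b * (Q a + sinpi b * sinpi (c - a) * sinpi (d - a))
    - Q c * sinpi (d - b) * (Q a + sinpi (b - a) * sinpi (d - a) * sinpi c)
    + Q d * sinpi (c - b) * (Q a + sinpi (b - a) * sinpi (c - a) * sinpi d) = 0"
proof -
  define s where "s = a + b + c + d"
  \<comment> \<open>The balance condition turns the sine of e + f + g - 3x into one of s - 3x. The
    other three sines have the form required by \<open>trig_three_point\<close>.\<close>
  have Q: "4 * Q x = sinpi (e + f - g - x) + sinpi (e - f + g - x) + sinpi (f + g - e - x) + sinpi (s - 3 * x)" for x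
  proof -
    have "e - x + (f - x) + (g - x) = 1 + (s - 3 * x)"
      using bal by (simp add: s_def algebra_simps)
    then have "sinpi (e - x + (f - x) + (g - x)) = - sinpi (s - 3 * x)"
      by (simp only: sinpi_plus_1)
    moreover have "e - x + (f - x) - (g - x) = e + f - g - x" "e - x - (f - x) + (g - x) = e - f + g - x"
      "f - x + (g - x) - (e - x) = f + g - e - x"
      by (simp_all add: algebra_simps)
    ultimately show ?thesis
      using sinpi_mult3[of "e - x" "f - x" "g - x"] by (simp only: Q_def diff_minus_eq_add)
  qed
  have "4 * (sinpi (d - c) * Q b - sinpi (d - b) * Q c + sinpi (c - b) * Q d)
    = sinpi (d - c) * (4 * Q b) - sinpi (d - b) * (4 * Q c) + sinpi (c - b) * (4 * Q d)"
    by (simp add: algebra_simps)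
  also have "\<dots> = - 4 * sinpi a * sinpi (d - c) * sinpi (d - b) * sinpi (c - b)"
    unfolding Q using trig_three_point[of d c "e + f - g" b] trig_three_point[of d c "e - f + g" b]
      trig_three_point[of d c "f + g - e" b] trig_four_point[of d c a b, folded s_def] by algebra
  finally have D: "sinpi (d - c) * Q b - sinpi (d - b) * Q c + sinpi (c - b) * Q d
    = - (sinpi a * sinpi (d - c) * sinpi (d - b) * sinpi (c - b))"
    by algebra
  \<comment> \<open>As functions of x, the summands are cosines of w - 2x, the cosine of s - 4x, and
    constants: exactly the weights covered by \<open>vandermonde_four_point\<close>.\<close>
  have Qs: "8 * (Q x * sinpi x) = cospi (e + f - g - 2 * x) + cospi (e - f + g - 2 * x) + cospi (f + g - e - 2 * x)
      + cospi (s - 4 * x) - cospi (s - 2 * x) - (cospi (e + f - g) + cospi (e - f + g) + cospi (f + g - e))" for x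
  proof -
    have "8 * (Q x * sinpi x) = 2 * (4 * Q x * sinpi x)" by simp
    also have "\<dots> = 2 * (sinpi (e + f - g - x) * sinpi x) + 2 * (sinpi (e - f + g - x) * sinpi x)
      + 2 * (sinpi (f + g - e - x) * sinpi x) + 2 * (sinpi (s - 3 * x) * sinpi x)"
      unfolding Q by (simp add: algebra_simps)
    finally show ?thesis
      unfolding sinpi_times_sinpi by (simp add: algebra_simps)
  qed
  have "8 * (- (Q a * sinpi a) * (sinpi (d - c) * sinpi (d - b) * sinpi (c - b))
    + Q b * sinpi b * (sinpi (d - c) * sinpi (c - a) * sinpi (d - a))
    - Q c * sinpi c * (sinpi (d - b) * sinpi (b - a) * sinpi (d - a))
    + Q d * sinpi d * (sinpi (c - b) * sinpi (b - a) * sinpi (c - a)))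
    = - (8 * (Q a * sinpi a)) * (sinpi (d - c) * sinpi (d - b) * sinpi (c - b))
    + 8 * (Q b * sinpi b) * (sinpi (d - c) * sinpi (c - a) * sinpi (d - a))
    - 8 * (Q c * sinpi c) * (sinpi (d - b) * sinpi (b - a) * sinpi (d - a))
    + 8 * (Q d * sinpi d) * (sinpi (c - b) * sinpi (b - a) * sinpi (c - a))"
    by (simp add: algebra_simps)
  also have "\<dots> = 0"
    unfolding Qs
    using vandermonde_four_point(1)[of "e + f - g" a d c b] vandermonde_four_point(1)[of "e - f + g" a d c b]
      vandermonde_four_point(1)[of "f + g - e" a d c b] vandermonde_four_point(1)[of s a d c b]
      vandermonde_four_point(2)[of d c b a] vandermonde_four_point(3)[of a b c d, folded s_def]
    by algebra
  finally have V: "- (Q a * sinpi a) * (sinpi (d - c) * sinpi (d - b) * sinpi (c - b))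
    + Q b * sinpi b * (sinpi (d - c) * sinpi (c - a) * sinpi (d - a))
    - Q c * sinpi c * (sinpi (d - b) * sinpi (b - a) * sinpi (d - a))
    + Q d * sinpi d * (sinpi (c - b) * sinpi (b - a) * sinpi (c - a)) = 0"
    by algebra
  show ?thesis using D V by algebra
qed

section \<open>The relation at generic parameters\<close>

lemma hyp4F3_swap: "hyp4F3 a b c d f e g = hyp4F3 a b c d e f g" "hyp4F3 a b c d e g f = hyp4F3 a b c d e f g"
  by (simp_all add: hyp4F3_def mult_ac)

lemma L_swap: "L a b c d e g f = L a b c d e f g"
  by (simp add: L_def hyp4F3_swap mult_ac)

lemma residue_series_swap: "residue_series a c b d e f g = residue_series a b c d e f g"
  "residue_series a b d c e f g = residue_series a b c d e f g"
  by (simp_all add: residue_series_def hyp4F3_swap mult_ac)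

section \<open>From \<open>A\<close>, \<open>K\<close> and \<open>L\<close> to residue
  series\<close>

lemma rGamma_reflection: "rGamma z * rGamma (1 - z) = sinpi z / of_real pi"
  unfolding sinpi_def by (rule rGamma_reflection_complex)

lemma rGamma_reflection': "rGamma (x - y) * rGamma (1 + y - x) = sinpi (x - y) / of_real pi"
  using rGamma_reflection[of "x - y"] by (simp add: algebra_simps)

lemma Gamma_times_rGamma:
  fixes z :: complex
  assumes "z \<notin> \<int>"
  shows "Gamma z * rGamma z = 1"
proof -
  have "z \<notin> \<int>\<^sub>\<le>\<^sub>0" using assms by auto
  then show ?thesis by (simp add: rGamma_inverse_Gamma Gamma_eq_zero_iff)
qed

lemma A_reflection:
  "A (1 - x) (e - x) (f - x) (g - x) * A x (1 + x - e) (1 + x - f) (1 + x - g)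
    = sinpi x * (sinpi (e - x) * sinpi (f - x) * sinpi (g - x)) / of_real pi ^ 4"
proof -
  have "A (1 - x) (e - x) (f - x) (g - x) * A x (1 + x - e) (1 + x - f) (1 + x - g)
    = (rGamma x * rGamma (1 - x)) * (rGamma (e - x) * rGamma (1 + x - e))
      * (rGamma (f - x) * rGamma (1 + x - f)) * (rGamma (g - x) * rGamma (1 + x - g))"
    by (simp add: A_def mult_ac)
  then show ?thesis
    unfolding rGamma_reflection rGamma_reflection' by (simp add: power4_eq_xxxx)
qed

text \<open>Reflection replaces each \<open>rGamma (1 + a - x)\<close> by
  \<open>Gamma (x - a)\<close> at the cost of a sine.\<close>

lemma A_times_hyp4F3:
  assumes "b - a \<notin> \<int>" "c - a \<notin> \<int>" "d - a \<notin> \<int>"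
  shows "A (1 - a) (e - a) (f - a) (g - a)
      * (hyp4F3 a (1 + a - e) (1 + a - f) (1 + a - g) (1 + a - b) (1 + a - c) (1 + a - d)
        * (rGamma (1 + a - b) * rGamma (1 + a - c) * rGamma (1 + a - d)))
    = residue_series a b c d e f g * (sinpi (b - a) * sinpi (c - a) * sinpi (d - a)) / of_real pi ^ 3"
proof -
  have r: "rGamma (1 + a - x) = Gamma (x - a) * (sinpi (x - a) / of_real pi)" if "x - a \<notin> \<int>" for x
    by (simp only: rGamma_reflection'[symmetric] mult.assoc[symmetric] Gamma_times_rGamma[OF that] mult_1_left)
  show ?thesis
    unfolding r[OF assms(1)] r[OF assms(2)] r[OF assms(3)]
    by (simp add: residue_series_def A_def power3_eq_cube)
qed

text \<open>\<open>L_dual\<close> with 1 + c - a as its middle lower parameter turns the upper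
  parameter 1 - a into c. The result contains exactly the series belonging to c and b. The factor
  \<open>Ab'\<close> is pulled out because it also accompanies \<open>K_p0\<close> in the
  theorem.\<close>

lemma A_times_L_bar:
  assumes nonint: "b - a \<notin> \<int>" "c - a \<notin> \<int>" "d - a \<notin> \<int>" "c - b \<notin> \<int>" "d - b \<notin> \<int>" "d - c \<notin> \<int>"
    and b: "b \<notin> \<int>" "e - b \<notin> \<int>" "f - b \<notin> \<int>" "g - b \<notin> \<int>"
    and bal: "e + f + g = 1 + a + b + c + d"
  defines "Q \<equiv> \<lambda>x. sinpi (e - x) * sinpi (f - x) * sinpi (g - x)"
  shows "A (1 - c) (e - c) (f - c) (g - c)
      * L (1 - a) (e - a) (f - a) (g - a) (1 + d - a) (1 + c - a) (1 + b - a)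
    = A b (1 + b - e) (1 + b - f) (1 + b - g) / of_real pi ^ 3
      * (residue_series c a b d e f g * (sinpi (a - c) * sinpi (d - c))
        + sinpi c * Q c / (sinpi b * Q b) * residue_series b a c d e f g * (sinpi (a - b) * sinpi (d - b)))"
proof -
  have neg: "a - b \<notin> \<int>" "a - c \<notin> \<int>" "a - d \<notin> \<int>" "b - c \<notin> \<int>" "b - d \<notin> \<int>" "c - d \<notin> \<int>"
    using nonint by (metis minus_diff_eq minus_in_Ints_iff)+
  define Ab' where "Ab' = A b (1 + b - e) (1 + b - f) (1 + b - g)"
  define Ab where "Ab = A (1 - b) (e - b) (f - b) (g - b)"
  define Ac' where "Ac' = A c (1 + c - e) (1 + c - f) (1 + c - g)"
  define Ac where "Ac = A (1 - c) (e - c) (f - c) (g - c)"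
  define X where "X = hyp4F3 c (1 + c - e) (1 + c - f) (1 + c - g) (1 + c - a) (1 + c - b) (1 + c - d)
    * (rGamma (1 + c - a) * rGamma (1 + c - b) * rGamma (1 + c - d))"
  define Y where "Y = hyp4F3 b (1 + b - e) (1 + b - f) (1 + b - g) (1 + b - a) (1 + b - c) (1 + b - d)
    * (rGamma (1 + b - a) * rGamma (1 + b - c) * rGamma (1 + b - d))"
  have "L (1 - a) (e - a) (f - a) (g - a) (1 + d - a) (1 + c - a) (1 + b - a)
    = L (1 + c - a - (1 - a)) (1 + c - a - (e - a)) (1 + c - a - (f - a)) (1 + c - a - (g - a))
        (1 + (1 + c - a) - (1 + b - a)) (1 + c - a) (1 + (1 + c - a) - (1 + d - a))"
  proof (rule L_dual)
    show "1 + d - a + (1 + c - a) + (1 + b - a) = 1 + (1 - a) + (e - a) + (f - a) + (g - a)"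
      using bal by algebra
    show "1 + d - a \<notin> \<int>" "1 + c - a \<notin> \<int>" "1 + b - a \<notin> \<int>"
      using nonint by (simp_all flip: add_diff_eq)
    show "1 + c - a - (1 + d - a) \<notin> \<int>" "1 + b - a - (1 + d - a) \<notin> \<int>" "1 + c - a - (1 + b - a) \<notin> \<int>"
      using nonint neg by simp_all
  qed
  also have "\<dots> = L c (1 + c - e) (1 + c - f) (1 + c - g) (1 + c - b) (1 + c - a) (1 + c - d)"
    by (simp add: algebra_simps)
  also have "\<dots> = (X * Ab' - Y * Ac') / sinpi (b - c)"
  proof -
    have s: "sinpi (1 + c - b) = sinpi (b - c)"
      using sinpi_plus_1[of "c - b"] sinpi_swap[of c b] by (simp add: add_diff_eq)
    have l: "1 + c - (1 + c - b) = b" "1 + (1 + c - e) - (1 + c - b) = 1 + b - e"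
      "1 + (1 + c - f) - (1 + c - b) = 1 + b - f" "1 + (1 + c - g) - (1 + c - b) = 1 + b - g"
      "2 - (1 + c - b) = 1 + b - c" "1 + (1 + c - a) - (1 + c - b) = 1 + b - a"
      "1 + (1 + c - d) - (1 + c - b) = 1 + b - d" by simp_all
    show ?thesis
      unfolding L_def X_def Y_def Ab'_def Ac'_def A_def s l
      by (simp add: hyp4F3_swap diff_divide_distrib mult_ac)
  qed
  finally have "Ac * L (1 - a) (e - a) (f - a) (g - a) (1 + d - a) (1 + c - a) (1 + b - a)
    = (Ac * X * Ab' - (Ac * Ac') * Y) / sinpi (b - c)"
    by (simp add: algebra_simps)
  also have "Ac * Ac' = sinpi c * Q c / of_real pi ^ 4"
    unfolding Ac_def Ac'_def Q_def by (rule A_reflection)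
  also have "Ac * X = residue_series c a b d e f g * (sinpi (a - c) * sinpi (b - c) * sinpi (d - c)) / of_real pi ^ 3"
    unfolding Ac_def X_def using neg nonint by (intro A_times_hyp4F3)
  finally have *: "Ac * L (1 - a) (e - a) (f - a) (g - a) (1 + d - a) (1 + c - a) (1 + b - a)
    = (residue_series c a b d e f g * (sinpi (a - c) * sinpi (b - c) * sinpi (d - c)) / of_real pi ^ 3 * Ab'
       - sinpi c * Q c / of_real pi ^ 4 * Y) / sinpi (b - c)" .
  have nz: "sinpi b \<noteq> 0" "Q b \<noteq> 0" "sinpi (b - c) \<noteq> 0"
    using b neg by (simp_all add: Q_def sinpi_eq_0_iff)
  have "Ab * Ab' = sinpi b * Q b / of_real pi ^ 4"
    unfolding Ab_def Ab'_def Q_def by (rule A_reflection)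
  moreover have "Ab * Y = residue_series b a c d e f g * (sinpi (a - b) * sinpi (c - b) * sinpi (d - b)) / of_real pi ^ 3"
    unfolding Ab_def Y_def using neg nonint by (intro A_times_hyp4F3)
  ultimately have "Ab * (Y * (sinpi b * Q b / of_real pi ^ 4)) = Ab * (Ab' * (residue_series b a c d e f g * (sinpi (a - b) * sinpi (c - b) * sinpi (d - b)) / of_real pi ^ 3))"
    by algebra
  \<comment> \<open>The series \<open>Y\<close> becomes a residue series only after multiplication
    by \<open>Ab\<close>, which is cancelled again. It is nonzero since \<open>Ab * Ab'\<close> is a
    product of nonvanishing sines divided by a power of pi.\<close>
  moreover have "Ab \<noteq> 0"
    using \<open>Ab * Ab' = _\<close> nz by auto
  ultimately have "Y * (sinpi b * Q b / of_real pi ^ 4) = Ab' * (residue_series b a c d e f g * (sinpi (a - b) * sinpi (c - b) * sinpi (d - b)) / of_real pi ^ 3)"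
    by (simp only: mult_left_cancel not_False_eq_True)
  then have Y: "Y / of_real pi ^ 4 = Ab' * (residue_series b a c d e f g * (sinpi (a - b) * sinpi (c - b) * sinpi (d - b)) / of_real pi ^ 3) / (sinpi b * Q b)"
    using nz by (simp add: field_simps)
  have "sinpi c * Q c / of_real pi ^ 4 * Y = sinpi c * Q c * (Y / of_real pi ^ 4)" by simp
  also note Y
  also have "sinpi (c - b) = - sinpi (b - c)" by (rule sinpi_swap)
  finally have **: "sinpi c * Q c / of_real pi ^ 4 * Y = - (Ab' / of_real pi ^ 3 * (sinpi c * Q c / (sinpi b * Q b) * residue_series b a c d e f g * (sinpi (a - b) * sinpi (d - b)))) * sinpi (b - c)"
    by simp
  show ?thesis
    unfolding Ac_def[symmetric] Ab'_def[symmetric] * ** using nz(3) by (simp add: diff_divide_distrib add_divide_distrib distrib_left)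
qed

text \<open>Up to the common factor \<open>Ab' / p ^ 7\<close>, the left side is linear in
  \<open>ra\<close>, \<open>rb\<close>, \<open>rc\<close>, \<open>rd\<close>. All four coefficients
  equal \<open>l\<close>, so the sum of the residue series, which is zero, can be factored
  out.\<close>

lemma proposition6p11_generic:
  assumes nonint: "b - a \<notin> \<int>" "c - a \<notin> \<int>" "d - a \<notin> \<int>" "c - b \<notin> \<int>" "d - b \<notin> \<int>" "d - c \<notin> \<int>"
    and abcd: "a \<notin> \<int>" "b \<notin> \<int>" "c \<notin> \<int>" "d \<notin> \<int>"
    and efg: "e \<notin> \<int>" "f \<notin> \<int>" "g \<notin> \<int>"
    and b: "e - b \<notin> \<int>" "f - b \<notin> \<int>" "g - b \<notin> \<int>"
    and bal: "e + f + g = 1 + a + b + c + d"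
  shows "S [d - c] * A (1 - a) (e - a) (f - a) (g - a)
           * A (1 - a) (1 - b) (1 - c) (1 - d)
           * A b (1 + b - e) (1 + b - f) (1 + b - g) * K_p0 (a, b, c, d, e, f, g)
       - A (1 - c) (e - c) (f - c) (g - c) * B1 (a, b, d, c, e, f, g) * L_1bar (a, b, c, d, e, f, g)
       + A (1 - d) (e - d) (f - d) (g - d) * B1 (a, b, c, d, e, f, g) * L_2bar (a, b, c, d, e, f, g) = 0"
proof -
  have neg: "a - b \<notin> \<int>" "a - c \<notin> \<int>" "a - d \<notin> \<int>" "b - c \<notin> \<int>" "b - d \<notin> \<int>" "c - d \<notin> \<int>"
    using nonint by (metis minus_diff_eq minus_in_Ints_iff)+
  define Q where "Q = (\<lambda>x. sinpi (e - x) * sinpi (f - x) * sinpi (g - x))"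
  define p where "p = (of_real pi :: complex)"
  define Ab' where "Ab' = A b (1 + b - e) (1 + b - f) (1 + b - g)"
  define ra rb rc rd where "ra = residue_series a b c d e f g" and "rb = residue_series b a c d e f g"
    and "rc = residue_series c a b d e f g" and "rd = residue_series d a b c e f g"
  define sa sb sc sd where "sa = sinpi a" and "sb = sinpi b" and "sc = sinpi c" and "sd = sinpi d"
  define ca cb cc cd where "ca = cospi a" and "cb = cospi b" and "cc = cospi c" and "cd = cospi d"
  have p: "p \<noteq> 0" by (simp add: p_def)
  have nz: "sa \<noteq> 0" "sb \<noteq> 0" "sc \<noteq> 0" "sd \<noteq> 0" "Q b \<noteq> 0"
    using abcd b by (simp_all add: sa_def sb_def sc_def sd_def Q_def sinpi_eq_0_iff)
  have sum0: "ra + rb + rc + rd = 0"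
    unfolding ra_def rb_def rc_def rd_def by (rule sum_residue_series_eq_0[OF nonint bal])
  define F where "F = ra * ca / sa + rb * cb / sb + rc * cc / sc + rd * cd / sd"
  have efg': "e \<notin> \<int>\<^sub>\<le>\<^sub>0" "f \<notin> \<int>\<^sub>\<le>\<^sub>0" "g \<notin> \<int>\<^sub>\<le>\<^sub>0" using efg by auto
  have Dig: "Digamma (1 - x) - Digamma x = p * (cospi x / sinpi x)" if "x \<notin> \<int>" for x
    using Digamma_reflection[OF that] that by (simp add: field_simps p_def cospi_def sinpi_eq_0_iff)
  have f0: "hyp4F3 a b c d e f g * (Gamma a * Gamma b * Gamma c * Gamma d * (rGamma e * rGamma f * rGamma g)) = p * F"
    unfolding hyp4F3_eq_sum_residue_series[OF nonint abcd efg' bal] Dig[OF abcd(1)] Dig[OF abcd(2)] Dig[OF abcd(3)] Dig[OF abcd(4)]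
    by (simp add: F_def ra_def rb_def rc_def rd_def sa_def sb_def sc_def sd_def ca_def cb_def cc_def cd_def algebra_simps)
  define Ad where "Ad = rGamma a * rGamma b * rGamma c * rGamma d"
  have "Ad * (p * F) = hyp4F3 a b c d e f g * (rGamma e * rGamma f * rGamma g)
     * ((Gamma a * rGamma a) * (Gamma b * rGamma b) * (Gamma c * rGamma c) * (Gamma d * rGamma d))"
    unfolding f0[symmetric] Ad_def by (simp add: mult_ac)
  then have F0: "hyp4F3 a b c d e f g * (rGamma e * rGamma f * rGamma g) = Ad * (p * F)"
    by (simp add: Gamma_times_rGamma abcd)
  have AA: "A (1 - a) (1 - b) (1 - c) (1 - d) * Ad = sa * sb * sc * sd / p ^ 4"
  proof -
    have "A (1 - a) (1 - b) (1 - c) (1 - d) * Ad = (rGamma a * rGamma (1 - a)) * (rGamma b * rGamma (1 - b))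
      * (rGamma c * rGamma (1 - c)) * (rGamma d * rGamma (1 - d))"
      by (simp add: A_def Ad_def mult_ac)
    then show ?thesis
      unfolding rGamma_reflection by (simp add: sa_def sb_def sc_def sd_def p_def power4_eq_xxxx)
  qed
  define Va where "Va = sinpi (b - a) * sinpi (c - a) * sinpi (d - a)"
  define Aa where "Aa = A (1 - a) (e - a) (f - a) (g - a)"
  define Aa' where "Aa' = A a (1 + a - e) (1 + a - f) (1 + a - g)"
  define Ga where "Ga = hyp4F3 a (1 + a - e) (1 + a - f) (1 + a - g) (1 + a - b) (1 + a - c) (1 + a - d)
     * (rGamma (1 + a - b) * rGamma (1 + a - c) * rGamma (1 + a - d))"
  have "K_p0 (a, b, c, d, e, f, g) = (hyp4F3 a b c d e f g * (rGamma e * rGamma f * rGamma g) * Aa' + Ga * Ad) / sa"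
    by (simp add: K_def Aa'_def Ga_def Ad_def A_def sa_def add_divide_distrib mult_ac)
  also have "\<dots> = Ad * (p * F * Aa' + Ga) / sa"
    unfolding F0 by (simp add: algebra_simps)
  finally have "S [d - c] * Aa * A (1 - a) (1 - b) (1 - c) (1 - d) * Ab' * K_p0 (a, b, c, d, e, f, g)
    = S [d - c] * Ab' * ((A (1 - a) (1 - b) (1 - c) (1 - d) * Ad) * (p * F * (Aa * Aa') + Aa * Ga)) / sa"
    by (simp add: algebra_simps)
  also have "Aa * Aa' = sa * Q a / p ^ 4"
    unfolding Aa_def Aa'_def sa_def Q_def p_def by (rule A_reflection)
  also have "Aa * Ga = ra * Va / p ^ 3"
    unfolding Aa_def Ga_def ra_def Va_def p_def by (rule A_times_hyp4F3[OF nonint(1-3)])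
  also have "p * F * (sa * Q a / p ^ 4) = F * sa * Q a / p ^ 3"
    using p by (simp add: power4_eq_xxxx power3_eq_cube mult_ac)
  also note AA
  finally have T1: "S [d - c] * Aa * A (1 - a) (1 - b) (1 - c) (1 - d) * Ab' * K_p0 (a, b, c, d, e, f, g)
    = Ab' / p ^ 7 * (sinpi (d - c) * (sb * sc * sd) * (F * sa * Q a + ra * Va))"
    using nz p by (simp add: S_def divide_simps)
  have pw: "x / p ^ 4 * (y / p ^ 3 * z) = y / p ^ 7 * (x * z)" for x y z
    by (simp flip: power_add)
  have B2: "B1 (a, b, d, c, e, f, g) = sb * sd * (sinpi (b - a) * sinpi (d - a) * sc + Q a) / p ^ 4"
    by (simp add: S_def sb_def sc_def sd_def Q_def p_def mult_ac)
  have L2: "A (1 - c) (e - c) (f - c) (g - c) * L_1bar (a, b, c, d, e, f, g)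
    = Ab' / p ^ 3 * (rc * (sinpi (a - c) * sinpi (d - c)) + sc * Q c / (sb * Q b) * rb * (sinpi (a - b) * sinpi (d - b)))"
    using A_times_L_bar[OF nonint abcd(2) b bal]
    by (simp add: Ab'_def rc_def rb_def sc_def sb_def Q_def p_def)
  have "A (1 - c) (e - c) (f - c) (g - c) * B1 (a, b, d, c, e, f, g) * L_1bar (a, b, c, d, e, f, g)
    = B1 (a, b, d, c, e, f, g) * (A (1 - c) (e - c) (f - c) (g - c) * L_1bar (a, b, c, d, e, f, g))"
    by (simp only: mult_ac)
  also have "\<dots> = sb * sd * (sinpi (b - a) * sinpi (d - a) * sc + Q a) / p ^ 4
    * (Ab' / p ^ 3 * (rc * (sinpi (a - c) * sinpi (d - c)) + sc * Q c / (sb * Q b) * rb * (sinpi (a - b) * sinpi (d - b))))"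
    by (simp only: B2 L2)
  also note pw
  finally have T2: "A (1 - c) (e - c) (f - c) (g - c) * B1 (a, b, d, c, e, f, g) * L_1bar (a, b, c, d, e, f, g)
    = Ab' / p ^ 7 * (sb * sd * (sinpi (b - a) * sinpi (d - a) * sc + Q a)
       * (rc * (sinpi (a - c) * sinpi (d - c)) + sc * Q c / (sb * Q b) * rb * (sinpi (a - b) * sinpi (d - b))))" .
  have B3: "B1 (a, b, c, d, e, f, g) = sb * sc * (sinpi (b - a) * sinpi (c - a) * sd + Q a) / p ^ 4"
    by (simp add: S_def sb_def sc_def sd_def Q_def p_def mult_ac)
  \<comment> \<open>The case of \<open>L2\<close> with c and d exchanged; the residue series and
    \<open>L\<close> are symmetric in the parameters that change places.\<close>
  have L3: "A (1 - d) (e - d) (f - d) (g - d) * L_2bar (a, b, c, d, e, f, g)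
    = Ab' / p ^ 3 * (rd * (sinpi (a - d) * sinpi (c - d)) + sd * Q d / (sb * Q b) * rb * (sinpi (a - b) * sinpi (c - b)))"
  proof -
    have "e + f + g = 1 + a + b + d + c" using bal by simp
    from A_times_L_bar[OF nonint(1,3,2,5,4) neg(6) abcd(2) b this] show ?thesis
      by (simp add: Ab'_def rd_def rb_def sd_def sb_def Q_def p_def residue_series_swap L_swap[of _ _ _ _ _ "1 + b - a" "1 + d - a"])
  qed
  have "A (1 - d) (e - d) (f - d) (g - d) * B1 (a, b, c, d, e, f, g) * L_2bar (a, b, c, d, e, f, g)
    = B1 (a, b, c, d, e, f, g) * (A (1 - d) (e - d) (f - d) (g - d) * L_2bar (a, b, c, d, e, f, g))"
    by (simp only: mult_ac)
  also have "\<dots> = sb * sc * (sinpi (b - a) * sinpi (c - a) * sd + Q a) / p ^ 4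
    * (Ab' / p ^ 3 * (rd * (sinpi (a - d) * sinpi (c - d)) + sd * Q d / (sb * Q b) * rb * (sinpi (a - b) * sinpi (c - b))))"
    by (simp only: B3 L3)
  also note pw
  finally have T3: "A (1 - d) (e - d) (f - d) (g - d) * B1 (a, b, c, d, e, f, g) * L_2bar (a, b, c, d, e, f, g)
    = Ab' / p ^ 7 * (sb * sc * (sinpi (b - a) * sinpi (c - a) * sd + Q a)
       * (rd * (sinpi (a - d) * sinpi (c - d)) + sd * Q d / (sb * Q b) * rb * (sinpi (a - b) * sinpi (c - b))))" .
  \<comment> \<open>The coefficient of \<open>ra\<close>, read off from \<open>T1\<close>; the
    coefficients of \<open>rb\<close>, \<open>rc\<close>, \<open>rd\<close> are compared with
    it.\<close>
  define l where "l = sinpi (d - c) * sb * sc * sd * (Q a * ca + Va)"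
  \<comment> \<open>Eliminates all cosines except \<open>ca\<close>, the only one occurring in
    \<open>l\<close>.\<close>
  have sub: "sa * cb = sinpi (a - b) + ca * sb" "sa * cc = sinpi (a - c) + ca * sc" "sa * cd = sinpi (a - d) + ca * sd"
    by (simp_all add: sinpi_def cospi_def sa_def sb_def sc_def sd_def ca_def cb_def cc_def cd_def
        right_diff_distrib sin_diff mult_ac)
  note swap = sinpi_swap[of a b] sinpi_swap[of a c] sinpi_swap[of a d] sinpi_swap[of c d]
  have lc: "sinpi (d - c) * (sb * sd) * (sa * cc) * Q a
      - sb * sd * (sinpi (b - a) * sinpi (d - a) * sc + Q a) * (sinpi (a - c) * sinpi (d - c)) = l"
    unfolding sub l_def Va_def swap by algebra
  have ld: "sinpi (d - c) * (sb * sc) * (sa * cd) * Q a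
      + sb * sc * (sinpi (b - a) * sinpi (c - a) * sd + Q a) * (sinpi (a - d) * sinpi (c - d)) = l"
    unfolding sub l_def Va_def swap by algebra
  \<comment> \<open>The coefficient of \<open>rb\<close> has denominator \<open>sb * Q b\<close>.
    Once \<open>Q b\<close> is cleared, its deviation from \<open>l\<close> is a multiple of the
    expression in \<open>trig_quadratic\<close>.\<close>
  have "Q b * (sinpi (d - c) * (sc * sd) * (sa * cb) * Q a)
      - sd * (sinpi (b - a) * sinpi (d - a) * sc + Q a) * (sc * Q c * (sinpi (a - b) * sinpi (d - b)))
      + sc * (sinpi (b - a) * sinpi (c - a) * sd + Q a) * (sd * Q d * (sinpi (a - b) * sinpi (c - b))) - Q b * l
     = sc * sd * sinpi (a - b) * (sinpi (d - c) * Q b * (Q a + sb * sinpi (c - a) * sinpi (d - a))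
    - Q c * sinpi (d - b) * (Q a + sinpi (b - a) * sinpi (d - a) * sc)
    + Q d * sinpi (c - b) * (Q a + sinpi (b - a) * sinpi (c - a) * sd))"
    unfolding sub l_def Va_def swap by algebra
  also have "\<dots> = 0"
    using trig_quadratic[OF bal] by (simp add: Q_def sb_def sc_def sd_def)
  finally have Ql: "Q b * l = Q b * (sinpi (d - c) * (sc * sd) * (sa * cb) * Q a)
      - sd * (sinpi (b - a) * sinpi (d - a) * sc + Q a) * (sc * Q c * (sinpi (a - b) * sinpi (d - b)))
      + sc * (sinpi (b - a) * sinpi (c - a) * sd + Q a) * (sd * Q d * (sinpi (a - b) * sinpi (c - b)))"
    by simp
  have lb: "sinpi (d - c) * (sc * sd) * (sa * cb) * Q a
      - sb * sd * (sinpi (b - a) * sinpi (d - a) * sc + Q a) * (sc * Q c / (sb * Q b) * (sinpi (a - b) * sinpi (d - b)))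
      + sb * sc * (sinpi (b - a) * sinpi (c - a) * sd + Q a) * (sd * Q d / (sb * Q b) * (sinpi (a - b) * sinpi (c - b))) = l"
    (is "?l = l")
  proof -
    define m n where "m = sc * Q c / (sb * Q b)" and "n = sd * Q d / (sb * Q b)"
    have "m * (sb * Q b) = sc * Q c" "n * (sb * Q b) = sd * Q d"
      using nz by (simp_all add: m_def n_def)
    then have "Q b * ?l = Q b * l"
      unfolding m_def[symmetric] n_def[symmetric] Ql by algebra
    then show ?thesis
      using nz(5) by (simp only: mult_left_cancel not_False_eq_True)
  qed
  have "sinpi (d - c) * (sb * sc * sd) * (F * sa * Q a + ra * Va)
    - sb * sd * (sinpi (b - a) * sinpi (d - a) * sc + Q a)
       * (rc * (sinpi (a - c) * sinpi (d - c)) + sc * Q c / (sb * Q b) * rb * (sinpi (a - b) * sinpi (d - b)))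
    + sb * sc * (sinpi (b - a) * sinpi (c - a) * sd + Q a)
       * (rd * (sinpi (a - d) * sinpi (c - d)) + sd * Q d / (sb * Q b) * rb * (sinpi (a - b) * sinpi (c - b)))
    = l * (ra + rb + rc + rd)"
  proof -
    have Fs: "sb * sc * sd * (F * sa) = sb * sc * sd * (ra * ca) + sc * sd * (sa * cb) * rb + sb * sd * (sa * cc) * rc
      + sb * sc * (sa * cd) * rd"
      using nz by (simp add: F_def field_simps)
    define m n where "m = sc * Q c / (sb * Q b)" and "n = sd * Q d / (sb * Q b)"
    show ?thesis
      using Fs lb lc ld unfolding m_def[symmetric] n_def[symmetric] l_def by algebra
  qed
  then have "Ab' / p ^ 7 * (sinpi (d - c) * (sb * sc * sd) * (F * sa * Q a + ra * Va)
    - sb * sd * (sinpi (b - a) * sinpi (d - a) * sc + Q a)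
       * (rc * (sinpi (a - c) * sinpi (d - c)) + sc * Q c / (sb * Q b) * rb * (sinpi (a - b) * sinpi (d - b)))
    + sb * sc * (sinpi (b - a) * sinpi (c - a) * sd + Q a)
       * (rd * (sinpi (a - d) * sinpi (c - d)) + sd * Q d / (sb * Q b) * rb * (sinpi (a - b) * sinpi (c - b)))) = 0"
    by (simp add: sum0)
  then show ?thesis
    unfolding Aa_def[symmetric] Ab'_def[symmetric] T1 T2 T3
    by (simp only: distrib_left right_diff_distrib)
qed

section \<open>Continuity in the parameters\<close>

lemma pochhammer_tendsto:
  fixes x :: "'p \<Rightarrow> complex"
  assumes "(x \<longlongrightarrow> x0) F"
  shows "((\<lambda>t. pochhammer (x t) n) \<longlongrightarrow> pochhammer x0 n) F"
  unfolding pochhammer_prod by (intro tendsto_prod tendsto_add assms tendsto_const)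

lemma hyp_coeff_Suc_ratio:
  "hyp_coeff a b c d e f g (Suc n) = hyp_coeff a b c d e f g n *
    (((a + of_nat n) * (b + of_nat n) * (c + of_nat n) * (d + of_nat n)) /
     ((1 + of_nat n) * (e + of_nat n) * (f + of_nat n) * (g + of_nat n)))"
  by (simp add: hyp_coeff_def pochhammer_Suc mult_ac)

text \<open>Turns a bound on ratios of successive terms into a telescoping product, hence into decay
  of order n^(-3/2). It follows from ln(1 + 1/n) \<le> 1/n and 1 - y \<le> exp(-y).\<close>

lemma one_minus_le_quotient_powr:
  assumes "n > 0"
  shows "1 - 3 / (2 * real n) \<le> (real n / real (Suc n)) powr (3/2)"
proof -
  have "ln (1 + 1 / real n) \<le> 1 / real n"
    by (rule ln_add_one_self_le_self) simp
  moreover have "1 + 1 / real n = real (Suc n) / real n"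
    using assms by (simp add: field_simps)
  ultimately have "ln (real (Suc n)) - ln (real n) \<le> 1 / real n"
    using assms by (simp add: ln_div)
  then have "- (3 / (2 * real n)) \<le> 3/2 * ln (real n / real (Suc n))"
    using assms by (simp add: ln_div field_simps)
  then have "exp (- (3 / (2 * real n))) \<le> (real n / real (Suc n)) powr (3/2)"
    using assms by (simp add: powr_def)
  moreover have "1 + - (3 / (2 * real n)) \<le> exp (- (3 / (2 * real n)))"
    by (rule exp_ge_add_one_self)
  ultimately show ?thesis by simp
qed

text \<open>At balanced parameters the ratio is 1 - 2/n up to lower order, jointly in n and t. Near
  the limit point the constant 2 may be perturbed by at most 1/2, and the remaining 3/2 still
  exceeds 1, as summability requires.\<close>

lemma hyp_coeff_ratio_eventually_le:
  fixes a b c d e f g :: "'p \<Rightarrow> complex"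
  assumes lim: "(a \<longlongrightarrow> a0) F" "(b \<longlongrightarrow> b0) F" "(c \<longlongrightarrow> c0) F" "(d \<longlongrightarrow> d0) F"
      "(e \<longlongrightarrow> e0) F" "(f \<longlongrightarrow> f0) F" "(g \<longlongrightarrow> g0) F"
    and bal: "e0 + f0 + g0 = 1 + a0 + b0 + c0 + d0"
  shows "\<forall>\<^sub>F (n, t) in sequentially \<times>\<^sub>F F.
    norm (((a t + of_nat n) * (b t + of_nat n) * (c t + of_nat n) * (d t + of_nat n)) /
     ((1 + of_nat n) * (e t + of_nat n) * (f t + of_nat n) * (g t + of_nat n))) \<le> 1 - 3 / (2 * real n)"
proof -
  let ?FF = "sequentially \<times>\<^sub>F F"
  define x where "x = (\<lambda>p::nat \<times> 'p. inverse (of_nat (fst p)) :: complex)"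
  have snd: "filterlim snd F ?FF" and fst: "filterlim fst sequentially ?FF"
    by (simp_all add: filterlim_snd filterlim_fst)
  have x: "(x \<longlongrightarrow> 0) ?FF"
    unfolding x_def by (rule filterlim_compose[OF lim_inverse_n fst])
  note l = lim[THEN filterlim_compose, OF snd]
  define u where "u = (\<lambda>z p. 1 + z (snd p :: 'p) * x p :: complex)"
  have u: "(u z \<longlongrightarrow> 1) ?FF" if "(z \<longlongrightarrow> z0) F" for z z0
    unfolding u_def using tendsto_add[OF tendsto_const tendsto_mult[OF filterlim_compose[OF that snd] x]] by simp
  note ul = u[OF lim(1)] u[OF lim(2)] u[OF lim(3)] u[OF lim(4)] u[OF lim(5)] u[OF lim(6)] u[OF lim(7)]
    u[OF tendsto_const[of 1]]
  \<comment> \<open>Every factor is divided by n. \<open>D\<close> is the scaled denominator, and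
    \<open>G\<close> is n times the scaled denominator minus numerator, telescoped by exchanging one
    factor at a time so that its limit is visible.\<close>
  define D where "D = (\<lambda>p. u (\<lambda>_. 1) p * u e p * u f p * u g p)"
  define G where "G = (\<lambda>p. (1 - a (snd p)) * (u e p * u f p * u g p) + u a p * (e (snd p) - b (snd p)) * (u f p * u g p)
    + u a p * u b p * (f (snd p) - c (snd p)) * u g p + u a p * u b p * u c p * (g (snd p) - d (snd p)))"
  have D: "(D \<longlongrightarrow> 1 * 1 * 1 * 1) ?FF"
    unfolding D_def by (intro tendsto_mult ul)
  have "(G \<longlongrightarrow> (1 - a0) * (1 * 1 * 1) + 1 * (e0 - b0) * (1 * 1) + 1 * 1 * (f0 - c0) * 1 + 1 * 1 * 1 * (g0 - d0)) ?FF"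
    unfolding G_def by (intro tendsto_add tendsto_mult tendsto_diff tendsto_const ul l)
  also have "(1 - a0) * (1 * 1 * 1) + 1 * (e0 - b0) * (1 * 1) + 1 * 1 * (f0 - c0) * 1 + 1 * 1 * 1 * (g0 - d0) = 2"
    using bal by (simp add: algebra_simps)
  finally have "(G \<longlongrightarrow> 2) ?FF" .
  from tendsto_divide[OF this D] have "((\<lambda>p. G p / D p) \<longlongrightarrow> 2) ?FF"
    by simp
  then have "\<forall>\<^sub>F p in ?FF. dist (G p / D p) 2 < 1/2"
    by (rule tendstoD) simp
  moreover have "\<forall>\<^sub>F p in ?FF. D p \<noteq> 0"
    using tendsto_imp_eventually_ne[OF D, of 0] by simp
  \<comment> \<open>From 2 on, 1 - 2/n is nonnegative and agrees with its norm.\<close>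
  moreover have "\<forall>\<^sub>F p in ?FF. fst p \<ge> 2"
    by (rule eventually_compose_filterlim[OF eventually_ge_at_top fst])
  ultimately show ?thesis
  proof eventually_elim
    case (elim p)
    obtain n t where p: "p = (n, t)" by (cases p)
    have n: "n \<ge> 2" using elim by (simp add: p)
    then have nx: "of_nat n * x p = 1" and n0: "of_nat n \<noteq> (0::complex)" by (simp_all add: x_def p)
    have un: "z t + of_nat n = of_nat n * u z p" for z
      using nx unfolding u_def p snd_conv by algebra
    have "((a t + of_nat n) * (b t + of_nat n) * (c t + of_nat n) * (d t + of_nat n)) /
     ((1 + of_nat n) * (e t + of_nat n) * (f t + of_nat n) * (g t + of_nat n))
      = (u a p * u b p * u c p * u d p) / D p"
    proof -
      have cancel: "(m * p) * (m * q) * (m * r) * (m * s) / ((m * p') * (m * q') * (m * r') * (m * s'))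
        = (p * q * r * s) / (p' * q' * r' * s')" if "m \<noteq> 0" for m p q r s p' q' r' s' :: complex
      proof -
        have "(m * p) * (m * q) * (m * r) * (m * s) / ((m * p') * (m * q') * (m * r') * (m * s'))
          = (m ^ 4 * (p * q * r * s)) / (m ^ 4 * (p' * q' * r' * s'))"
          by (simp only: power4_eq_xxxx mult_ac)
        then show ?thesis using that by simp
      qed
      show ?thesis
        unfolding un[of a] un[of b] un[of c] un[of d] un[of e] un[of f] un[of g] un[of "\<lambda>_. 1"] D_def by (rule cancel[OF n0])
    qed
    also have "u a p * u b p * u c p * u d p = D p - x p * G p"
    proof -
      have "x p * (1 - a t) = u (\<lambda>_. 1) p - u a p" "x p * (e t - b t) = u e p - u b p"
        "x p * (f t - c t) = u f p - u c p" "x p * (g t - d t) = u g p - u d p"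
        by (simp_all add: u_def p algebra_simps)
      then show ?thesis
        unfolding D_def G_def p snd_conv by algebra
    qed
    also have "(D p - x p * G p) / D p = (1 - 2 * x p) - x p * (G p / D p - 2)"
    proof -
      have "(r - y * q) / r = (1 - 2 * y) - y * (q / r - 2)" if "r \<noteq> 0" for r y q :: complex
        using that by (simp add: diff_divide_distrib right_diff_distrib)
      then show ?thesis using elim(2) by blast
    qed
    also have "norm \<dots> \<le> norm (1 - 2 * x p) + norm (x p) * norm (G p / D p - 2)"
      using norm_triangle_ineq4[of "1 - 2 * x p" "x p * (G p / D p - 2)"] by (simp add: norm_mult)
    also have "norm (1 - 2 * x p) = 1 - 2 / real n"
    proof -
      have "1 - 2 * x p = of_real (1 - 2 / real n)"
        by (simp add: x_def p divide_inverse)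
      then show ?thesis
        using n by (simp only: norm_of_real) (simp add: field_simps)
    qed
    also have "norm (x p) * norm (G p / D p - 2) \<le> (1 / real n) * (1 / 2)"
    proof (rule mult_mono)
      show "norm (x p) \<le> 1 / real n"
        by (simp add: x_def p norm_inverse divide_inverse)
      show "norm (G p / D p - 2) \<le> 1 / 2"
        using elim(1) unfolding dist_norm by (rule less_imp_le)
    qed simp_all
    finally show ?case
      by (simp add: p)
  qed
qed

text \<open>Tannery's theorem with a majorant of order n^(-3/2) that holds for all parameters near
  the limit: the ratio bound is iterated from a fixed index m, at which the term itself is bounded
  by continuity.\<close>

lemma hyp4F3_tendsto:
  fixes a b c d e f g :: "'p \<Rightarrow> complex"
  assumes lim: "(a \<longlongrightarrow> a0) F" "(b \<longlongrightarrow> b0) F" "(c \<longlongrightarrow> c0) F" "(d \<longlongrightarrow> d0) F"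
      "(e \<longlongrightarrow> e0) F" "(f \<longlongrightarrow> f0) F" "(g \<longlongrightarrow> g0) F"
    and efg: "e0 \<notin> \<int>\<^sub>\<le>\<^sub>0" "f0 \<notin> \<int>\<^sub>\<le>\<^sub>0" "g0 \<notin> \<int>\<^sub>\<le>\<^sub>0"
    and bal: "e0 + f0 + g0 = 1 + a0 + b0 + c0 + d0"
    and F: "F \<noteq> bot"
  shows "((\<lambda>t. hyp4F3 (a t) (b t) (c t) (d t) (e t) (f t) (g t)) \<longlongrightarrow> hyp4F3 a0 b0 c0 d0 e0 f0 g0) F"
proof -
  define h where "h = (\<lambda>k t. hyp_coeff (a t) (b t) (c t) (d t) (e t) (f t) (g t) k)"
  have h: "(h k \<longlongrightarrow> hyp_coeff a0 b0 c0 d0 e0 f0 g0 k) F" for k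
    unfolding h_def hyp_coeff_def
    by (intro tendsto_divide tendsto_mult pochhammer_tendsto lim tendsto_const) (use efg in \<open>simp add: pochhammer_neq_0\<close>)
  obtain P P' where P: "eventually P sequentially" "eventually P' F"
    and ratio: "\<And>n t. P n \<Longrightarrow> P' t \<Longrightarrow> norm (((a t + of_nat n) * (b t + of_nat n) * (c t + of_nat n) * (d t + of_nat n)) /
     ((1 + of_nat n) * (e t + of_nat n) * (f t + of_nat n) * (g t + of_nat n))) \<le> 1 - 3 / (2 * real n)"
    using hyp_coeff_ratio_eventually_le[OF lim bal] unfolding eventually_prod_filter by auto
  obtain m where m: "\<And>n. n \<ge> m \<Longrightarrow> P n" "m > 0"
    using P(1) unfolding eventually_sequentially by (metis le_Suc_eq nat_le_linear not_gr_zero zero_less_Suc order_trans le_0_eq)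
  define B where "B = norm (hyp_coeff a0 b0 c0 d0 e0 f0 g0 m) + 1"
  have "\<forall>\<^sub>F t in F. norm (h m t) < B"
    by (rule order_tendstoD(2)[OF tendsto_norm[OF h]]) (simp add: B_def)
  with P(2) have ev: "\<forall>\<^sub>F t in F. P' t \<and> norm (h m t) < B"
    by (rule eventually_conj)
  have bound: "norm (h n t) \<le> B * real m powr (3/2) * real n powr (-3/2)" if "n \<ge> m" "P' t" "norm (h m t) < B" for n t
    using that(1)
  proof (induction n rule: dec_induct)
    case base
    then show ?case using that(3) m(2) by (simp add: powr_minus field_simps)
  next
    case (step n)
    then have n: "n > 0" using m(2) by linarith
    have "norm (h (Suc n) t) = norm (h n t) * norm (((a t + of_nat n) * (b t + of_nat n) * (c t + of_nat n) * (d t + of_nat n)) /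
     ((1 + of_nat n) * (e t + of_nat n) * (f t + of_nat n) * (g t + of_nat n)))"
      unfolding h_def hyp_coeff_Suc_ratio by (rule norm_mult)
    also have "\<dots> \<le> norm (h n t) * (real n / real (Suc n)) powr (3/2)"
      using ratio[OF m(1)[OF step.hyps(1)] that(2)] one_minus_le_quotient_powr[OF n]
      by (intro mult_left_mono) auto
    also have "\<dots> \<le> B * real m powr (3/2) * real n powr (-3/2) * (real n / real (Suc n)) powr (3/2)"
      by (intro mult_right_mono step.IH) simp
    also have "\<dots> = B * real m powr (3/2) * real (Suc n) powr (-3/2)"
      using n by (simp add: powr_divide powr_minus field_simps del: of_nat_Suc)
    finally show ?case .
  qed
  have bnd: "\<forall>\<^sub>F (n, t) in sequentially \<times>\<^sub>F F. norm (h n t) \<le> B * real m powr (3/2) * real n powr (-3/2)"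
    unfolding eventually_prod_filter
    by (rule exI[of _ "\<lambda>n. n \<ge> m"], rule exI[of _ "\<lambda>t. P' t \<and> norm (h m t) < B"])
       (use ev bound in \<open>auto simp: eventually_ge_at_top\<close>)
  have sm: "summable (\<lambda>n. B * real m powr (3/2) * real n powr (-3/2))"
    by (intro summable_mult) (simp add: summable_real_powr_iff)
  have "((\<lambda>t. \<Sum>k. h k t) \<longlongrightarrow> (\<Sum>k. hyp_coeff a0 b0 c0 d0 e0 f0 g0 k)) F"
    using tannerys_theorem[OF h bnd sm F] by blast
  then show ?thesis
    by (simp add: h_def hyp4F3_eq_suminf)
qed

lemma rGamma_tendsto:
  fixes z :: "'p \<Rightarrow> complex"
  assumes "(z \<longlongrightarrow> z0) F"
  shows "((\<lambda>t. rGamma (z t)) \<longlongrightarrow> rGamma z0) F"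
  by (rule isCont_tendsto_compose[OF _ assms]) (intro continuous_intros)

lemma sinpi_tendsto:
  assumes "(z \<longlongrightarrow> z0) F"
  shows "((\<lambda>t. sinpi (z t)) \<longlongrightarrow> sinpi z0) F"
  unfolding sinpi_def
  by (rule isCont_tendsto_compose[where g = sin]) (intro isCont_sin continuous_ident tendsto_mult tendsto_const assms)+

lemma A_tendsto:
  assumes "(x \<longlongrightarrow> x0) F" "(y \<longlongrightarrow> y0) F" "(z \<longlongrightarrow> z0) F" "(w \<longlongrightarrow> w0) F"
  shows "((\<lambda>t. A (x t) (y t) (z t) (w t)) \<longlongrightarrow> A x0 y0 z0 w0) F"
  unfolding A_def by (intro tendsto_mult rGamma_tendsto assms)

lemma K_tendsto:
  assumes lim: "(a \<longlongrightarrow> a0) F" "(b \<longlongrightarrow> b0) F" "(c \<longlongrightarrow> c0) F" "(d \<longlongrightarrow> d0) F"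
      "(e \<longlongrightarrow> e0) F" "(f \<longlongrightarrow> f0) F" "(g \<longlongrightarrow> g0) F"
    and def: "K_defined a0 b0 c0 d0 e0 f0 g0"
    and bal: "e0 + f0 + g0 = 1 + a0 + b0 + c0 + d0"
    and F: "F \<noteq> bot"
  shows "((\<lambda>t. K (a t) (b t) (c t) (d t) (e t) (f t) (g t)) \<longlongrightarrow> K a0 b0 c0 d0 e0 f0 g0) F"
proof -
  have bal': "(1 + a0 - b0) + (1 + a0 - c0) + (1 + a0 - d0) = 1 + a0 + (1 + a0 - e0) + (1 + a0 - f0) + (1 + a0 - g0)"
    using bal by (simp add: algebra_simps)
  have "sinpi a0 \<noteq> 0" "e0 \<notin> \<int>\<^sub>\<le>\<^sub>0" "f0 \<notin> \<int>\<^sub>\<le>\<^sub>0" "g0 \<notin> \<int>\<^sub>\<le>\<^sub>0"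
    "1 + a0 - b0 \<notin> \<int>\<^sub>\<le>\<^sub>0" "1 + a0 - c0 \<notin> \<int>\<^sub>\<le>\<^sub>0" "1 + a0 - d0 \<notin> \<int>\<^sub>\<le>\<^sub>0"
    using def by (auto simp: K_defined_def)
  then show ?thesis
    unfolding K_def
    by (intro tendsto_add tendsto_mult tendsto_divide hyp4F3_tendsto rGamma_tendsto sinpi_tendsto
        tendsto_diff tendsto_const lim bal bal' F)
qed

lemma L_tendsto:
  assumes lim: "(a \<longlongrightarrow> a0) F" "(b \<longlongrightarrow> b0) F" "(c \<longlongrightarrow> c0) F" "(d \<longlongrightarrow> d0) F"
      "(e \<longlongrightarrow> e0) F" "(f \<longlongrightarrow> f0) F" "(g \<longlongrightarrow> g0) F"
    and def: "L_defined a0 b0 c0 d0 e0 f0 g0"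
    and bal: "e0 + f0 + g0 = 1 + a0 + b0 + c0 + d0"
    and F: "F \<noteq> bot"
  shows "((\<lambda>t. L (a t) (b t) (c t) (d t) (e t) (f t) (g t)) \<longlongrightarrow> L a0 b0 c0 d0 e0 f0 g0) F"
proof -
  have bal': "(2 - e0) + (1 + f0 - e0) + (1 + g0 - e0)
      = 1 + (1 + a0 - e0) + (1 + b0 - e0) + (1 + c0 - e0) + (1 + d0 - e0)"
    using bal by (simp add: algebra_simps)
  have "sinpi e0 \<noteq> 0" "e0 \<notin> \<int>\<^sub>\<le>\<^sub>0" "f0 \<notin> \<int>\<^sub>\<le>\<^sub>0" "g0 \<notin> \<int>\<^sub>\<le>\<^sub>0"
    "2 - e0 \<notin> \<int>\<^sub>\<le>\<^sub>0" "1 + f0 - e0 \<notin> \<int>\<^sub>\<le>\<^sub>0" "1 + g0 - e0 \<notin> \<int>\<^sub>\<le>\<^sub>0"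
    using def by (auto simp: L_defined_def)
  then show ?thesis
    unfolding L_def
    by (intro tendsto_diff[of "\<lambda>t. hyp4F3 _ _ _ _ _ _ _ / _ * _"] tendsto_mult tendsto_divide hyp4F3_tendsto rGamma_tendsto sinpi_tendsto
        tendsto_add tendsto_diff tendsto_const lim bal bal' F)
qed

section \<open>Approximation by generic parameters\<close>

text \<open>The point z may itself be an integer. The other integers form a closed set avoiding z,
  and z is excluded because t v is nonzero for t > 0.\<close>

lemma eventually_perturbed_not_Ints:
  fixes z :: complex and v :: real
  assumes "v \<noteq> 0"
  shows "\<forall>\<^sub>F t in at_right 0. z + of_real (t * v) \<notin> \<int>"
proof -
  have "closed (\<int> - {z})"
    by (rule closed_subset_Ints) auto
  then have "open (- (\<int> - {z}))" by (rule open_Compl)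
  moreover have "((\<lambda>t::real. z + of_real (t * v)) \<longlongrightarrow> z + of_real (0 * v)) (at_right 0)"
    by (intro tendsto_intros)
  ultimately have "\<forall>\<^sub>F t in at_right 0. z + of_real (t * v) \<in> - (\<int> - {z})"
    by (intro topological_tendstoD) auto
  moreover have "\<forall>\<^sub>F t in at_right (0::real). t > 0"
    by (rule eventually_at_right_less)
  ultimately show ?thesis
    by eventually_elim (use assms in auto)
qed

theorem proposition6p11:
  fixes a b c d e f g :: complex and x :: complex7
  assumes "x = (a, b, c, d, e, f, g)"
    and "x \<in> V"
    and "K_p0_defined x"
    and "L_1bar_defined x"
    and "L_2bar_defined x"
  shows "S [d - c] * A (1 - a) (e - a) (f - a) (g - a)
           * A (1 - a) (1 - b) (1 - c) (1 - d)
           * A b (1 + b - e) (1 + b - f) (1 + b - g) * K_p0 x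
       - A (1 - c) (e - c) (f - c) (g - c) * B1 (a, b, d, c, e, f, g) * L_1bar x
       + A (1 - d) (e - d) (f - d) (g - d) * B1 x * L_2bar x = 0"
proof -
  have bal: "e + f + g = 1 + a + b + c + d"
    using assms(1,2) by (auto simp: V_def algebra_simps)
  define F where "F = at_right (0::real)"
  have F: "F \<noteq> bot" by (simp add: F_def)
  define s where "s = (\<lambda>z v t. z + of_real (t * v) :: complex)"
  have lim: "(s z v \<longlongrightarrow> z) F" for z v
  proof -
    have "((\<lambda>t::real. z + of_real (t * v)) \<longlongrightarrow> z + of_real (0 * v)) (at_right 0)"
      by (intro tendsto_intros)
    then show ?thesis by (simp add: s_def F_def)
  qed
  define E where "E = (\<lambda>a b c d e f g. S [d - c] * A (1 - a) (e - a) (f - a) (g - a)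
           * A (1 - a) (1 - b) (1 - c) (1 - d)
           * A b (1 + b - e) (1 + b - f) (1 + b - g) * K_p0 (a, b, c, d, e, f, g)
       - A (1 - c) (e - c) (f - c) (g - c) * B1 (a, b, d, c, e, f, g) * L_1bar (a, b, c, d, e, f, g)
       + A (1 - d) (e - d) (f - d) (g - d) * B1 (a, b, c, d, e, f, g) * L_2bar (a, b, c, d, e, f, g))"
  have bal1: "(1 + d - a) + (1 + c - a) + (1 + b - a) = 1 + (1 - a) + (e - a) + (f - a) + (g - a)"
    "(1 + c - a) + (1 + b - a) + (1 + d - a) = 1 + (1 - a) + (e - a) + (f - a) + (g - a)"
    using bal by algebra+
  have def: "K_defined a b c d e f g"
    "L_defined (1 - a) (e - a) (f - a) (g - a) (1 + d - a) (1 + c - a) (1 + b - a)"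
    "L_defined (1 - a) (e - a) (f - a) (g - a) (1 + c - a) (1 + b - a) (1 + d - a)"
    using assms by simp_all
  \<comment> \<open>The speeds below preserve the balance condition and make every linear form that has to avoid the
    integers nonconstant.\<close>
  have lim0: "((\<lambda>t. E (s a 1 t) (s b 2 t) (s c 4 t) (s d 8 t) (s e 3 t) (s f 5 t) (s g 7 t)) \<longlongrightarrow> E a b c d e f g) F"
    unfolding E_def K_p0.simps L_1bar.simps L_2bar.simps B1.simps S_def list.map prod_list.Cons prod_list.Nil
    by (intro tendsto_add[of "\<lambda>t. _ - _"] tendsto_diff tendsto_mult A_tendsto K_tendsto[OF _ _ _ _ _ _ _ def(1) bal F]
        L_tendsto[OF _ _ _ _ _ _ _ def(2) bal1(1) F] L_tendsto[OF _ _ _ _ _ _ _ def(3) bal1(2) F]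
        tendsto_divide sinpi_tendsto tendsto_const lim tendsto_add) simp_all
  have ev0: "\<forall>\<^sub>F t in F. E (s a 1 t) (s b 2 t) (s c 4 t) (s d 8 t) (s e 3 t) (s f 5 t) (s g 7 t) = 0"
  proof -
    have ev: "\<forall>\<^sub>F t in F. s z v t \<notin> \<int>" if "v \<noteq> 0" for z v
      unfolding F_def s_def by (rule eventually_perturbed_not_Ints[OF that])
    have diff: "s z v t - s w u t = s (z - w) (v - u) t" for z v w u t
      by (simp add: s_def algebra_simps)
    have "\<forall>\<^sub>F t in F. s b 2 t - s a 1 t \<notin> \<int>" "\<forall>\<^sub>F t in F. s c 4 t - s a 1 t \<notin> \<int>"
      "\<forall>\<^sub>F t in F. s d 8 t - s a 1 t \<notin> \<int>" "\<forall>\<^sub>F t in F. s c 4 t - s b 2 t \<notin> \<int>"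
      "\<forall>\<^sub>F t in F. s d 8 t - s b 2 t \<notin> \<int>" "\<forall>\<^sub>F t in F. s d 8 t - s c 4 t \<notin> \<int>"
      "\<forall>\<^sub>F t in F. s a 1 t \<notin> \<int>" "\<forall>\<^sub>F t in F. s b 2 t \<notin> \<int>" "\<forall>\<^sub>F t in F. s c 4 t \<notin> \<int>"
      "\<forall>\<^sub>F t in F. s d 8 t \<notin> \<int>" "\<forall>\<^sub>F t in F. s e 3 t \<notin> \<int>" "\<forall>\<^sub>F t in F. s f 5 t \<notin> \<int>"
      "\<forall>\<^sub>F t in F. s g 7 t \<notin> \<int>" "\<forall>\<^sub>F t in F. s e 3 t - s b 2 t \<notin> \<int>"
      "\<forall>\<^sub>F t in F. s f 5 t - s b 2 t \<notin> \<int>" "\<forall>\<^sub>F t in F. s g 7 t - s b 2 t \<notin> \<int>"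
      unfolding diff by (rule ev, simp)+
    then show ?thesis
    proof eventually_elim
      case (elim t)
      have "s e 3 t + s f 5 t + s g 7 t = 1 + s a 1 t + s b 2 t + s c 4 t + s d 8 t"
        using bal by (simp add: s_def algebra_simps)
      then show ?case
        unfolding E_def using elim by (intro proposition6p11_generic)
    qed
  qed
  have "E a b c d e f g = 0"
    by (rule tendsto_unique[OF F lim0 tendsto_eventually[OF ev0]])
  then show ?thesis
    by (simp only: E_def assms(1))
qed

end
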